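(* Let $n$ be a positive integer and let $1<p<\infty$ with $p\neq n$. Let $f\in L^{1,0}(\mathbb R^n)$ be nontrivial (not identically zero). Then there exists a unique polytope $\langle f\rangle_p\in\mathcal P_0^n$ such that $$n\int_{\mathbb R^n}\Psi(-\nabla f(x))^p\,dx=\int_{S^{n-1}}\Psi(u)^p\,dS_p(\langle f\rangle_p,u)$$ for every continuous function $\Psi:\mathbb R^n\to[0,\infty)$ that is positively homogeneous of degree $1$.
   Context: $L^{1,0}(\mathbb R^n)$ is the space of piecewise affine functions: continuous $f:\mathbb R^n\to\mathbb R$ for which there are finitely many $n$-dimensional simplices $T_1,\dots,T_m\subset\mathbb R^n$ with pairwise disjoint interiors such that the restriction of $f$ to each $T_i$ is affine and $f=0$ outside $T_1\cup\dots\cup T_m$. The gradient $\nabla f$ is defined almost everywhere. A convex body is a compact convex subset of $\mathbb R^n$ with non-empty interior. $\mathcal P_0^n$ is the set of polytopes in $\mathbb R^n$ containing the origin in their interior. The support function is $h(K,x)=\max\{x\cdot y:y\in K\}$. The surface area measure $S(K,\cdot)$ of a convex body $K$ is the Borel measure on $S^{n-1}$ such that $S(K,\omega)$ is the $(n-1)$-dimensional Hausdorff measure of the set of boundary points of $K$ having a (outer unit) normal vector in $\omega$. For $K$ containing the origin in its interior, $dS_p(K,u)=h(K,u)^{1-p}dS(K,u)$. Positively homogeneous of degree $1$ means $\Psi(tx)=t\Psi(x)$ for all $t\geq 0$, $x\in\mathbb R^n$. *)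

theory Defs
  imports "HOL-Analysis.Analysis"
begin

definition piecewise_affine :: "('a::euclidean_space \<Rightarrow> real) set" where
  "piecewise_affine = {f. continuous_on UNIV f \<and>
     (\<exists>\<T>. finite \<T> \<and>
        (\<forall>T\<in>\<T>. int DIM('a) simplex T) \<and>
        pairwise (\<lambda>S T. disjnt (interior S) (interior T)) \<T> \<and>
        (\<forall>T\<in>\<T>. \<exists>a b. \<forall>x\<in>T. f x = a \<bullet> x + b) \<and>
        (\<forall>x. x \<notin> \<Union>\<T> \<longrightarrow> f x = 0))}"

text \<open>The value is unspecified at points where \<open>f\<close> is not differentiable; for piecewise affine
  functions these form a null set.\<close>
definition gradient :: "('a::euclidean_space \<Rightarrow> real) \<Rightarrow> 'a \<Rightarrow> 'a" where
  "gradient f x = (THE D. GDERIV f x :> D)"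

definition positively_homogeneous :: "('a::real_vector \<Rightarrow> real) \<Rightarrow> bool" where
  "positively_homogeneous \<Psi> \<longleftrightarrow> (\<forall>t\<ge>0. \<forall>x. \<Psi> (t *\<^sub>R x) = t * \<Psi> x)"

definition polytopes0 :: "'a::euclidean_space set set" where
  "polytopes0 = {K. polytope K \<and> 0 \<in> interior K}"

text \<open>For nonempty compact \<open>K\<close> the supremum is attained, so it is the maximum.\<close>
definition support_fun :: "'a::euclidean_space set \<Rightarrow> 'a \<Rightarrow> real" where
  "support_fun K x = (SUP y\<in>K. x \<bullet> y)"

text \<open>Hausdorff measure of dimension \<open>k\<close> as an outer measure, normalized to agree with Lebesgue
  measure on \<open>k\<close>-dimensional subspaces. In dimension 0 it is the counting measure: the
  convention \<open>0 ^ 0 = 1\<close> gives weight 1 to a singleton, and only the empty set has weight 0.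
  The boundedness condition is needed because \<open>diameter\<close> is real-valued, hence unspecified on
  unbounded sets.\<close>
definition hausdorff_weight :: "nat \<Rightarrow> 'a::euclidean_space set \<Rightarrow> real" where
  "hausdorff_weight k C = (if C = {} then 0 else unit_ball_vol (real k) * (diameter C / 2) ^ k)"

definition hausdorff_content :: "nat \<Rightarrow> real \<Rightarrow> 'a::euclidean_space set \<Rightarrow> ennreal" where
  "hausdorff_content k \<delta> A =
     (INF C \<in> {C :: nat \<Rightarrow> 'a set. A \<subseteq> (\<Union>i. C i) \<and> (\<forall>i. bounded (C i) \<and> diameter (C i) \<le> \<delta>)}.
        \<Sum>i. ennreal (hausdorff_weight k (C i)))"

definition hausdorff_measure :: "nat \<Rightarrow> 'a::euclidean_space set \<Rightarrow> ennreal" where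
  "hausdorff_measure k A = (SUP \<delta>\<in>{0<..}. hausdorff_content k \<delta> A)"

definition outer_normal :: "'a::euclidean_space set \<Rightarrow> 'a \<Rightarrow> 'a \<Rightarrow> bool" where
  "outer_normal K x u \<longleftrightarrow> norm u = 1 \<and> (\<forall>y\<in>K. u \<bullet> (y - x) \<le> 0)"

text \<open>\<open>measure_of\<close> returns the null measure when the given set function is not countably
  additive on the generated sigma-algebra. For a convex body it is countably additive: boundary
  points with more than one outer unit normal form a set of Hausdorff measure zero.\<close>
definition surface_area_measure :: "'a::euclidean_space set \<Rightarrow> 'a measure" where
  "surface_area_measure K =
     measure_of (sphere 0 1) (sets (restrict_space borel (sphere 0 1)))
       (\<lambda>\<omega>. hausdorff_measure (DIM('a) - 1) {x \<in> frontier K. \<exists>u\<in>\<omega>. outer_normal K x u})"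

definition Lp_surface_area_measure :: "real \<Rightarrow> 'a::euclidean_space set \<Rightarrow> 'a measure" where
  "Lp_surface_area_measure p K =
     density (surface_area_measure K) (\<lambda>u. ennreal (support_fun K u powr (1 - p)))"

end

theory Submission
  imports Defs
begin

text \<open>
  Almost everywhere the gradient of a piecewise affine function takes one of finitely many values, so
  the left-hand side is a finite sum \<open>\<Sum>u\<in>U. \<alpha> u * \<Psi> u powr p\<close> over unit vectors with positive weights
  (lemma \<open>piecewise_affine_gradient_integral\<close>). The directions \<open>U\<close> do not lie in a closed half-space: otherwise
  the function would be monotone along some direction, and having compact support it would vanish. The theorem
  thus becomes the \<open>L\<^sub>p\<close> Minkowski problem for a discrete measure.

  For a polytope \<open>hpoly U h\<close> given by its support numbers \<open>h\<close> in the directions \<open>U\<close>, the \<open>L\<^sub>p\<close> surface area measure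
  puts at \<open>u\<close> the mass \<open>h u powr (1 - p)\<close> times the area of the facet with normal \<open>u\<close>. The area times \<open>h u\<close> is a
  constant multiple of the volume of the cone over the facet, and cone volumes are what the proof works with.
  The constant \<open>C\<close>, which depends only on the dimension, comes from the uniqueness of translation invariant
  measures on a hyperplane (theorem \<open>hausdorff_measure_cone_volume\<close>). It is treated as an unknown positive number:
  in the existence proof a dilation adapts to it, and in the uniqueness proof it cancels.

  Existence is variational. Maximize the volume \<open>V h\<close> among all \<open>h \<ge> 0\<close> with \<open>\<Sum>u\<in>U. \<alpha> u * h u powr p = 1\<close>. All
  support numbers of a maximizer are positive: the root of the volume is concave by the Brunn--Minkowski inequality, so raising
  the vanishing ones to \<open>\<epsilon>\<close> would gain at least a multiple of \<open>\<epsilon>\<close> at a cost of order \<open>\<epsilon> powr p\<close>, and \<open>p > 1\<close>. The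
  first variation then makes each cone volume proportional to \<open>\<alpha> u * h u powr p\<close>, and since \<open>p\<close> is not the
  dimension a dilation normalizes the factor (theorem \<open>Lp_minkowski_existence\<close>).

  Uniqueness rests on Minkowski's first inequality, which follows from the Brunn--Minkowski inequality and the radial
  bound \<open>V k \<le> (\<Sum>u\<in>U. (k u / h u) ^ n * cone_volume U h u)\<close> in dimension \<open>n\<close>. For two solutions \<open>P\<close> and \<open>Q\<close>, testing
  with the support function of \<open>Q\<close> shows that the mean of \<open>(h_Q / h_P) powr p\<close> with respect to the cone volumes of
  \<open>P\<close> is the volume ratio. Jensen's and Minkowski's inequalities, for \<open>(P, Q)\<close> and for \<open>(Q, P)\<close>, force this ratio to
  be 1, and strict convexity of the power function then gives \<open>h_Q = h_P\<close> for all facet normals of \<open>P\<close>, so that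
  \<open>Q\<close> is contained in \<open>P\<close>; exchanging them gives equality (theorem \<open>Lp_minkowski_uniqueness\<close>).

  The Brunn--Minkowski inequality itself is proved with the induction of Hadwiger and Ohmann over finite unions
  of boxes.
\<close>

section \<open>Hausdorff measure\<close>

lemma hausdorff_weight_nonneg:
  assumes "bounded C" shows "0 \<le> hausdorff_weight k C"
  using diameter_ge_0[OF assms] by (simp add: hausdorff_weight_def)

lemma hausdorff_weight_mono:
  assumes "C \<subseteq> D" "bounded D"
  shows "hausdorff_weight k C \<le> hausdorff_weight k D"
proof (cases "C = {}")
  case True
  then show ?thesis using hausdorff_weight_nonneg[OF assms(2)] by (simp add: hausdorff_weight_def)
next
  case False
  then show ?thesis
    using assms diameter_subset[OF assms] diameter_ge_0[OF bounded_subset[OF assms(2,1)]]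
    by (auto simp: hausdorff_weight_def intro!: mult_left_mono power_mono)
qed

lemma hausdorff_content_le:
  assumes "A \<subseteq> (\<Union>i. C i)" "\<And>i. bounded (C i)" "\<And>i. diameter (C i) \<le> \<delta>"
  shows "hausdorff_content k \<delta> A \<le> (\<Sum>i::nat. ennreal (hausdorff_weight k (C i)))"
  unfolding hausdorff_content_def using assms by (intro INF_lower) auto

lemma hausdorff_content_geI:
  assumes "\<And>C. A \<subseteq> (\<Union>i. C i) \<Longrightarrow> (\<And>i. bounded (C i)) \<Longrightarrow> (\<And>i. diameter (C i) \<le> \<delta>)
     \<Longrightarrow> x \<le> (\<Sum>i::nat. ennreal (hausdorff_weight k (C i)))"
  shows "x \<le> hausdorff_content k \<delta> A"
  unfolding hausdorff_content_def using assms by (intro INF_greatest) auto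

lemma hausdorff_content_le_measure: "0 < \<delta> \<Longrightarrow> hausdorff_content k \<delta> A \<le> hausdorff_measure k A"
  unfolding hausdorff_measure_def by (intro SUP_upper) auto

lemma hausdorff_measure_leI:
  "(\<And>\<delta>. 0 < \<delta> \<Longrightarrow> hausdorff_content k \<delta> A \<le> x) \<Longrightarrow> hausdorff_measure k A \<le> x"
  unfolding hausdorff_measure_def by (intro SUP_least) auto

lemma hausdorff_content_antimono: "\<delta> \<le> \<epsilon> \<Longrightarrow> hausdorff_content k \<epsilon> A \<le> hausdorff_content k \<delta> A"
  by (rule hausdorff_content_geI, rule hausdorff_content_le) (auto intro: order_trans)

lemma hausdorff_measure_mono: "A \<subseteq> B \<Longrightarrow> hausdorff_measure k A \<le> hausdorff_measure k B"
  unfolding hausdorff_measure_def hausdorff_content_def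
  by (intro SUP_subset_mono order_refl INF_superset_mono) auto

lemma hausdorff_measure_empty [simp]: "hausdorff_measure k {} = 0"
proof -
  have "hausdorff_measure k ({} :: 'a set) \<le> 0"
    by (rule hausdorff_measure_leI, rule order_trans, rule hausdorff_content_le[where C = "\<lambda>_. {}"])
      (auto simp: hausdorff_weight_def)
  then show ?thesis by simp
qed

lemma hausdorff_content_countable_subadd:
  assumes "0 < \<delta>"
  shows "hausdorff_content k \<delta> (\<Union>i. A i) \<le> (\<Sum>i::nat. hausdorff_content k \<delta> (A i))"
proof (rule ennreal_le_epsilon)
  fix e :: real
  assume e: "0 < e" and fin: "(\<Sum>i. hausdorff_content k \<delta> (A i)) < top"
  have "\<exists>C. A i \<subseteq> (\<Union>j. C j) \<and> (\<forall>j. bounded (C j) \<and> diameter (C j) \<le> \<delta>) \<and>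
        (\<Sum>j::nat. ennreal (hausdorff_weight k (C j))) \<le> hausdorff_content k \<delta> (A i) + e * (1/2)^Suc i" for i
  proof -
    have "hausdorff_content k \<delta> (A i) < top"
      using fin by (metis ennreal_suminf_lessD)
    then have "hausdorff_content k \<delta> (A i) < hausdorff_content k \<delta> (A i) + e * (1/2)^Suc i"
      using e by (auto simp: less_top)
    then obtain C where "A i \<subseteq> (\<Union>j. C j)" "\<forall>j. bounded (C j) \<and> diameter (C j) \<le> \<delta>"
       "(\<Sum>j::nat. ennreal (hausdorff_weight k (C j))) < hausdorff_content k \<delta> (A i) + e * (1/2)^Suc i"
      by (subst (asm) (1) hausdorff_content_def) (auto simp: INF_less_iff)
    then show ?thesis by (intro exI[of _ C]) (auto intro: less_imp_le)
  qed
  then obtain C where C: "\<And>i. A i \<subseteq> (\<Union>j. C i j)" "\<And>i j. bounded (C i j)" "\<And>i j. diameter (C i j) \<le> \<delta>"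
     "\<And>i. (\<Sum>j::nat. ennreal (hausdorff_weight k (C i j))) \<le> hausdorff_content k \<delta> (A i) + e * (1/2)^Suc i"
    by metis
  let ?D = "\<lambda>m. case_prod C (prod_decode m)"
  have "(\<Union>i. A i) \<subseteq> (\<Union>m. ?D m)"
    using C(1) by (auto simp: subset_eq) (metis prod.case prod_encode_inverse)
  then have "hausdorff_content k \<delta> (\<Union>i. A i) \<le> (\<Sum>m. ennreal (hausdorff_weight k (?D m)))"
    using C(2,3) by (intro hausdorff_content_le) (auto split: prod.split)
  also have "\<dots> = (\<Sum>i. \<Sum>j. ennreal (hausdorff_weight k (C i j)))"
    by (rule suminf_ennreal_2dimen[where f = "\<lambda>x. ennreal (hausdorff_weight k (case_prod C x))"]) auto
  also have "\<dots> \<le> (\<Sum>i. hausdorff_content k \<delta> (A i) + e * (1/2)^Suc i)"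
    by (intro suminf_le C(4)) auto
  also have "\<dots> = (\<Sum>i. hausdorff_content k \<delta> (A i)) + (\<Sum>i. ennreal e * ennreal ((1/2) ^ Suc i))"
    using e by (subst suminf_add[symmetric])
      (auto simp del: ennreal_suminf_cmult simp add: ennreal_mult[symmetric])
  also have "\<dots> = (\<Sum>i. hausdorff_content k \<delta> (A i)) + e"
    unfolding ennreal_suminf_cmult
    by (subst suminf_ennreal_eq[OF zero_le_power power_half_series]) auto
  finally show "hausdorff_content k \<delta> (\<Union>i. A i) \<le> (\<Sum>i. hausdorff_content k \<delta> (A i)) + ennreal e" .
qed

lemma hausdorff_measure_countable_subadd:
  "hausdorff_measure k (\<Union>i. A i) \<le> (\<Sum>i::nat. hausdorff_measure k (A i))"
  by (rule hausdorff_measure_leI, rule order_trans, erule hausdorff_content_countable_subadd,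
      intro suminf_le) (auto intro: hausdorff_content_le_measure)

lemma hausdorff_measure_subadd:
  "hausdorff_measure k (A \<union> B) \<le> hausdorff_measure k A + hausdorff_measure k B"
proof -
  have "hausdorff_measure k (\<Union>i. binaryset A B i) \<le> (\<Sum>i::nat. hausdorff_measure k (binaryset A B i))"
    by (rule hausdorff_measure_countable_subadd)
  then show ?thesis
    by (simp add: UN_binaryset_eq suminf_binaryset_eq)
qed

text \<open>Once \<open>\<delta>\<close> is below the distance of the two sets, a cover by sets of diameter at most \<open>\<delta>\<close>
  splits into a cover of \<open>A\<close> and a cover of \<open>B\<close>.\<close>
lemma hausdorff_measure_metric_add:
  assumes "0 < d" "\<And>x y. x \<in> A \<Longrightarrow> y \<in> B \<Longrightarrow> d \<le> dist x y"
  shows "hausdorff_measure k A + hausdorff_measure k B \<le> hausdorff_measure k (A \<union> B)"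
proof -
  have *: "hausdorff_content k \<delta> A + hausdorff_content k \<epsilon> B \<le> hausdorff_measure k (A \<union> B)"
    if "0 < \<delta>" "0 < \<epsilon>" for \<delta> \<epsilon>
  proof -
    define \<eta> where "\<eta> = min (min \<delta> \<epsilon>) (d/2)"
    have \<eta>: "0 < \<eta>" "\<eta> \<le> \<delta>" "\<eta> \<le> \<epsilon>" "\<eta> < d" using that assms(1) by (auto simp: \<eta>_def)
    have "hausdorff_content k \<eta> A + hausdorff_content k \<eta> B \<le> hausdorff_content k \<eta> (A \<union> B)"
    proof (rule hausdorff_content_geI)
      fix C :: "nat \<Rightarrow> 'a set"
      assume C: "A \<union> B \<subseteq> (\<Union>i. C i)" "\<And>i. bounded (C i)" "\<And>i. diameter (C i) \<le> \<eta>"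
      have sep: "C i \<inter> A = {} \<or> C i \<inter> B = {}" for i
      proof (rule ccontr)
        assume "\<not> ?thesis"
        then obtain x y where "x \<in> C i" "x \<in> A" "y \<in> C i" "y \<in> B" by auto
        then have "d \<le> dist x y" "dist x y \<le> diameter (C i)"
          using assms(2) C(2) by (auto intro: diameter_bounded_bound)
        then show False using C(3)[of i] \<eta>(4) by linarith
      qed
      have dA: "diameter (C i \<inter> S) \<le> \<eta>" for i S
        by (rule order_trans[OF diameter_subset C(3)]) (use C in auto)
      have bA: "bounded (C i \<inter> S)" for i S
        using C(2) bounded_subset by blast
      have "hausdorff_content k \<eta> A + hausdorff_content k \<eta> B \<le>
         (\<Sum>i. ennreal (hausdorff_weight k (C i \<inter> A))) + (\<Sum>i. ennreal (hausdorff_weight k (C i \<inter> B)))"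
      proof (intro add_mono hausdorff_content_le dA bA)
        show "A \<subseteq> (\<Union>i. C i \<inter> A)" "B \<subseteq> (\<Union>i. C i \<inter> B)" using C(1) by auto
      qed
      also have "\<dots> = (\<Sum>i. ennreal (hausdorff_weight k (C i \<inter> A)) + ennreal (hausdorff_weight k (C i \<inter> B)))"
        by (intro suminf_add) auto
      also have "\<dots> \<le> (\<Sum>i. ennreal (hausdorff_weight k (C i)))"
      proof (intro suminf_le)
        show "ennreal (hausdorff_weight k (C i \<inter> A)) + ennreal (hausdorff_weight k (C i \<inter> B)) \<le>
           ennreal (hausdorff_weight k (C i))" for i
          using sep[of i] hausdorff_weight_mono[of "C i \<inter> A" "C i" k] hausdorff_weight_mono[of "C i \<inter> B" "C i" k] C(2)[of i]
          by (auto simp: hausdorff_weight_def[of k "{}"])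
      qed auto
      finally show "hausdorff_content k \<eta> A + hausdorff_content k \<eta> B \<le> (\<Sum>i. ennreal (hausdorff_weight k (C i)))" .
    qed
    then show ?thesis
      using hausdorff_content_antimono[OF \<eta>(2), of k A] hausdorff_content_antimono[OF \<eta>(3), of k B]
        hausdorff_content_le_measure[OF \<eta>(1), of k "A \<union> B"]
      by (meson add_mono order_trans)
  qed
  have "hausdorff_measure k A + hausdorff_measure k B =
     (SUP \<delta>\<in>{0<..}. (SUP \<epsilon>\<in>{0<..}. hausdorff_content k \<delta> A + hausdorff_content k \<epsilon> B))"
    unfolding hausdorff_measure_def
    by (subst ennreal_SUP_add_left[symmetric], simp, subst ennreal_SUP_add_right, auto)
  also have "\<dots> \<le> hausdorff_measure k (A \<union> B)"
    using * by (intro SUP_least) auto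
  finally show ?thesis .
qed

lemma diameter_similarity_image:
  fixes f :: "'a::euclidean_space \<Rightarrow> 'a"
  assumes "0 \<le> c" "\<And>x y. dist (f x) (f y) = c * dist x y" "bounded C"
  shows "diameter (f ` C) \<le> c * diameter C"
proof (rule diameter_le)
  show "f ` C \<noteq> {} \<or> 0 \<le> c * diameter C" using assms(1,3) by (auto simp: diameter_ge_0)
next
  fix x y assume "x \<in> f ` C" "y \<in> f ` C"
  then obtain a b where "a \<in> C" "b \<in> C" "x = f a" "y = f b" by auto
  then show "norm (x - y) \<le> c * diameter C"
    using assms diameter_bounded_bound[OF assms(3), of a b]
    by (metis dist_norm mult_left_mono)
qed

lemma hausdorff_measure_similarity_le:
  fixes f :: "'a::euclidean_space \<Rightarrow> 'a"
  assumes c: "0 < c" and f: "\<And>x y. dist (f x) (f y) = c * dist x y"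
  shows "hausdorff_measure k (f ` A) \<le> ennreal (c ^ k) * hausdorff_measure k A"
proof (rule hausdorff_measure_leI)
  fix \<delta> :: real assume \<delta>: "0 < \<delta>"
  have bf: "bounded (f ` C)" if "bounded C" for C
  proof -
    obtain x e where "\<And>y. y \<in> C \<Longrightarrow> dist x y \<le> e" using \<open>bounded C\<close> unfolding bounded_def by blast
    then have "f ` C \<subseteq> cball (f x) (c * e)"
      using f c by (auto intro!: mult_left_mono)
    then show ?thesis by (rule bounded_subset[OF bounded_cball])
  qed
  have "hausdorff_content k \<delta> (f ` A) \<le> ennreal (c ^ k) * hausdorff_content k (\<delta> / c) A"
  proof -
    have "hausdorff_content k \<delta> (f ` A) / ennreal (c^k) \<le> hausdorff_content k (\<delta> / c) A"
    proof (rule hausdorff_content_geI)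
      fix C :: "nat \<Rightarrow> 'a set"
      assume C: "A \<subseteq> (\<Union>i. C i)" "\<And>i. bounded (C i)" "\<And>i. diameter (C i) \<le> \<delta> / c"
      have d: "diameter (f ` C i) \<le> c * diameter (C i)" for i
        using diameter_similarity_image[of c f "C i"] c f C(2) by auto
      have "hausdorff_content k \<delta> (f ` A) \<le> (\<Sum>i. ennreal (hausdorff_weight k (f ` C i)))"
      proof (rule hausdorff_content_le)
        show "diameter (f ` C i) \<le> \<delta>" for i
          using d[of i] C(3)[of i] c by (simp add: field_simps)
        show "f ` A \<subseteq> (\<Union>i. f ` C i)" using C(1) by (simp add: image_mono flip: image_UN)
      qed (use C bf in auto)
      also have "\<dots> \<le> (\<Sum>i. ennreal (c^k) * ennreal (hausdorff_weight k (C i)))"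
      proof (intro suminf_le)
        fix i
        have *: "(diameter (f ` C i) / 2) ^ k \<le> (c * diameter (C i) / 2) ^ k"
          using d[of i] diameter_ge_0[OF bf[OF C(2)], of i] by (intro power_mono) auto
        have "hausdorff_weight k (f ` C i) \<le> c^k * hausdorff_weight k (C i)"
        proof (cases "C i = {}")
          case False
          have "unit_ball_vol (real k) * (diameter (f ` C i) / 2) ^ k \<le> unit_ball_vol (real k) * (c * diameter (C i) / 2) ^ k"
            by (intro mult_left_mono *) simp
          also have "\<dots> = c^k * (unit_ball_vol (real k) * (diameter (C i) / 2) ^ k)"
            by (simp add: power_mult_distrib power_divide)
          finally show ?thesis using False by (simp add: hausdorff_weight_def)
        qed (simp add: hausdorff_weight_def)
        then show "ennreal (hausdorff_weight k (f ` C i)) \<le> ennreal (c^k) * ennreal (hausdorff_weight k (C i))"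
          using c by (simp add: ennreal_mult[symmetric] hausdorff_weight_nonneg C(2) ennreal_leI)
      qed auto
      also have "\<dots> = (\<Sum>i. ennreal (hausdorff_weight k (C i))) * ennreal (c^k)"
        by (simp add: mult.commute)
      finally show "hausdorff_content k \<delta> (f ` A) / ennreal (c^k) \<le> (\<Sum>i. ennreal (hausdorff_weight k (C i)))"
        using c by (intro divide_le_posI_ennreal) (auto simp: mult.commute)
    qed
    then have "hausdorff_content k \<delta> (f ` A) / ennreal (c^k) * ennreal (c^k) \<le> hausdorff_content k (\<delta> / c) A * ennreal (c^k)"
      by (rule mult_right_mono) simp
    moreover have "hausdorff_content k \<delta> (f ` A) / ennreal (c^k) * ennreal (c^k) = hausdorff_content k \<delta> (f ` A)"
      using c by (simp only: ennreal_divide_times) (simp add: ennreal_divide_self)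
    ultimately show ?thesis by (simp add: mult.commute)
  qed
  also have "\<dots> \<le> ennreal (c^k) * hausdorff_measure k A"
    using \<delta> c by (intro mult_left_mono hausdorff_content_le_measure) auto
  finally show "hausdorff_content k \<delta> (f ` A) \<le> ennreal (c ^ k) * hausdorff_measure k A" .
qed

text \<open>This serves for translations, rotations and dilations alike.\<close>
lemma hausdorff_measure_similarity:
  fixes f :: "'a::euclidean_space \<Rightarrow> 'a"
  assumes c: "0 < c" and f: "\<And>x y. dist (f x) (f y) = c * dist x y" and g: "\<And>x. g (f x) = x" "\<And>x. f (g x) = x"
  shows "hausdorff_measure k (f ` A) = ennreal (c ^ k) * hausdorff_measure k A"
proof (rule antisym)
  show "hausdorff_measure k (f ` A) \<le> ennreal (c ^ k) * hausdorff_measure k A"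
    by (rule hausdorff_measure_similarity_le) (use c f in auto)
  have g': "dist (g x) (g y) = (1/c) * dist x y" for x y
    using f[of "g x" "g y"] g c by (simp add: field_simps)
  have "ennreal (c^k) * hausdorff_measure k A = ennreal (c^k) * hausdorff_measure k (g ` (f ` A))"
    by (simp add: image_image g)
  also have "\<dots> \<le> ennreal (c^k) * (ennreal ((1/c)^k) * hausdorff_measure k (f ` A))"
    by (intro mult_left_mono hausdorff_measure_similarity_le) (use c g' in auto)
  also have "\<dots> = hausdorff_measure k (f ` A)"
    using c by (simp add: mult.assoc[symmetric] ennreal_mult[symmetric] power_mult_distrib[symmetric])
  finally show "ennreal (c^k) * hausdorff_measure k A \<le> hausdorff_measure k (f ` A)" .
qed

lemma hausdorff_outer_measure_space:
  "outer_measure_space (Pow UNIV) (hausdorff_measure k :: 'a::euclidean_space set \<Rightarrow> ennreal)"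
  by (auto simp: outer_measure_space_def positive_def increasing_def countably_subadditive_def
      hausdorff_measure_mono hausdorff_measure_countable_subadd)

text \<open>Caratheodory's criterion: the part of \<open>T\<close> outside the closed set \<open>F\<close> is exhausted by the
  parts at distance at least \<open>1/j\<close> from \<open>F\<close>. What is left over is a union of shells of which
  every second one is separated from the others, so that their measures form a
  convergent series.\<close>
lemma closed_in_hausdorff_lambda_system:
  fixes F :: "'a::euclidean_space set"
  assumes F: "closed F"
  shows "F \<in> lambda_system UNIV (Pow UNIV) (hausdorff_measure k)"
proof (cases "F = {}")
  case True
  then show ?thesis by (auto simp: lambda_system_def)
next
  case ne: False
  let ?H = "hausdorff_measure k :: 'a set \<Rightarrow> ennreal"
  have key: "?H (F \<inter> T) + ?H (T - F) \<le> ?H T" for T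
  proof (cases "?H T = top")
    case True
    then show ?thesis by simp
  next
    case False
    then have Tfin: "?H S < top" if "S \<subseteq> T" for S
      using hausdorff_measure_mono[OF that, of k] by (auto simp: less_top)
    define D where "D j = {x \<in> T. 1 / real (Suc j) \<le> infdist x F}" for j
    define R where "R j = D (Suc j) - D j" for j
    have DT: "D j \<subseteq> T" for j by (auto simp: D_def)
    have Dmono: "D i \<subseteq> D j" if "i \<le> j" for i j
    proof -
      have "1 / real (Suc j) \<le> 1 / real (Suc i)" using that by (simp add: frac_le)
      then show ?thesis by (auto simp: D_def)
    qed
    have shell: "?H A + ?H (R j) \<le> ?H (A \<union> R j)" if A: "A \<subseteq> D i" and ij: "i < j" for A i j
    proof (rule hausdorff_measure_metric_add)
      show "0 < 1 / real (Suc i) - 1 / real (Suc j)"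
        using ij by (simp add: frac_less2)
      fix x y assume "x \<in> A" "y \<in> R j"
      then have "1 / real (Suc i) \<le> infdist x F" "infdist y F < 1 / real (Suc j)"
        using A DT by (auto simp: D_def R_def)
      moreover have "infdist x F \<le> infdist y F + dist x y" by (rule infdist_triangle)
      ultimately show "1 / real (Suc i) - 1 / real (Suc j) \<le> dist x y" by linarith
    qed
    have RD: "R i \<subseteq> D (Suc i)" for i by (auto simp: R_def)
    have alternate: "(\<Sum>i<N. ?H (R (2 * i + c))) \<le> ?H (\<Union>i<N. R (2 * i + c))" for N c
    proof (induction N)
      case (Suc N)
      have "(\<Sum>i<Suc N. ?H (R (2 * i + c))) \<le> ?H (\<Union>i<N. R (2 * i + c)) + ?H (R (2 * N + c))"
        using Suc by (simp add: add_right_mono)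
      also have "\<dots> \<le> ?H ((\<Union>i<N. R (2 * i + c)) \<union> R (2 * N + c))"
      proof (cases N)
        case (Suc M)
        have "R (2 * i + c) \<subseteq> D (2 * M + c + 1)" if "i < N" for i
          using order_trans[OF RD Dmono] that Suc by (metis (no_types, lifting) Suc_eq_plus1 add_le_mono1 less_Suc_eq_le mult_le_mono2)
        then have "(\<Union>i<N. R (2 * i + c)) \<subseteq> D (2 * M + c + 1)" by auto
        then show ?thesis by (rule shell) (use Suc in auto)
      qed simp
      also have "(\<Union>i<N. R (2 * i + c)) \<union> R (2 * N + c) = (\<Union>i<Suc N. R (2 * i + c))"
        by (auto simp: lessThan_Suc)
      finally show ?case .
    qed simp
    have half: "(\<Sum>i. ?H (R (2 * i + c))) \<le> ?H T" for c
    proof (rule suminf_le_const[OF summableI])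
      fix N
      have "(\<Union>i<N. R (2 * i + c)) \<subseteq> T" using RD DT by blast
      then show "(\<Sum>i<N. ?H (R (2 * i + c))) \<le> ?H T"
        by (rule order_trans[OF alternate hausdorff_measure_mono])
    qed
    have fin: "(\<Sum>i. ?H (R i)) < top"
    proof -
      have "(\<Sum>i<N. ?H (R i)) \<le> ?H T + ?H T" for N
      proof -
        have "(\<Sum>i<N. ?H (R i)) \<le> (\<Sum>i<2*N. ?H (R i))"
          by (intro sum_mono2) auto
        also have "(\<Sum>i<2*N. ?H (R i)) = (\<Sum>i<N. ?H (R (2 * i + 0))) + (\<Sum>i<N. ?H (R (2 * i + 1)))"
          by (induction N) (auto simp: algebra_simps)
        also have "\<dots> \<le> (\<Sum>i. ?H (R (2 * i + 0))) + (\<Sum>i. ?H (R (2 * i + 1)))"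
          by (intro add_mono sum_le_suminf summableI) auto
        also have "\<dots> \<le> ?H T + ?H T" by (intro add_mono half)
        finally show ?thesis .
      qed
      then have "(\<Sum>i. ?H (R i)) \<le> ?H T + ?H T" by (intro suminf_le_const summableI) auto
      also have "\<dots> < top" using Tfin[of T] by (simp add: ennreal_add_less_top)
      finally show ?thesis .
    qed
    have sepD: "?H (F \<inter> T) + ?H (D j) \<le> ?H T" for j
    proof -
      have "?H (F \<inter> T) + ?H (D j) \<le> ?H (F \<inter> T \<union> D j)"
      proof (rule hausdorff_measure_metric_add)
        show "0 < 1 / real (Suc j)" by simp
        fix x y assume "x \<in> F \<inter> T" "y \<in> D j"
        then have "infdist y F \<le> dist y x" "1 / real (Suc j) \<le> infdist y F"
          by (auto simp: D_def intro: infdist_le)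
        then show "1 / real (Suc j) \<le> dist x y" by (simp add: dist_commute)
      qed
      also have "\<dots> \<le> ?H T" using DT by (intro hausdorff_measure_mono) auto
      finally show ?thesis .
    qed
    have rest: "?H (T - F) \<le> ?H (D j) + (\<Sum>i. ?H (R (i + j)))" for j
    proof -
      have "T - F \<subseteq> D j \<union> (\<Union>i. R (i + j))"
      proof
        fix x assume x: "x \<in> T - F"
        then have "0 < infdist x F"
          using F ne in_closed_iff_infdist_zero[of F x] infdist_nonneg[of x F] by auto
        then obtain m where m: "1 / real (Suc m) < infdist x F"
          using nat_approx_posE by (metis inverse_eq_divide reals_Archimedean)
        define l where "l = (LEAST m. x \<in> D m)"
        have xl: "x \<in> D l" unfolding l_def by (rule LeastI[of _ m]) (use m x in \<open>auto simp: D_def\<close>)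
        show "x \<in> D j \<union> (\<Union>i. R (i + j))"
        proof (cases "l \<le> j")
          case True
          then show ?thesis using xl Dmono by blast
        next
          case False
          then obtain q where q: "l = Suc q" "j \<le> q" by (cases l) auto
          have "x \<notin> D q" using not_less_Least[of q "\<lambda>m. x \<in> D m"] q by (auto simp: l_def)
          then have "x \<in> R ((q - j) + j)" using xl q by (auto simp: R_def)
          then show ?thesis by blast
        qed
      qed
      then have "?H (T - F) \<le> ?H (D j \<union> (\<Union>i. R (i + j)))" by (rule hausdorff_measure_mono)
      also have "\<dots> \<le> ?H (D j) + ?H (\<Union>i. R (i + j))" by (rule hausdorff_measure_subadd)
      also have "\<dots> \<le> ?H (D j) + (\<Sum>i. ?H (R (i + j)))"
        by (intro add_left_mono hausdorff_measure_countable_subadd)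
      finally show ?thesis .
    qed
    have "(\<lambda>j. \<Sum>i. ?H (R (i + j))) \<longlonglongrightarrow> 0"
    proof -
      have r: "\<exists>r\<ge>0. ?H (R i) = ennreal r" for i
        using ennreal_suminf_lessD[OF fin, of i] by (cases "?H (R i)") auto
      then obtain r where r: "\<And>i. 0 \<le> r i" "\<And>i. ?H (R i) = ennreal (r i)" by metis
      have "summable r"
        using fin r by (intro summable_suminf_not_top) (auto simp: less_top)
      then have s: "summable (\<lambda>i. r (i + j))" for j by (simp add: summable_iff_shift)
      have "(\<lambda>j. ennreal (\<Sum>i. r (i + j))) \<longlonglongrightarrow> ennreal 0"
        by (intro tendsto_ennrealI suminf_exist_split2) (use \<open>summable r\<close> in auto)
      then show ?thesis
        using r s by (simp add: suminf_ennreal2)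
    qed
    then have "(\<lambda>j. ?H T + (\<Sum>i. ?H (R (i + j)))) \<longlonglongrightarrow> ?H T + 0"
      by (intro tendsto_add tendsto_const)
    moreover have "?H (F \<inter> T) + ?H (T - F) \<le> ?H T + (\<Sum>i. ?H (R (i + j)))" for j
    proof -
      have "?H (F \<inter> T) + ?H (T - F) \<le> (?H (F \<inter> T) + ?H (D j)) + (\<Sum>i. ?H (R (i + j)))"
        using rest[of j] by (simp add: add.assoc add_left_mono)
      also have "\<dots> \<le> ?H T + (\<Sum>i. ?H (R (i + j)))" by (intro add_right_mono sepD)
      finally show ?thesis .
    qed
    ultimately show ?thesis
      by (intro LIMSEQ_le_const[where X = "\<lambda>j. ?H T + (\<Sum>i. ?H (R (i + j)))"]) auto
  qed
  have "?H T \<le> ?H (F \<inter> T) + ?H (T - F)" for T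
  proof -
    have "?H T = ?H ((F \<inter> T) \<union> (T - F))" by (rule arg_cong[of _ _ ?H]) auto
    then show ?thesis using hausdorff_measure_subadd by metis
  qed
  then show ?thesis
    using key by (auto simp: lambda_system_def Compl_eq_Diff_UNIV[symmetric] Int_commute Diff_eq intro!: antisym)
qed

definition hausdorff_borel :: "nat \<Rightarrow> 'a::euclidean_space measure" where
  "hausdorff_borel k = measure_of UNIV (sets borel) (hausdorff_measure k)"

lemma sets_hausdorff_borel [simp, measurable_cong]: "sets (hausdorff_borel k) = sets borel"
  by (simp add: hausdorff_borel_def sets.sigma_sets_eq[of borel, simplified])

lemma space_hausdorff_borel [simp]: "space (hausdorff_borel k) = UNIV"
  by (simp add: hausdorff_borel_def)

lemma emeasure_hausdorff_borel:
  assumes "A \<in> sets borel"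
  shows "emeasure (hausdorff_borel k) A = hausdorff_measure k (A :: 'a::euclidean_space set)"
proof -
  let ?L = "lambda_system UNIV (Pow UNIV) (hausdorff_measure k :: 'a set \<Rightarrow> ennreal)"
  interpret P: sigma_algebra UNIV "Pow UNIV :: 'a set set" by (rule sigma_algebra_Pow)
  have L: "measure_space UNIV ?L (hausdorff_measure k)"
    by (rule P.caratheodory_lemma[OF hausdorff_outer_measure_space])
  then have sL: "sigma_algebra UNIV ?L" by (simp add: measure_space_def)
  have "sigma_sets UNIV {F :: 'a set. closed F} \<subseteq> ?L"
    by (rule sigma_algebra.sigma_sets_subset[OF sL]) (rule subsetI, erule CollectE, rule closed_in_hausdorff_lambda_system)
  moreover have "sets borel = sigma_sets UNIV {F :: 'a set. closed F}"
    by (subst borel_eq_closed) (rule sets_measure_of, simp)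
  ultimately have "sets borel \<subseteq> ?L" by simp
  then have "measure_space UNIV (sets borel) (hausdorff_measure k :: 'a set \<Rightarrow> ennreal)"
    by (intro measure_down[OF L]) (use sets.sigma_algebra_axioms[of borel] in auto)
  then show ?thesis
    unfolding hausdorff_borel_def
    by (intro emeasure_measure_of_sigma) (use assms in \<open>auto simp: measure_space_def\<close>)
qed

section \<open>Hausdorff measure on a hyperplane\<close>

text \<open>Integrate \<open>(x, y) \<mapsto> indicator A x * indicator B (x - y)\<close> in both orders. With \<open>y\<close> first, the
  symmetry of \<open>B\<close> and the invariance of \<open>N\<close> give the left-hand side. With \<open>x\<close> first, shifting \<open>x\<close> by \<open>y\<close>
  and exchanging the integrals once more gives the right-hand side. Invariance is assumed only
  along \<open>W\<close>, so that the lemma applies to measures living on a hyperplane.\<close>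
lemma translation_invariant_measures_proportional:
  fixes M N :: "'a::euclidean_space measure"
  assumes M: "sigma_finite_measure M" "sets M = sets borel" "AE x in M. x \<in> W"
    and N: "sigma_finite_measure N" "sets N = sets borel" "AE x in N. x \<in> W"
    and invM: "\<And>w A. w \<in> W \<Longrightarrow> A \<in> sets borel \<Longrightarrow> emeasure M ((\<lambda>x. x + w) -` A) = emeasure M A"
    and invN: "\<And>w A. w \<in> W \<Longrightarrow> A \<in> sets borel \<Longrightarrow> emeasure N ((\<lambda>x. x + w) -` A) = emeasure N A"
    and W: "\<And>w. w \<in> W \<Longrightarrow> - w \<in> W"
    and A: "A \<in> sets borel" and B: "B \<in> sets borel" "\<And>x. - x \<in> B \<longleftrightarrow> x \<in> B"
  shows "emeasure M A * emeasure N B = emeasure M B * emeasure N A"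
proof -
  interpret M: sigma_finite_measure M by fact
  interpret N: sigma_finite_measure N by fact
  interpret P: pair_sigma_finite M N by unfold_locales
  have [measurable_cong]: "sets M = sets borel" "sets N = sets borel" by fact+
  have sp: "space M = UNIV" "space N = UNIV"
    using sets_eq_imp_space_eq[OF M(2)] sets_eq_imp_space_eq[OF N(2)] by simp_all
  note [measurable] = A B(1)
  have shift: "(\<lambda>y. y + c) -` S \<in> sets borel" if "S \<in> sets borel" for c and S :: "'a set"
  proof -
    have "(\<lambda>y. y + c) \<in> borel_measurable borel" by measurable
    from measurable_sets[OF this that] show ?thesis by simp
  qed
  have "emeasure M A * emeasure N B = (\<integral>\<^sup>+x. indicator A x * emeasure N B \<partial>M)"
    by (subst nn_integral_multc) (auto simp: M(2) A)
  also have "\<dots> = (\<integral>\<^sup>+x. (\<integral>\<^sup>+y. indicator A x * indicator B (x - y) \<partial>N) \<partial>M)"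
  proof (rule nn_integral_cong_AE, use M(3) in eventually_elim)
    fix x assume "x \<in> W"
    have "(\<integral>\<^sup>+y. indicator A x * indicator B (x - y) \<partial>N) = indicator A x * (\<integral>\<^sup>+y. indicator ((\<lambda>y. y + - x) -` B) y \<partial>N)"
    proof (subst nn_integral_cmult[symmetric])
      show "(\<integral>\<^sup>+y. indicator A x * indicator B (x - y) \<partial>N) = (\<integral>\<^sup>+y. indicator A x * indicator ((\<lambda>y. y + - x) -` B) y \<partial>N)"
      proof (intro nn_integral_cong)
        fix y
        have "x - y \<in> B \<longleftrightarrow> y + - x \<in> B" using B(2)[of "x - y"] by simp
        then have "indicator B (x - y) = (indicator ((\<lambda>y. y + - x) -` B) y :: ennreal)"
          by (simp only: indicator_def vimage_eq)
        then show "indicator A x * indicator B (x - y) = (indicator A x * indicator ((\<lambda>y. y + - x) -` B) y :: ennreal)"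
          by (simp only:)
      qed
    qed measurable
    also have "\<dots> = indicator A x * emeasure N ((\<lambda>y. y + - x) -` B)"
      by (subst nn_integral_indicator) (simp_all add: M(2) N(2) A B(1) shift shift[of _ "- _", simplified] sets.Int)
    also have "\<dots> = indicator A x * emeasure N B"
      using invN[OF W[OF \<open>x \<in> W\<close>] B(1)] by simp
    finally show "indicator A x * emeasure N B = (\<integral>\<^sup>+y. indicator A x * indicator B (x - y) \<partial>N)" by simp
  qed
  also have "\<dots> = (\<integral>\<^sup>+y. (\<integral>\<^sup>+x. indicator A x * indicator B (x - y) \<partial>M) \<partial>N)"
    by (rule P.Fubini'[symmetric]) measurable
  also have "\<dots> = (\<integral>\<^sup>+y. (\<integral>\<^sup>+x. indicator B x * indicator A (x + y) \<partial>M) \<partial>N)"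
  proof (rule nn_integral_cong_AE, use N(3) in eventually_elim)
    fix y assume "y \<in> W"
    have AB: "A \<inter> (\<lambda>x. x - y) -` B \<in> sets borel"
      using shift[OF B(1), of "- y"] A by simp
    have "(\<integral>\<^sup>+x. indicator A x * indicator B (x - y) \<partial>M) = (\<integral>\<^sup>+x. indicator (A \<inter> (\<lambda>x. x - y) -` B) x \<partial>M)"
      by (intro nn_integral_cong) (simp split: split_indicator)
    also have "\<dots> = emeasure M (A \<inter> (\<lambda>x. x - y) -` B)"
      using AB by (simp add: M(2))
    also have "\<dots> = emeasure M ((\<lambda>x. x + y) -` (A \<inter> (\<lambda>x. x - y) -` B))"
      using invM[OF \<open>y \<in> W\<close> AB] by simp
    also have "(\<lambda>x. x + y) -` (A \<inter> (\<lambda>x. x - y) -` B) = B \<inter> (\<lambda>x. x + y) -` A" by auto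
    also have "emeasure M \<dots> = (\<integral>\<^sup>+x. indicator (B \<inter> (\<lambda>x. x + y) -` A) x \<partial>M)"
      by (subst nn_integral_indicator) (simp_all add: M(2) N(2) A B(1) shift shift[of _ "- _", simplified] sets.Int)
    also have "\<dots> = (\<integral>\<^sup>+x. indicator B x * indicator A (x + y) \<partial>M)"
      by (intro nn_integral_cong) (simp split: split_indicator)
    finally show "(\<integral>\<^sup>+x. indicator A x * indicator B (x - y) \<partial>M) = (\<integral>\<^sup>+x. indicator B x * indicator A (x + y) \<partial>M)" .
  qed
  also have "\<dots> = (\<integral>\<^sup>+x. (\<integral>\<^sup>+y. indicator B x * indicator A (x + y) \<partial>N) \<partial>M)"
    by (rule P.Fubini') measurable
  also have "\<dots> = (\<integral>\<^sup>+x. indicator B x * emeasure N A \<partial>M)"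
  proof (rule nn_integral_cong_AE, use M(3) in eventually_elim)
    fix x assume "x \<in> W"
    have "(\<integral>\<^sup>+y. indicator B x * indicator A (x + y) \<partial>N) = indicator B x * (\<integral>\<^sup>+y. indicator ((\<lambda>y. y + x) -` A) y \<partial>N)"
    proof (subst nn_integral_cmult[symmetric])
      show "(\<integral>\<^sup>+y. indicator B x * indicator A (x + y) \<partial>N) = (\<integral>\<^sup>+y. indicator B x * indicator ((\<lambda>y. y + x) -` A) y \<partial>N)"
        by (intro nn_integral_cong) (simp add: add.commute split: split_indicator)
    qed measurable
    also have "\<dots> = indicator B x * emeasure N ((\<lambda>y. y + x) -` A)"
      by (subst nn_integral_indicator) (simp_all add: M(2) N(2) A B(1) shift shift[of _ "- _", simplified] sets.Int)
    also have "\<dots> = indicator B x * emeasure N A"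
      using invN[OF \<open>x \<in> W\<close> A] by simp
    finally show "(\<integral>\<^sup>+y. indicator B x * indicator A (x + y) \<partial>N) = indicator B x * emeasure N A" .
  qed
  also have "\<dots> = emeasure M B * emeasure N A"
    by (subst nn_integral_multc) (auto simp: M(2) B)
  finally show ?thesis .
qed

lemma sigma_finite_measure_if_finite_on_balls:
  fixes M :: "'a::euclidean_space measure"
  assumes M: "sets M = sets borel" "\<And>n. emeasure M (cball 0 (real n)) < top"
  shows "sigma_finite_measure M"
proof
  let ?A = "range (\<lambda>n. cball (0::'a) (real n))"
  have "\<Union>?A = space M" using sets_eq_imp_space_eq[OF M(1)] by (auto simp: real_arch_simple)
  then show "\<exists>A. countable A \<and> A \<subseteq> sets M \<and> \<Union>A = space M \<and> (\<forall>a\<in>A. emeasure M a \<noteq> \<infinity>)"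
    using M by (intro exI[of _ ?A]) (auto simp: less_top)
qed

lemma lborel_translate_vimage:
  fixes A :: "'a::euclidean_space set"
  assumes "A \<in> sets borel"
  shows "emeasure lborel ((\<lambda>x. x + w) -` A) = emeasure lborel A"
proof -
  have "emeasure (distr lborel borel ((+) w)) A = emeasure lborel A"
    by (simp add: lborel_distr_plus)
  then show ?thesis
    using assms by (simp add: emeasure_distr fun_eq_iff[of "\<lambda>x. x + w" "(+) w", THEN iffD2] add.commute)
qed

lemma lborel_ball_pos_finite:
  "emeasure lborel (ball (0::'a::euclidean_space) 1) \<noteq> 0" "emeasure lborel (ball (0::'a) 1) \<noteq> top"
proof -
  have "\<not> negligible (ball (0::'a) 1)" by (rule open_not_negligible) auto
  then show "emeasure lborel (ball (0::'a::euclidean_space) 1) \<noteq> 0"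
    by (simp add: negligible_iff_emeasure0)
  show "emeasure lborel (ball (0::'a::euclidean_space) 1) \<noteq> top"
    using emeasure_lborel_ball_finite[of "0::'a" 1] by simp
qed

text \<open>The image of Lebesgue measure under \<open>f\<close> is again translation invariant; the unit ball
  determines the factor.\<close>
lemma lborel_linear_vimage:
  fixes f g :: "'a::euclidean_space \<Rightarrow> 'a"
  assumes f: "linear f" "linear g" "\<And>x. g (f x) = x" "\<And>x. f (g x) = x" and A: "A \<in> sets borel"
  shows "emeasure lborel A * emeasure lborel (f -` ball 0 1) = emeasure lborel (ball (0::'a) 1) * emeasure lborel (f -` A)"
proof -
  have cont: "continuous_on UNIV f" "continuous_on UNIV g" using f by (auto intro: linear_continuous_on linear_conv_bounded_linear[THEN iffD1])
  then have meas [measurable]: "f \<in> borel_measurable borel" by (intro borel_measurable_continuous_onI)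
  have "emeasure lborel A * emeasure (distr lborel borel f) (ball 0 1) = emeasure lborel (ball (0::'a) 1) * emeasure (distr lborel borel f) A"
  proof (rule translation_invariant_measures_proportional[where W = UNIV])
    show "sigma_finite_measure (distr lborel borel f)"
    proof (rule sigma_finite_measure_if_finite_on_balls)
      fix n
      have "f -` cball 0 (real n) = g ` cball 0 (real n)"
      proof (intro set_eqI iffI)
        fix x assume "x \<in> f -` cball 0 (real n)"
        then show "x \<in> g ` cball 0 (real n)" using f(3)[of x] by (intro image_eqI[of _ _ "f x"]) auto
      qed (use f(4) in auto)
      moreover have "compact (g ` cball 0 (real n))"
        by (intro compact_continuous_image continuous_on_subset[OF cont(2)]) auto
      ultimately show "emeasure (distr lborel borel f) (cball 0 (real n)) < top"
        using emeasure_compact_finite[of "g ` cball 0 (real n)"] by (simp add: emeasure_distr less_top)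
    qed simp
    fix w :: 'a and A :: "'a set" assume A: "A \<in> sets borel"
    show "emeasure lborel ((\<lambda>x. x + w) -` A) = emeasure lborel A"
      by (rule lborel_translate_vimage[OF A])
    have mA: "(\<lambda>x. x + w) -` A \<in> sets borel" "f -` A \<in> sets borel"
      using A measurable_sets[OF meas A] measurable_sets[of "\<lambda>x. x + w" borel borel A] by auto
    have "emeasure (distr lborel borel f) ((\<lambda>x. x + w) -` A) = emeasure lborel (f -` (\<lambda>x. x + w) -` A)"
      using mA by (simp add: emeasure_distr)
    also have "f -` (\<lambda>x. x + w) -` A = (\<lambda>x. x + g w) -` (f -` A)"
      using f by (auto simp: linear_add)
    also have "emeasure lborel \<dots> = emeasure lborel (f -` A)"
      by (rule lborel_translate_vimage[OF mA(2)])
    finally show "emeasure (distr lborel borel f) ((\<lambda>x. x + w) -` A) = emeasure (distr lborel borel f) A"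
      using A by (simp add: emeasure_distr)
  qed (use A in \<open>auto simp: lborel.sigma_finite_measure_axioms\<close>)
  then show ?thesis using A by (simp add: emeasure_distr)
qed

lemma lborel_orthogonal_vimage:
  fixes f :: "'a::euclidean_space \<Rightarrow> 'a"
  assumes f: "orthogonal_transformation f" and A: "A \<in> sets borel"
  shows "emeasure lborel (f -` A) = emeasure lborel A"
proof -
  have "bij f" "linear f" "linear (inv f)"
    using f by (auto simp: orthogonal_transformation_bij orthogonal_transformation_linear orthogonal_transformation_inv)
  moreover have "f -` ball 0 1 = ball 0 1"
    using f by (auto simp: orthogonal_transformation_norm)
  ultimately have "emeasure lborel A * emeasure lborel (ball (0::'a) 1) = emeasure lborel (ball (0::'a) 1) * emeasure lborel (f -` A)"
    using lborel_linear_vimage[of f "inv f" A] A by (simp add: bij_is_inj bij_is_surj surj_f_inv_f)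
  then show ?thesis
    using lborel_ball_pos_finite[where 'a='a] by (metis ennreal_mult_cancel_left mult.commute)
qed

text \<open>The reflection in the hyperplane orthogonal to \<open>u\<close> conjugates the shear by \<open>w\<close> to the shear by
  \<open>- w\<close>, its inverse. Both therefore scale volume by the same factor, and the product of
  the factors is 1.\<close>
lemma lborel_shear_vimage:
  fixes u w :: "'a::euclidean_space"
  assumes uw: "u \<bullet> w = 0" and u: "norm u = 1" and A: "A \<in> sets borel"
  shows "emeasure lborel ((\<lambda>x. x + (u \<bullet> x) *\<^sub>R w) -` A) = emeasure lborel A"
proof -
  define T where "T w x = x + (u \<bullet> x) *\<^sub>R w" for w x :: 'a
  define R where "R x = x - (2 * (u \<bullet> x)) *\<^sub>R u" for x
  have uu: "u \<bullet> u = 1" using u by (simp add: norm_eq_1)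
  have T: "linear (T w)" for w
    unfolding T_def by (rule linearI) (auto simp: algebra_simps)
  have TT: "T (-w) (T w x) = x" "T w (T (-w) x) = x" if "u \<bullet> w = 0" for w x
    using that by (auto simp: T_def algebra_simps)
  have R: "orthogonal_transformation R"
    unfolding orthogonal_transformation_def R_def
    by (auto intro!: linearI simp: algebra_simps uu inner_commute)
  have TR: "T w (R x) = R (T (-w) x)" if "u \<bullet> w = 0" for w x
    using that by (simp add: T_def R_def algebra_simps uu)
  define c where "c w = emeasure lborel (T w -` ball 0 1)" for w
  let ?b = "emeasure lborel (ball (0::'a) 1)"
  have scale: "emeasure lborel A * c w = ?b * emeasure lborel (T w -` A)" if "u \<bullet> w = 0" "A \<in> sets borel" for w A
    unfolding c_def by (rule lborel_linear_vimage[OF T T TT that(2)]) (use that in auto)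
  have mT: "T w -` A \<in> sets borel" if "A \<in> sets borel" for w A
  proof -
    have "T w \<in> borel_measurable borel" unfolding T_def by measurable
    from measurable_sets[OF this that] show ?thesis by simp
  qed
  have sym: "c (-w) = c w" if "u \<bullet> w = 0" for w
  proof -
    have "c w = emeasure lborel (R -` (T w -` ball 0 1))"
      unfolding c_def by (rule lborel_orthogonal_vimage[OF R, symmetric]) (auto intro: mT)
    also have "R -` (T w -` ball 0 1) = T (-w) -` (R -` ball 0 1)"
      using TR[OF that] by auto
    also have "R -` ball 0 1 = ball 0 1" using R by (auto simp: orthogonal_transformation_norm)
    finally show ?thesis by (simp add: c_def)
  qed
  \<comment> \<open>two opposite shears compose to the identity and scale volume equally\<close>
  have "c (-w) * c w = ?b * ?b"
  proof -
    have "T w -` (T (-w) -` ball 0 1) = ball 0 1" using TT[OF uw] by auto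
    then show ?thesis
      using scale[of w "T (-w) -` ball 0 1"] uw mT by (simp add: c_def)
  qed
  then have "c w * c w = ?b * ?b" using sym[OF uw] by simp
  have cb: "c w = ?b"
  proof -
    obtain r where r: "?b = ennreal r" "0 \<le> r"
      using lborel_ball_pos_finite(2)[where 'a='a] by (cases ?b) auto
    have "c w \<noteq> top"
    proof
      assume "c w = top"
      then have "ennreal r * ennreal r = top" using \<open>c w * c w = ?b * ?b\<close> r by simp
      then show False using r(2) by (simp add: ennreal_mult[symmetric])
    qed
    then obtain s where s: "c w = ennreal s" "0 \<le> s" by (cases "c w") auto
    have "s * s = r * r"
      using \<open>c w * c w = ?b * ?b\<close> r s by (simp add: ennreal_mult[symmetric])
    then show ?thesis using r s square_eq_iff[of s r] by auto
  qed
  then have "emeasure lborel A * ?b = ?b * emeasure lborel (T w -` A)"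
    using scale[OF uw A] by simp
  then have "emeasure lborel (T w -` A) = emeasure lborel A"
    using lborel_ball_pos_finite[where 'a='a] by (metis ennreal_mult_cancel_left mult.commute)
  then show ?thesis by (simp add: T_def[abs_def])
qed

text \<open>The model hyperplane is spanned by all coordinate directions except \<open>k\<close>. A set \<open>A\<close> in it is
  measured by the volume of the cone with apex \<open>0\<close> over the copy of \<open>A\<close> at height 1; translating
  \<open>A\<close> shears this cone, so the measure is translation invariant.\<close>

definition cone_projection :: "'n::finite \<Rightarrow> real^'n \<Rightarrow> real^'n" where
  "cone_projection k x = (1 / x$k) *\<^sub>R x - axis k 1"

definition unit_slab :: "'n::finite \<Rightarrow> (real^'n) set" where
  "unit_slab k = {x. 0 < x$k \<and> x$k \<le> 1}"

definition cone_measure :: "'n::finite \<Rightarrow> (real^'n) measure" where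
  "cone_measure k = distr (density lborel (indicator (unit_slab k))) borel (cone_projection k)"

lemma unit_slab_borel [measurable]: "unit_slab k \<in> sets borel"
  unfolding unit_slab_def by measurable

lemma cone_projection_measurable [measurable]: "cone_projection k \<in> borel_measurable borel"
  unfolding cone_projection_def by measurable

lemma cone_projection_nth: "x \<in> unit_slab k \<Longrightarrow> cone_projection k x $ k = 0"
  by (simp add: cone_projection_def unit_slab_def axis_def)

lemma sets_cone_measure [simp, measurable_cong]: "sets (cone_measure k) = sets borel"
  by (simp add: cone_measure_def)

lemma emeasure_cone_measure:
  assumes "A \<in> sets borel"
  shows "emeasure (cone_measure k) A = emeasure lborel {x \<in> unit_slab k. cone_projection k x \<in> A}"
proof -
  have *: "cone_projection k -` A \<in> sets borel"
    using measurable_sets[OF cone_projection_measurable assms, of k] by simp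
  have "emeasure (cone_measure k) A = emeasure (density lborel (indicator (unit_slab k))) (cone_projection k -` A)"
    using assms by (simp add: cone_measure_def emeasure_distr)
  also have "\<dots> = (\<integral>\<^sup>+x. indicator (unit_slab k) x * indicator (cone_projection k -` A) x \<partial>lborel)"
    using * by (subst emeasure_density) auto
  also have "\<dots> = (\<integral>\<^sup>+x. indicator (unit_slab k \<inter> cone_projection k -` A) x \<partial>lborel)"
    by (intro nn_integral_cong) (simp split: split_indicator)
  also have "\<dots> = emeasure lborel (unit_slab k \<inter> cone_projection k -` A)"
    using * by (subst nn_integral_indicator) auto
  also have "unit_slab k \<inter> cone_projection k -` A = {x \<in> unit_slab k. cone_projection k x \<in> A}" by auto
  finally show ?thesis .
qed

lemma cone_measure_translate:
  fixes w :: "real^'n::finite"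
  assumes w: "w$k = 0" and A: "A \<in> sets borel"
  shows "emeasure (cone_measure k) ((\<lambda>x. x + w) -` A) = emeasure (cone_measure k) A"
proof -
  let ?T = "\<lambda>x. x + (axis k 1 \<bullet> x) *\<^sub>R w"
  have m: "(\<lambda>x. x + w) \<in> borel_measurable borel" by measurable
  have A': "(\<lambda>x. x + w) -` A \<in> sets borel" using measurable_sets[OF m A] by simp
  have "{x \<in> unit_slab k. cone_projection k x \<in> (\<lambda>x. x + w) -` A} = ?T -` {x \<in> unit_slab k. cone_projection k x \<in> A}"
    using w by (auto simp: unit_slab_def cone_projection_def inner_axis' algebra_simps)
  moreover have "{x \<in> unit_slab k. cone_projection k x \<in> A} \<in> sets borel"
    using measurable_sets[OF cone_projection_measurable A, of k] unit_slab_borel[of k]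
    by (simp add: vimage_def Collect_conj_eq sets.Int)
  ultimately show ?thesis
    using lborel_shear_vimage[of "axis k 1" w "{x \<in> unit_slab k. cone_projection k x \<in> A}"] w A A'
    by (simp add: emeasure_cone_measure inner_axis')
qed

lemma cone_measure_box:
  fixes k :: "'n::finite"
  assumes "0 \<le> d"
  shows "emeasure (cone_measure k) {y. y$k = 0 \<and> (\<forall>i. \<bar>y$i\<bar> \<le> d)} \<le> ennreal ((2 * d) ^ (CARD('n) - 1))"
proof -
  let ?a = "(\<chi> i. if i = k then 0 else - d) :: real^'n" and ?b = "(\<chi> i. if i = k then 1 else d) :: real^'n"
  have cl: "closed {y::real^'n. y$k = 0 \<and> (\<forall>i. \<bar>y$i\<bar> \<le> d)}"
    by (intro closed_Collect_conj closed_Collect_eq closed_Collect_all closed_Collect_le continuous_intros)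
  have "{x \<in> unit_slab k. cone_projection k x \<in> {y. y$k = 0 \<and> (\<forall>i. \<bar>y$i\<bar> \<le> d)}} \<subseteq> cbox ?a ?b"
  proof (clarsimp simp: mem_box_cart unit_slab_def)
    fix x :: "real^'n" and i
    assume x: "0 < x$k" "x$k \<le> 1" and y: "\<forall>i. \<bar>cone_projection k x $ i\<bar> \<le> d" and "i \<noteq> k"
    have "\<bar>x$i / x$k\<bar> \<le> d"
      using y[rule_format, of i] \<open>i \<noteq> k\<close> by (simp add: cone_projection_def axis_def)
    then have "\<bar>x$i\<bar> \<le> d * x$k" using x by (simp add: abs_divide field_simps)
    also have "\<dots> \<le> d" using assms x by (simp add: mult_left_le)
    finally show "- d \<le> x $ i \<and> x $ i \<le> d" by linarith
  qed
  then have "emeasure (cone_measure k) {y. y$k = 0 \<and> (\<forall>i. \<bar>y$i\<bar> \<le> d)} \<le> emeasure lborel (cbox ?a ?b)"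
    using cl by (subst emeasure_cone_measure) (auto intro!: emeasure_mono)
  also have "emeasure lborel (cbox ?a ?b) = ennreal (measure lborel (cbox ?a ?b))"
    using emeasure_lborel_cbox_finite[of ?a ?b] by (intro emeasure_eq_ennreal_measure) auto
  also have "measure lborel (cbox ?a ?b) = (\<Prod>i\<in>UNIV. ?b$i - ?a$i)"
    using assms by (intro content_cbox_cart) (auto simp: interval_ne_empty_cart)
  also have "\<dots> = (\<Prod>i\<in>insert k (UNIV - {k}). if i = k then 1 else 2 * d)"
    by (intro prod.cong) auto
  also have "\<dots> = (2 * d) ^ (CARD('n) - 1)"
    by (subst prod.insert) (auto simp: card_Diff_singleton)
  finally show ?thesis .
qed

lemma hausdorff_content_le_finite:
  assumes I: "finite I" and C: "A \<subseteq> (\<Union>i\<in>I. C i)" "\<And>i. i \<in> I \<Longrightarrow> bounded (C i)" "\<And>i. i \<in> I \<Longrightarrow> diameter (C i) \<le> \<delta>"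
    and "0 \<le> \<delta>"
  shows "hausdorff_content k \<delta> A \<le> (\<Sum>i\<in>I. ennreal (hausdorff_weight k (C i)))"
proof -
  obtain g where g: "bij_betw g {0..<card I} I" using ex_bij_betw_nat_finite[OF I] by blast
  define D where "D j = (if j < card I then C (g j) else {})" for j
  have gI: "g j \<in> I" if "j < card I" for j using bij_betwE[OF g] that by auto
  have "hausdorff_content k \<delta> A \<le> (\<Sum>j. ennreal (hausdorff_weight k (D j)))"
  proof (rule hausdorff_content_le)
    show "A \<subseteq> (\<Union>j. D j)"
    proof
      fix x assume "x \<in> A"
      then obtain i where i: "i \<in> I" "x \<in> C i" using C(1) by auto
      then obtain j where "j < card I" "g j = i" using bij_betw_imp_surj_on[OF g] by (metis atLeastLessThan_iff imageE)
      then show "x \<in> (\<Union>j. D j)" using i by (auto simp: D_def intro!: exI[of _ j])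
    qed
  qed (use C gI assms in \<open>auto simp: D_def\<close>)
  also have "\<dots> = (\<Sum>j\<in>{0..<card I}. ennreal (hausdorff_weight k (D j)))"
    by (rule suminf_finite) (auto simp: D_def hausdorff_weight_def)
  also have "\<dots> = (\<Sum>i\<in>I. ennreal (hausdorff_weight k (C i)))"
    using sum.reindex_bij_betw[OF g, of "\<lambda>i. ennreal (hausdorff_weight k (C i))"] by (simp add: D_def)
  finally show ?thesis .
qed

text \<open>Cutting the cube into \<open>m ^ (CARD('n) - 1)\<close> cells of side \<open>1 / m\<close> gives covers by small sets whose total
  weight is bounded independently of \<open>m\<close>.\<close>
lemma hausdorff_measure_flat_cube_finite:
  fixes k :: "'n::finite"
  shows "hausdorff_measure (CARD('n) - 1) {y::real^'n. y$k = 0 \<and> (\<forall>i. 0 \<le> y$i \<and> y$i \<le> 1)} < top"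
proof -
  let ?n = "CARD('n) - 1" and ?N = "real CARD('n)"
  let ?Q = "{y::real^'n. y$k = 0 \<and> (\<forall>i. 0 \<le> y$i \<and> y$i \<le> 1)}"
  have "hausdorff_measure ?n ?Q \<le> ennreal (unit_ball_vol (real ?n) * (?N / 2) ^ ?n)"
  proof (rule hausdorff_measure_leI)
    fix \<delta> :: real assume \<delta>: "0 < \<delta>"
    obtain m :: nat where m: "?N / \<delta> < real m" using reals_Archimedean2 by blast
    moreover have "0 < ?N / \<delta>" using \<delta> by simp
    ultimately have m0: "0 < m" by (metis less_trans of_nat_0_less_iff)
    have mN: "?N / real m \<le> \<delta>" using m m0 \<delta> by (simp add: field_simps)
    define G where "G = (UNIV - {k}) \<rightarrow>\<^sub>E {..<m}"
    define C where "C g = {y::real^'n. y$k = 0 \<and> (\<forall>i. i \<noteq> k \<longrightarrow> real (g i) / m \<le> y$i \<and> y$i \<le> (real (g i) + 1) / m)}" for g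
    have dist: "norm (x - y) \<le> ?N / m" if "x \<in> C g" "y \<in> C g" for x y g
    proof -
      have "\<bar>(x - y)$i\<bar> \<le> 1 / m" for i
        using that by (cases "i = k") (auto simp: C_def add_divide_distrib abs_le_iff dest!: spec[of _ i])
      then have "norm (x - y) \<le> (\<Sum>i\<in>(UNIV::'n set). 1 / m)"
        by (intro order_trans[OF norm_le_l1_cart] sum_mono)
      then show ?thesis by simp
    qed
    have bd: "bounded (C g)" for g
      unfolding bounded_two_points dist_norm using dist by blast
    have dia: "diameter (C g) \<le> ?N / m" for g
      using dist by (intro diameter_le) auto
    have "hausdorff_content ?n \<delta> ?Q \<le> (\<Sum>g\<in>G. ennreal (hausdorff_weight ?n (C g)))"
    proof (rule hausdorff_content_le_finite)
      show "finite G" unfolding G_def by (intro finite_PiE) auto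
      show "?Q \<subseteq> (\<Union>g\<in>G. C g)"
      proof
        fix y assume y: "y \<in> ?Q"
        \<comment> \<open>the cells are indexed by the integer part, except that the far face belongs to the last cell\<close>
        define g where "g = (\<lambda>i. if i = k then undefined else (if y$i = 1 then m - 1 else nat \<lfloor>y$i * m\<rfloor>))"
        have gi: "g i < m \<and> real (g i) / m \<le> y$i \<and> y$i \<le> (real (g i) + 1) / m" if "i \<noteq> k" for i
        proof (cases "y$i = 1")
          case True
          then show ?thesis using that m0 by (simp add: g_def of_nat_diff)
        next
          case False
          then have yi: "0 \<le> y$i" "y$i < 1" using y by (auto simp: less_le)
          have "real (nat \<lfloor>y$i * m\<rfloor>) \<le> y$i * m" "y$i * m < real (nat \<lfloor>y$i * m\<rfloor>) + 1" "y$i * m < m"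
            using yi m0 by (auto simp: of_nat_nat)
          moreover from this have "nat \<lfloor>y$i * m\<rfloor> < m" by linarith
          ultimately show ?thesis using that False m0 by (simp add: g_def field_simps)
        qed
        then have "g \<in> G" "y \<in> C g" using y by (auto simp: G_def C_def g_def PiE_iff extensional_def)
        then show "y \<in> (\<Union>g\<in>G. C g)" by blast
      qed
    qed (use bd dia mN \<delta> in \<open>auto intro: order_trans\<close>)
    also have "\<dots> \<le> (\<Sum>g\<in>G. ennreal (unit_ball_vol (real ?n) * (?N / m / 2) ^ ?n))"
    proof (intro sum_mono ennreal_leI)
      fix g
      have "(diameter (C g) / 2) ^ ?n \<le> (?N / m / 2) ^ ?n"
        using dia[of g] diameter_ge_0[OF bd, of g] by (intro power_mono) auto
      then show "hausdorff_weight ?n (C g) \<le> unit_ball_vol (real ?n) * (?N / m / 2) ^ ?n"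
        by (auto simp: hausdorff_weight_def intro!: mult_left_mono)
    qed
    also have "\<dots> = ennreal (real (card G) * (unit_ball_vol (real ?n) * (?N / m / 2) ^ ?n))"
      by (simp add: ennreal_mult[symmetric] ennreal_of_nat_eq_real_of_nat)
    also have "card G = m ^ ?n"
      unfolding G_def by (subst card_PiE) (auto simp: card_Diff_singleton)
    also have "real (m ^ ?n) * (unit_ball_vol (real ?n) * (?N / m / 2) ^ ?n) = unit_ball_vol (real ?n) * (?N / 2) ^ ?n"
      using m0 by (simp add: power_divide)
    finally show "hausdorff_content ?n \<delta> ?Q \<le> ennreal (unit_ball_vol (real ?n) * (?N / 2) ^ ?n)" .
  qed
  also have "\<dots> < top" by simp
  finally show ?thesis .
qed

lemma hausdorff_measure_flat_bounded_finite:
  fixes k :: "'n::finite"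
  assumes "A \<subseteq> {y::real^'n. y$k = 0}" "bounded A"
  shows "hausdorff_measure (CARD('n) - 1) A < top"
proof -
  obtain r where r: "r > 0" "\<And>x. x \<in> A \<Longrightarrow> norm x \<le> r" using assms(2) bounded_pos by blast
  let ?Q = "{y::real^'n. y$k = 0 \<and> (\<forall>i. 0 \<le> y$i \<and> y$i \<le> 1)}"
  \<comment> \<open>\<open>?f\<close> carries the unit cube to the cube of side \<open>2 * r\<close> centred at the origin\<close>
  let ?v = "(\<chi> i. if i = k then 0 else r) :: real^'n"
  let ?f = "\<lambda>x. (2 * r) *\<^sub>R x - ?v" and ?g = "\<lambda>x. (1 / (2 * r)) *\<^sub>R (x + ?v)"
  have "A \<subseteq> ?f ` ?Q"
  proof
    fix x assume x: "x \<in> A"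
    have b: "- r \<le> x$i \<and> x$i \<le> r" for i
      using r(2)[OF x] component_le_norm_cart[of x i] by linarith
    have "x$k = 0" using assms(1) x by auto
    moreover have "0 \<le> ?g x $ i \<and> ?g x $ i \<le> 1" for i
      using b[of i] r(1) \<open>x$k = 0\<close> by (cases "i = k") (simp_all add: field_simps)
    ultimately have "?g x \<in> ?Q" by simp
    moreover have "x = ?f (?g x)" using r(1) by simp
    ultimately show "x \<in> ?f ` ?Q" by blast
  qed
  then have "hausdorff_measure (CARD('n) - 1) A \<le> hausdorff_measure (CARD('n) - 1) (?f ` ?Q)"
    by (rule hausdorff_measure_mono)
  also have "\<dots> \<le> ennreal ((2 * r) ^ (CARD('n) - 1)) * hausdorff_measure (CARD('n) - 1) ?Q"
    by (rule hausdorff_measure_similarity_le) (use r(1) in \<open>auto simp: dist_norm simp flip: scaleR_diff_right\<close>)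
  also have "\<dots> < top"
    using hausdorff_measure_flat_cube_finite[of k] by (simp add: ennreal_mult_less_top)
  finally show ?thesis .
qed

text \<open>A flat set of diameter \<open>d\<close> lies in a flat cube of side \<open>2 * d\<close>, whose measure is comparable to the
  weight of the set. Hence the Hausdorff measure is not zero on the hyperplane.\<close>
lemma cone_measure_le_hausdorff:
  fixes k :: "'n::finite"
  assumes A: "A \<in> sets borel" "A \<subseteq> {y::real^'n. y$k = 0}"
  shows "emeasure (cone_measure k) A \<le>
    ennreal (4 ^ (CARD('n) - 1) / unit_ball_vol (real (CARD('n) - 1))) * hausdorff_measure (CARD('n) - 1) A"
proof -
  let ?n = "CARD('n) - 1"
  let ?\<omega> = "unit_ball_vol (real ?n)" and ?\<nu> = "emeasure (cone_measure k)"
  have \<omega>: "0 < ?\<omega>" by simp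
  have "?\<nu> A / ennreal (4 ^ ?n / ?\<omega>) \<le> hausdorff_content ?n 1 A"
  proof (rule hausdorff_content_geI)
    fix C :: "nat \<Rightarrow> (real^'n) set"
    assume C: "A \<subseteq> (\<Union>i. C i)" "\<And>i. bounded (C i)" "\<And>i. diameter (C i) \<le> 1"
    have "\<exists>D\<in>sets borel. C i \<inter> A \<subseteq> D \<and> ?\<nu> D \<le> ennreal (4 ^ ?n / ?\<omega>) * ennreal (hausdorff_weight ?n (C i))" for i
    proof (cases "C i \<inter> A = {}")
      case True
      then show ?thesis by (intro bexI[of _ "{}"]) auto
    next
      case False
      then obtain c where c: "c \<in> C i" "c \<in> A" by auto
      define d where "d = diameter (C i)"
      have d0: "0 \<le> d" unfolding d_def by (rule diameter_ge_0[OF C(2)])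
      let ?D = "{y::real^'n. y$k = 0 \<and> (\<forall>i. \<bar>y$i\<bar> \<le> d)}"
      have cl: "closed ?D"
        by (intro closed_Collect_conj closed_Collect_eq closed_Collect_all closed_Collect_le continuous_intros)
      have ck: "c$k = 0" using c A by auto
      have D: "(\<lambda>x. x + - c) -` ?D \<in> sets borel"
        by (intro borel_closed closed_vimage cl continuous_intros)
      have "C i \<inter> A \<subseteq> (\<lambda>x. x + - c) -` ?D"
      proof
        fix x assume x: "x \<in> C i \<inter> A"
        then have "norm (x - c) \<le> d" unfolding d_def using c C(2) diameter_bounded_bound[of "C i" x c] by (simp add: dist_norm)
        then have "\<bar>(x - c)$j\<bar> \<le> d" for j using component_le_norm_cart[of "x - c" j] by linarith
        then show "x \<in> (\<lambda>x. x + - c) -` ?D" using x A ck by auto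
      qed
      moreover have "?\<nu> ((\<lambda>x. x + - c) -` ?D) \<le> ennreal (4 ^ ?n / ?\<omega>) * ennreal (hausdorff_weight ?n (C i))"
      proof -
        have "?\<nu> ((\<lambda>x. x + - c) -` ?D) = ?\<nu> ?D"
          using cl ck by (intro cone_measure_translate) auto
        also have "\<dots> \<le> ennreal ((2 * d) ^ ?n)" by (rule cone_measure_box[OF d0])
        also have "(2 * d) ^ ?n = 4 ^ ?n / ?\<omega> * hausdorff_weight ?n (C i)"
        proof -
          have "4 ^ ?n * (d / 2) ^ ?n = (4 * (d / 2)) ^ ?n" by (simp only: power_mult_distrib)
          then have "(2 * d) ^ ?n = 4 ^ ?n * (d / 2) ^ ?n" by simp
          moreover have "hausdorff_weight ?n (C i) = ?\<omega> * (d / 2) ^ ?n" using c by (auto simp: hausdorff_weight_def d_def)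
          moreover have "x / w * (w * y) = x * y" if "0 < w" for x y w :: real using that by simp
          ultimately show ?thesis using \<omega> by (simp only:)
        qed
        also have "ennreal \<dots> = ennreal (4 ^ ?n / ?\<omega>) * ennreal (hausdorff_weight ?n (C i))"
          using \<omega> hausdorff_weight_nonneg[OF C(2)] by (intro ennreal_mult) auto
        finally show ?thesis .
      qed
      ultimately show ?thesis using D by blast
    qed
    then obtain D where D: "\<And>i. D i \<in> sets borel" "\<And>i. C i \<inter> A \<subseteq> D i"
       "\<And>i. ?\<nu> (D i) \<le> ennreal (4 ^ ?n / ?\<omega>) * ennreal (hausdorff_weight ?n (C i))" by metis
    have "A \<subseteq> (\<Union>i. D i)" using C(1) D(2) by blast
    then have "?\<nu> A \<le> ?\<nu> (\<Union>i. D i)" using D(1) by (intro emeasure_mono) auto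
    also have "\<dots> \<le> (\<Sum>i. ?\<nu> (D i))" using D(1) by (intro emeasure_subadditive_countably) auto
    also have "\<dots> \<le> (\<Sum>i. ennreal (4 ^ ?n / ?\<omega>) * ennreal (hausdorff_weight ?n (C i)))"
      by (intro suminf_le D(3)) auto
    also have "\<dots> = (\<Sum>i. ennreal (hausdorff_weight ?n (C i))) * ennreal (4 ^ ?n / ?\<omega>)"
      by (simp add: mult.commute)
    finally show "?\<nu> A / ennreal (4 ^ ?n / ?\<omega>) \<le> (\<Sum>i. ennreal (hausdorff_weight ?n (C i)))"
      using \<omega> by (intro divide_le_posI_ennreal) (auto simp: mult.commute)
  qed
  also have "\<dots> \<le> hausdorff_measure ?n A" by (rule hausdorff_content_le_measure) simp
  finally have "?\<nu> A / ennreal (4 ^ ?n / ?\<omega>) * ennreal (4 ^ ?n / ?\<omega>) \<le> hausdorff_measure ?n A * ennreal (4 ^ ?n / ?\<omega>)"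
    by (rule mult_right_mono) simp
  moreover have "?\<nu> A / ennreal (4 ^ ?n / ?\<omega>) * ennreal (4 ^ ?n / ?\<omega>) = ?\<nu> A"
  proof -
    have "0 < 4 ^ ?n / ?\<omega>" using \<omega> by (intro divide_pos_pos) simp_all
    then have "ennreal (4 ^ ?n / ?\<omega>) / ennreal (4 ^ ?n / ?\<omega>) = 1"
      by (intro ennreal_divide_self) (simp_all only: ennreal_eq_0_iff not_le ennreal_neq_top ennreal_less_top)
    then show ?thesis by (simp only: ennreal_divide_times mult_1_right)
  qed
  ultimately show ?thesis by (simp add: mult.commute)
qed

text \<open>Both measures are translation invariant on the hyperplane, and positive and finite on the unit
  ball.\<close>
lemma hausdorff_measure_flat_eq_cone_measure:
  fixes k :: "'n::finite"
  obtains C :: real where "0 < C"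
    "\<And>A. A \<in> sets borel \<Longrightarrow> A \<subseteq> {y::real^'n. y$k = 0} \<Longrightarrow>
      hausdorff_measure (CARD('n) - 1) A = ennreal C * emeasure (cone_measure k) A"
proof -
  let ?H = "hausdorff_measure (CARD('n) - 1) :: (real^'n) set \<Rightarrow> ennreal" and ?\<nu> = "emeasure (cone_measure k)"
  let ?W = "{y::real^'n. y$k = 0}" and ?B = "cball (0::real^'n) 1"
  define M where "M = density (hausdorff_borel (CARD('n) - 1)) (indicator ?W :: real^'n \<Rightarrow> ennreal)"
  have clW: "closed ?W" by (intro closed_Collect_eq continuous_intros)
  then have W: "?W \<in> sets borel" by simp
  have sM: "sets M = sets borel" "space M = UNIV" by (simp_all add: M_def)
  have eM: "emeasure M A = ?H (A \<inter> ?W)" if "A \<in> sets borel" for A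
  proof -
    have "emeasure M A = (\<integral>\<^sup>+x. indicator ?W x * indicator A x \<partial>hausdorff_borel (CARD('n) - 1))"
      unfolding M_def using that W by (intro emeasure_density) auto
    also have "\<dots> = (\<integral>\<^sup>+x. indicator (A \<inter> ?W) x \<partial>hausdorff_borel (CARD('n) - 1))"
      by (intro nn_integral_cong) (simp split: split_indicator)
    also have "\<dots> = ?H (A \<inter> ?W)"
      using that W by (subst nn_integral_indicator) (simp_all add: emeasure_hausdorff_borel)
    finally show ?thesis .
  qed
  have slab: "?\<nu> A = ?\<nu> (A \<inter> ?W)" if "A \<in> sets borel" for A
  proof -
    have "{x \<in> unit_slab k. cone_projection k x \<in> A} = {x \<in> unit_slab k. cone_projection k x \<in> A \<inter> ?W}"
      using cone_projection_nth[of _ k] by auto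
    then show ?thesis using that W by (simp add: emeasure_cone_measure)
  qed
  have boxfin: "?\<nu> {y. y$k = 0 \<and> (\<forall>i. \<bar>y$i\<bar> \<le> d)} < top" if "0 \<le> d" for d
    using cone_measure_box[OF that, of k] by (meson ennreal_less_top le_less_trans)
  have ballfin: "?\<nu> (cball 0 d) < top" if "0 \<le> d" for d
  proof -
    have cl: "closed {y::real^'n. y$k = 0 \<and> (\<forall>i. \<bar>y$i\<bar> \<le> d)}"
      by (intro closed_Collect_conj closed_Collect_eq closed_Collect_all closed_Collect_le continuous_intros)
    have "cball 0 d \<inter> ?W \<subseteq> {y. y$k = 0 \<and> (\<forall>i. \<bar>y$i\<bar> \<le> d)}"
      using component_le_norm_cart order_trans by (fastforce simp: dist_norm)
    then have "?\<nu> (cball 0 d \<inter> ?W) \<le> ?\<nu> {y. y$k = 0 \<and> (\<forall>i. \<bar>y$i\<bar> \<le> d)}"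
      using cl by (intro emeasure_mono) auto
    then show ?thesis using boxfin[OF that] slab[of "cball 0 d"] by simp
  qed
  have proportional: "emeasure M A * ?\<nu> ?B = emeasure M ?B * ?\<nu> A" if A: "A \<in> sets borel" for A
  proof (rule translation_invariant_measures_proportional[where W = ?W])
    show "sigma_finite_measure M"
      using hausdorff_measure_flat_bounded_finite[of "cball 0 (real _) \<inter> ?W" k]
      by (intro sigma_finite_measure_if_finite_on_balls) (auto simp: sM eM)
    show "sigma_finite_measure (cone_measure k)"
      using ballfin by (intro sigma_finite_measure_if_finite_on_balls) auto
    show "AE x in M. x \<in> ?W"
    proof (rule AE_I)
      show "{x \<in> space M. x \<notin> ?W} \<subseteq> - ?W" by auto
      show "emeasure M (- ?W) = 0" using eM[of "- ?W"] W by simp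
      show "- ?W \<in> sets M" using W sM by auto
    qed
    show "AE x in cone_measure k. x \<in> ?W"
    proof (rule AE_I)
      show "{x \<in> space (cone_measure k). x \<notin> ?W} \<subseteq> - ?W" by auto
      show "?\<nu> (- ?W) = 0" using slab[of "- ?W"] W by simp
      show "- ?W \<in> sets (cone_measure k)" using W by auto
    qed
    fix w :: "real^'n" and A :: "(real^'n) set" assume w: "w \<in> ?W" and A: "A \<in> sets borel"
    show "?\<nu> ((\<lambda>x. x + w) -` A) = ?\<nu> A" using w A by (intro cone_measure_translate) auto
    have m: "(\<lambda>x. x + w) \<in> borel_measurable borel" by measurable
    have A': "(\<lambda>x. x + w) -` A \<in> sets borel" using measurable_sets[OF m A] by simp
    have "A \<inter> ?W = (\<lambda>x. x + w) ` ((\<lambda>x. x + w) -` A \<inter> ?W)"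
    proof (intro set_eqI iffI)
      fix x assume "x \<in> A \<inter> ?W"
      then show "x \<in> (\<lambda>x. x + w) ` ((\<lambda>x. x + w) -` A \<inter> ?W)" using w by (intro image_eqI[of _ _ "x - w"]) auto
    qed (use w in auto)
    moreover have "?H ((\<lambda>x. x + w) ` ((\<lambda>x. x + w) -` A \<inter> ?W)) = ennreal (1 ^ (CARD('n) - 1)) * ?H ((\<lambda>x. x + w) -` A \<inter> ?W)"
      by (rule hausdorff_measure_similarity[where g = "\<lambda>x. x - w"]) (auto simp: dist_norm)
    ultimately show "emeasure M ((\<lambda>x. x + w) -` A) = emeasure M A"
      using A A' by (simp add: eM)
  qed (use A sM in auto)
  have \<nu>B: "?\<nu> ?B \<noteq> top" using ballfin[of 1] by simp
  have \<nu>B0: "?\<nu> ?B \<noteq> 0"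
  proof -
    define U where "U = {x. 0 < x$k} \<inter> {x. x$k < 1} \<inter> ({x. 0 < x$k} \<inter> cone_projection k -` ball 0 1)"
    have "open U"
      unfolding U_def cone_projection_def
      by (intro open_Int continuous_open_preimage continuous_intros open_Collect_less) auto
    moreover have "(1/2) *\<^sub>R axis k 1 \<in> U" by (auto simp: U_def cone_projection_def axis_def vec_eq_iff)
    ultimately have "\<not> negligible U" using open_not_negligible by blast
    then have "emeasure lborel U \<noteq> 0" using \<open>open U\<close> by (simp add: negligible_iff_emeasure0 emeasure_completion)
    moreover have "emeasure lborel U \<le> emeasure lborel {x \<in> unit_slab k. cone_projection k x \<in> ?B}"
    proof (rule emeasure_mono)
      show "U \<subseteq> {x \<in> unit_slab k. cone_projection k x \<in> ?B}" by (auto simp: U_def unit_slab_def)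
      show "{x \<in> unit_slab k. cone_projection k x \<in> ?B} \<in> sets lborel"
        using measurable_sets[OF cone_projection_measurable, of ?B k] unit_slab_borel[of k]
        by (simp add: vimage_def Collect_conj_eq sets.Int)
    qed
    ultimately show ?thesis using emeasure_cone_measure[of ?B k] by auto
  qed
  have HB: "?H (?B \<inter> ?W) \<noteq> top"
    using hausdorff_measure_flat_bounded_finite[of "?B \<inter> ?W" k] bounded_subset[OF bounded_cball[of 0 1], of "?B \<inter> ?W"] by auto
  have HB0: "?H (?B \<inter> ?W) \<noteq> 0"
    using cone_measure_le_hausdorff[of "?B \<inter> ?W" k] \<nu>B0 slab[of ?B] W by auto
  obtain a where a: "?H (?B \<inter> ?W) = ennreal a" "0 < a" using HB HB0 by (cases "?H (?B \<inter> ?W)") (auto simp: less_le)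
  obtain b where b: "?\<nu> ?B = ennreal b" "0 < b" using \<nu>B \<nu>B0 by (cases "?\<nu> ?B") (auto simp: less_le)
  show thesis
  proof
    show "0 < a / b" using a b by simp
    fix A assume A: "A \<in> sets borel" "A \<subseteq> ?W"
    have "?H A = ?H A * (ennreal b * ennreal (1 / b))"
      using b by (simp flip: ennreal_mult)
    also have "\<dots> = (?H A * ennreal b) * ennreal (1 / b)" by (simp add: mult.assoc)
    also have "?H A * ennreal b = ennreal a * ?\<nu> A"
      using proportional[OF A(1)] eM[OF A(1)] eM[of ?B] A(2) a b by (simp add: Int_absorb2)
    also have "ennreal a * ?\<nu> A * ennreal (1 / b) = ennreal (a * (1 / b)) * ?\<nu> A"
      using a b by (subst ennreal_mult) (auto simp: mult_ac)
    finally show "?H A = ennreal (a / b) * ?\<nu> A" by simp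
  qed
qed

text \<open>The Hausdorff measure of a flat set, times its height, is a multiple of the volume of the cone over
  it, by a factor that depends on the dimension only: rotating the hyperplane to the model
  hyperplane shows that the factor is the same for all normals \<open>u\<close>.\<close>
theorem hausdorff_measure_cone_volume:
  obtains C :: real where "0 < C"
    "\<And>(u::real^'n::finite) h A. norm u = 1 \<Longrightarrow> 0 < h \<Longrightarrow> A \<in> sets borel \<Longrightarrow> A \<subseteq> {x. u \<bullet> x = h} \<Longrightarrow>
      ennreal h * hausdorff_measure (CARD('n) - 1) A =
      ennreal C * emeasure lborel {x. 0 < u \<bullet> x \<and> u \<bullet> x \<le> h \<and> (h / (u \<bullet> x)) *\<^sub>R x \<in> A}"
proof -
  define k where "k = (undefined :: 'n)"
  obtain C where C: "0 < C" "\<And>A. A \<in> sets borel \<Longrightarrow> A \<subseteq> {y::real^'n. y$k = 0} \<Longrightarrow>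
      hausdorff_measure (CARD('n) - 1) A = ennreal C * emeasure (cone_measure k) A"
    using hausdorff_measure_flat_eq_cone_measure[of k] by blast
  show thesis
  proof
    show "0 < C" by fact
    fix u :: "real^'n" and h A assume u: "norm u = 1" and h: "0 < h" and A: "A \<in> sets borel" "A \<subseteq> {x. u \<bullet> x = h}"
    let ?n = "CARD('n) - 1" and ?e = "axis k 1 :: real^'n"
    obtain f where f: "orthogonal_transformation f" "f u = ?e"
      using orthogonal_transformation_exists[of u ?e] u by auto
    define g where "g = inv f"
    have g: "orthogonal_transformation g" "\<And>x. g (f x) = x" "\<And>x. f (g x) = x"
      using f(1) by (auto simp: g_def orthogonal_transformation_inv orthogonal_transformation_inj
          orthogonal_transformation_surj surj_f_inv_f)
    have lin: "linear f" "linear g" using f g by (auto simp: orthogonal_transformation_linear)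
    have fk: "f x $ k = u \<bullet> x" for x
      using f by (metis cart_eq_inner_axis inner_commute orthogonal_transformation_def)
    let ?\<phi> = "\<lambda>x. (1 / h) *\<^sub>R f x - ?e" and ?\<psi> = "\<lambda>y. h *\<^sub>R g (y + ?e)"
    have \<phi>\<psi>: "?\<psi> (?\<phi> x) = x" "?\<phi> (?\<psi> x) = x" for x
      using h g by (simp_all add: linear_scale[OF lin(1)] linear_scale[OF lin(2)])
    have "continuous_on UNIV ?\<psi>"
      by (intro continuous_intros linear_continuous_on_compose[OF _ lin(2)])
    then have m: "?\<psi> \<in> borel_measurable borel" by (rule borel_measurable_continuous_onI)
    have "?\<phi> ` A = ?\<psi> -` A"
    proof (intro set_eqI iffI)
      fix x assume "x \<in> ?\<psi> -` A"
      then show "x \<in> ?\<phi> ` A" using \<phi>\<psi>(2)[of x] by (intro image_eqI[of _ _ "?\<psi> x"]) simp_all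
    next
      fix x assume "x \<in> ?\<phi> ` A"
      then show "x \<in> ?\<psi> -` A" using \<phi>\<psi>(1) by auto
    qed
    then have bA: "?\<phi> ` A \<in> sets borel" using measurable_sets[OF m A(1)] by simp
    have sub: "?\<phi> ` A \<subseteq> {y. y$k = 0}" using A(2) h by (auto simp: fk axis_def)
    have "hausdorff_measure ?n (?\<phi> ` A) = ennreal ((1 / h) ^ ?n) * hausdorff_measure ?n A"
    proof (rule hausdorff_measure_similarity[where g = ?\<psi>])
      fix x y
      have "?\<phi> x - ?\<phi> y = (1 / h) *\<^sub>R f (x - y)" by (simp add: linear_diff[OF lin(1)] scaleR_diff_right)
      then show "dist (?\<phi> x) (?\<phi> y) = 1 / h * dist x y"
        using h f(1) by (simp add: dist_norm orthogonal_transformation_norm)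
    qed (use h \<phi>\<psi> in auto)
    then have HA: "ennreal ((1 / h) ^ ?n) * hausdorff_measure ?n A = ennreal C * emeasure (cone_measure k) (?\<phi> ` A)"
      using C(2)[OF bA sub] by simp
    let ?D = "{y \<in> unit_slab k. cone_projection k y \<in> ?\<phi> ` A}"
    have D: "?D \<in> sets borel"
      using measurable_sets[OF cone_projection_measurable bA, of k] unit_slab_borel[of k]
      by (simp add: vimage_def Collect_conj_eq sets.Int)
    have X: "(\<lambda>y. h *\<^sub>R y) ` ?D = (\<lambda>y. (1 / h) *\<^sub>R y) -` ?D"
    proof (intro set_eqI iffI)
      fix x assume "x \<in> (\<lambda>y. (1 / h) *\<^sub>R y) -` ?D"
      then show "x \<in> (\<lambda>y. h *\<^sub>R y) ` ?D" using h by (intro image_eqI[of _ _ "(1 / h) *\<^sub>R x"]) auto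
    qed (use h in auto)
    have m2: "(\<lambda>y. (1 / h) *\<^sub>R y) \<in> borel_measurable (borel :: (real^'n) measure)" by measurable
    have bX: "(\<lambda>y. h *\<^sub>R y) ` ?D \<in> sets borel"
      unfolding X using measurable_sets[OF m2 D] by simp
    have "{x. 0 < u \<bullet> x \<and> u \<bullet> x \<le> h \<and> (h / (u \<bullet> x)) *\<^sub>R x \<in> A} = f -` ((\<lambda>y. h *\<^sub>R y) ` ?D)"
    proof (intro set_eqI)
      fix x
      have q: "cone_projection k ((1 / h) *\<^sub>R f x) \<in> ?\<phi> ` A \<longleftrightarrow> (h / (u \<bullet> x)) *\<^sub>R x \<in> A" if "0 < u \<bullet> x"
      proof -
        have "cone_projection k ((1 / h) *\<^sub>R f x) = ?\<phi> ((h / (u \<bullet> x)) *\<^sub>R x)"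
          using h that by (simp add: cone_projection_def fk linear_scale[OF lin(1)])
        moreover have "inj ?\<phi>" using \<phi>\<psi>(1) by (rule inj_on_inverseI)
        ultimately show ?thesis using inj_image_mem_iff[of ?\<phi>] by (simp only:)
      qed
      have "(1 / h) *\<^sub>R f x \<in> unit_slab k \<longleftrightarrow> 0 < u \<bullet> x \<and> u \<bullet> x \<le> h"
        using h by (auto simp: unit_slab_def fk zero_less_divide_iff)
      then show "x \<in> {x. 0 < u \<bullet> x \<and> u \<bullet> x \<le> h \<and> (h / (u \<bullet> x)) *\<^sub>R x \<in> A} \<longleftrightarrow> x \<in> f -` ((\<lambda>y. h *\<^sub>R y) ` ?D)"
        unfolding X using q by auto
    qed
    then have "emeasure lborel {x. 0 < u \<bullet> x \<and> u \<bullet> x \<le> h \<and> (h / (u \<bullet> x)) *\<^sub>R x \<in> A} = emeasure lborel ((\<lambda>y. h *\<^sub>R y) ` ?D)"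
      using lborel_orthogonal_vimage[OF f(1) bX] by simp
    also have "\<dots> = ennreal (h ^ CARD('n)) * emeasure lborel ?D"
      using emeasure_lebesgue_affine[of h "0::real^'n" ?D] D bX h
      by (simp add: emeasure_completion ennreal_power)
    also have "emeasure lborel ?D = emeasure (cone_measure k) (?\<phi> ` A)"
      by (rule emeasure_cone_measure[OF bA, symmetric])
    finally have vol: "emeasure lborel {x. 0 < u \<bullet> x \<and> u \<bullet> x \<le> h \<and> (h / (u \<bullet> x)) *\<^sub>R x \<in> A} =
       ennreal (h ^ CARD('n)) * emeasure (cone_measure k) (?\<phi> ` A)" .
    have "h = h ^ CARD('n) * (1 / h) ^ ?n"
      using h by (cases "CARD('n)") (auto simp: power_divide)
    then have "ennreal h * hausdorff_measure ?n A = ennreal (h ^ CARD('n)) * (ennreal ((1 / h) ^ ?n) * hausdorff_measure ?n A)"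
      using h by (metis ennreal_mult' mult.assoc zero_le_power less_imp_le)
    also have "\<dots> = ennreal C * (ennreal (h ^ CARD('n)) * emeasure (cone_measure k) (?\<phi> ` A))"
      unfolding HA by (simp add: mult_ac)
    finally show "ennreal h * hausdorff_measure ?n A =
      ennreal C * emeasure lborel {x. 0 < u \<bullet> x \<and> u \<bullet> x \<le> h \<and> (h / (u \<bullet> x)) *\<^sub>R x \<in> A}"
      unfolding vol .
  qed
qed

section \<open>The Brunn--Minkowski inequality\<close>

definition disjoint_boxes :: "'a::euclidean_space set set \<Rightarrow> bool" where
  "disjoint_boxes \<D> \<longleftrightarrow> finite \<D> \<and> (\<forall>D\<in>\<D>. D \<noteq> {} \<and> (\<exists>a b. D = box a b)) \<and> pairwise disjnt \<D>"

lemma disjoint_boxes_obtain: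
  assumes "disjoint_boxes \<D>" "D \<in> \<D>"
  obtains a b where "D = box a b" "box a b \<noteq> {}"
  using assms unfolding disjoint_boxes_def by metis

lemma disjoint_boxes_lmeasurable: "disjoint_boxes \<D> \<Longrightarrow> \<Union>\<D> \<in> lmeasurable"
  unfolding disjoint_boxes_def by (intro fmeasurable.finite_Union) auto

lemma disjoint_boxes_open: "disjoint_boxes \<D> \<Longrightarrow> open (\<Union>\<D>)"
  unfolding disjoint_boxes_def by (intro open_Union) auto

lemma disjoint_boxes_bounded: "disjoint_boxes \<D> \<Longrightarrow> bounded (\<Union>\<D>)"
  unfolding disjoint_boxes_def by (intro bounded_Union) auto

lemma measure_disjoint_boxes_pos:
  assumes "disjoint_boxes \<D>" "\<D> \<noteq> {}"
  shows "0 < measure lebesgue (\<Union>\<D>)"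
proof -
  have "\<Union>\<D> \<noteq> {}" using assms by (auto simp: disjoint_boxes_def)
  then have "\<not> negligible (\<Union>\<D>)" using assms disjoint_boxes_open open_not_negligible by blast
  then show ?thesis
    using disjoint_boxes_lmeasurable[OF assms(1)] by (metis measure_nonneg negligible_iff_measure less_le)
qed

text \<open>Divide by the right-hand side and apply the inequality of the arithmetic and geometric mean to
  the ratios \<open>p i / (p i + q i)\<close> and \<open>q i / (p i + q i)\<close>, which add up to 1.\<close>
lemma prod_root_superadditive:
  fixes p q :: "'i \<Rightarrow> real"
  assumes "finite I" "I \<noteq> {}" "\<And>i. i \<in> I \<Longrightarrow> 0 < p i" "\<And>i. i \<in> I \<Longrightarrow> 0 < q i"
  shows "root (card I) (prod p I) + root (card I) (prod q I) \<le> root (card I) (\<Prod>i\<in>I. p i + q i)"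
proof -
  let ?n = "card I" and ?P = "\<Prod>i\<in>I. p i + q i"
  have n: "0 < ?n" using assms by (simp add: card_gt_0_iff)
  have P: "0 < ?P" using assms by (intro prod_pos) (auto intro: add_pos_pos)
  have s: "p i + q i \<noteq> 0" if "i \<in> I" for i using assms(3,4)[OF that] by linarith
  have am_gm: "root ?n (\<Prod>i\<in>I. x i) \<le> (\<Sum>i\<in>I. x i) / ?n" if x: "\<And>i. i \<in> I \<Longrightarrow> 0 < x i" for x :: "'i \<Rightarrow> real"
  proof -
    have "(\<Prod>i\<in>I. x i) powr (1 / ?n) \<le> (\<Sum>i\<in>I. x i / ?n)"
      using assms(1,2) x by (intro arith_geom_mean) (auto intro: less_imp_le)
    moreover have "root ?n (\<Prod>i\<in>I. x i) = (\<Prod>i\<in>I. x i) powr (1 / ?n)"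
      using n prod_pos[of I x] x by (intro root_powr_inverse) simp_all
    ultimately show ?thesis by (simp add: sum_divide_distrib)
  qed
  have "root ?n (\<Prod>i\<in>I. p i / (p i + q i)) \<le> (\<Sum>i\<in>I. p i / (p i + q i)) / ?n"
    using assms by (intro am_gm) (auto intro!: divide_pos_pos add_pos_pos)
  moreover have "root ?n (\<Prod>i\<in>I. q i / (p i + q i)) \<le> (\<Sum>i\<in>I. q i / (p i + q i)) / ?n"
    using assms by (intro am_gm) (auto intro!: divide_pos_pos add_pos_pos)
  moreover have "(\<Sum>i\<in>I. p i / (p i + q i)) + (\<Sum>i\<in>I. q i / (p i + q i)) = ?n"
  proof -
    have "(\<Sum>i\<in>I. p i / (p i + q i)) + (\<Sum>i\<in>I. q i / (p i + q i)) = (\<Sum>i\<in>I. 1)"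
      unfolding sum.distrib[symmetric] using s by (intro sum.cong) (auto simp: add_divide_distrib[symmetric])
    then show ?thesis by simp
  qed
  ultimately have "root ?n (\<Prod>i\<in>I. p i / (p i + q i)) + root ?n (\<Prod>i\<in>I. q i / (p i + q i)) \<le> real ?n / real ?n"
    by (metis (no_types, lifting) add_divide_distrib add_mono)
  then have "root ?n (prod p I / ?P) + root ?n (prod q I / ?P) \<le> 1"
    using n by (simp add: prod_dividef)
  then have "(root ?n (prod p I) + root ?n (prod q I)) / root ?n ?P \<le> 1"
    using n by (simp add: real_root_divide add_divide_distrib)
  then show ?thesis using P n by (simp add: field_simps)
qed

lemma brunn_minkowski_box:
  fixes a b c d :: "'a::euclidean_space"
  assumes ne: "box a b \<noteq> {}" "box c d \<noteq> {}" and S: "S \<in> lmeasurable"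
    and sub: "\<And>x y. x \<in> box a b \<Longrightarrow> y \<in> box c d \<Longrightarrow> x + y \<in> S"
  shows "root DIM('a) (measure lebesgue (box a b)) + root DIM('a) (measure lebesgue (box c d))
    \<le> root DIM('a) (measure lebesgue S)"
proof -
  have ab: "a \<bullet> i < b \<bullet> i" and cd: "c \<bullet> i < d \<bullet> i" if "i \<in> Basis" for i
    using ne that by (auto simp: box_ne_empty)
  have mb: "measure lebesgue (box u v) = (\<Prod>i\<in>Basis. (v - u) \<bullet> i)" if "\<And>i. i \<in> Basis \<Longrightarrow> u \<bullet> i < v \<bullet> i" for u v :: 'a
    using that by (simp add: measure_lborel_box_eq less_imp_le)
  have "box (a + c) (b + d) \<subseteq> S"
  proof
    fix z assume z: "z \<in> box (a + c) (b + d)"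
    \<comment> \<open>every coordinate of \<open>z - a - c\<close> is divided in the ratio of the side lengths of the two boxes\<close>
    define x where "x = (\<Sum>i\<in>Basis. (a \<bullet> i + (z \<bullet> i - a \<bullet> i - c \<bullet> i) * ((b \<bullet> i - a \<bullet> i) / (b \<bullet> i - a \<bullet> i + (d \<bullet> i - c \<bullet> i)))) *\<^sub>R i)"
    have xi: "x \<bullet> i = a \<bullet> i + (z \<bullet> i - a \<bullet> i - c \<bullet> i) * ((b \<bullet> i - a \<bullet> i) / (b \<bullet> i - a \<bullet> i + (d \<bullet> i - c \<bullet> i)))"
      if "i \<in> Basis" for i using that by (simp add: x_def)
    have *: "0 < t * (p / (p + q)) \<and> t * (p / (p + q)) < p \<and> 0 < t - t * (p / (p + q)) \<and> t - t * (p / (p + q)) < q"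
      if "0 < t" "t < p + q" "0 < p" "0 < q" for t p q :: real
    proof -
      have "t * (p / (p + q)) = p * (t / (p + q))" "t - t * (p / (p + q)) = q * (t / (p + q))"
        using that by (auto simp: field_simps)
      moreover have "0 < t / (p + q)" "t / (p + q) < 1" using that by auto
      ultimately show ?thesis using that by (metis mult.right_neutral mult_pos_pos mult_strict_left_mono)
    qed
    have **: "a \<bullet> i < x \<bullet> i \<and> x \<bullet> i < b \<bullet> i \<and> c \<bullet> i < (z - x) \<bullet> i \<and> (z - x) \<bullet> i < d \<bullet> i" if i: "i \<in> Basis" for i
    proof -
      define t p q where "t = z \<bullet> i - a \<bullet> i - c \<bullet> i" and "p = b \<bullet> i - a \<bullet> i" and "q = d \<bullet> i - c \<bullet> i"
      have "0 < p" "0 < q" "0 < t" "t < p + q"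
        using ab[OF i] cd[OF i] z i by (auto simp: t_def p_def q_def mem_box inner_simps algebra_simps)
      note *[OF this(3,4,1,2)]
      moreover have "x \<bullet> i = a \<bullet> i + t * (p / (p + q))" using xi[OF i] by (simp only: t_def p_def q_def)
      ultimately show ?thesis by (simp only: t_def p_def q_def inner_diff_left) linarith
    qed
    then have "x \<in> box a b" "z - x \<in> box c d" by (auto simp: mem_box)
    then show "z \<in> S" using sub[of x "z - x"] by simp
  qed
  then have le: "measure lebesgue (box (a + c) (b + d)) \<le> measure lebesgue S"
    using S by (intro measure_mono_fmeasurable) auto
  have "root DIM('a) (\<Prod>i\<in>Basis. (b - a) \<bullet> i) + root DIM('a) (\<Prod>i\<in>Basis. (d - c) \<bullet> i) \<le> root DIM('a) (\<Prod>i\<in>Basis. (b - a) \<bullet> i + (d - c) \<bullet> i)"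
    using ab cd by (intro prod_root_superadditive) (auto simp: inner_simps)
  also have "(\<Prod>i\<in>Basis. (b - a) \<bullet> i + (d - c) \<bullet> i) = (\<Prod>i\<in>Basis. ((b + d) - (a + c)) \<bullet> i)"
    by (intro prod.cong) (auto simp: inner_simps)
  also have "\<dots> = measure lebesgue (box (a + c) (b + d))"
    using ab cd by (subst mb) (auto simp: inner_simps add_strict_mono)
  also have "root DIM('a) \<dots> \<le> root DIM('a) (measure lebesgue S)" using le by simp
  finally show ?thesis using mb[of a b] mb[of c d] ab cd by simp
qed

lemma disjoint_boxes_split:
  fixes \<D> :: "'a::euclidean_space set set"
  assumes D: "disjoint_boxes \<D>" and i: "i \<in> Basis"
    and H: "H = {x. x \<bullet> i < t} \<or> H = {x. x \<bullet> i > t}"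
  obtains \<E> where "disjoint_boxes \<E>" "\<Union>\<E> = \<Union>\<D> \<inter> H" "card \<E> \<le> card \<D>"
    "(\<exists>D\<in>\<D>. D \<inter> H = {}) \<longrightarrow> card \<E> < card \<D>"
proof
  let ?E = "(\<lambda>D. D \<inter> H) ` {D \<in> \<D>. D \<inter> H \<noteq> {}}"
  have fin: "finite \<D>" using D by (simp add: disjoint_boxes_def)
  have bx: "\<exists>a' b'. box a b \<inter> H = box a' b'" for a b
  proof (cases "H = {x. x \<bullet> i < t}")
    case True
    have "box a b \<inter> H = box a (\<Sum>j\<in>Basis. (if j = i then min (b \<bullet> i) t else b \<bullet> j) *\<^sub>R j)"
      using i by (auto simp: True mem_box) (metis min_less_iff_conj)+
    then show ?thesis by blast
  next
    case False
    then have H: "H = {x. x \<bullet> i > t}" using H by simp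
    have "box a b \<inter> H = box (\<Sum>j\<in>Basis. (if j = i then max (a \<bullet> i) t else a \<bullet> j) *\<^sub>R j) b"
      using i by (auto simp: H mem_box) (metis max_less_iff_conj)+
    then show ?thesis by blast
  qed
  show "disjoint_boxes ?E"
    unfolding disjoint_boxes_def
  proof (intro conjI ballI)
    show "finite ?E" using fin by auto
    show "pairwise disjnt ?E"
      using D unfolding disjoint_boxes_def pairwise_def disjnt_def by blast
    fix E assume "E \<in> ?E"
    then obtain D' where D': "D' \<in> \<D>" "E = D' \<inter> H" "E \<noteq> {}" by auto
    then show "E \<noteq> {}" by simp
    obtain a b where "D' = box a b" using disjoint_boxes_obtain[OF D D'(1)] by blast
    then show "\<exists>a b. E = box a b" using bx D' by simp
  qed
  show "\<Union>?E = \<Union>\<D> \<inter> H" by blast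
  have le: "card ?E \<le> card {D \<in> \<D>. D \<inter> H \<noteq> {}}" using fin by (intro card_image_le) auto
  also have "\<dots> \<le> card \<D>" using fin by (intro card_mono) auto
  finally show "card ?E \<le> card \<D>" .
  show "(\<exists>D\<in>\<D>. D \<inter> H = {}) \<longrightarrow> card ?E < card \<D>"
  proof
    assume "\<exists>D\<in>\<D>. D \<inter> H = {}"
    then have "card {D \<in> \<D>. D \<inter> H \<noteq> {}} < card \<D>" using fin by (intro psubset_card_mono) auto
    then show "card ?E < card \<D>" using le by linarith
  qed
qed

lemma measure_split_hyperplane:
  fixes S :: "'a::euclidean_space set"
  assumes S: "S \<in> lmeasurable" and i: "i \<in> Basis"
  shows "measure lebesgue S = measure lebesgue (S \<inter> {x. x \<bullet> i < t}) + measure lebesgue (S \<inter> {x. x \<bullet> i > t})"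
proof -
  have ms: "S \<inter> {x. x \<bullet> i < t} \<in> lmeasurable" "S \<inter> {x. x \<bullet> i > t} \<in> lmeasurable"
    using open_halfspace_component_lt[of i t] open_halfspace_component_gt[of t i]
    by (simp_all add: fmeasurable_Int_fmeasurable[OF S] borel_open)
  have "negligible {x. x \<bullet> i = t}"
    using i negligible_hyperplane[of i t] by (auto simp: inner_commute)
  then have n: "negligible (S \<inter> {x. x \<bullet> i = t})" by (rule negligible_subset) auto
  have "measure lebesgue S = measure lebesgue ((S \<inter> {x. x \<bullet> i < t} \<union> S \<inter> {x. x \<bullet> i > t}))"
  proof (rule measure_negligible_symdiff[OF S, symmetric])
    have "S - (S \<inter> {x. x \<bullet> i < t} \<union> S \<inter> {x. x \<bullet> i > t}) \<union> (S \<inter> {x. x \<bullet> i < t} \<union> S \<inter> {x. x \<bullet> i > t} - S) = S \<inter> {x. x \<bullet> i = t}"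
      by auto
    then show "negligible (S - (S \<inter> {x. x \<bullet> i < t} \<union> S \<inter> {x. x \<bullet> i > t}) \<union> (S \<inter> {x. x \<bullet> i < t} \<union> S \<inter> {x. x \<bullet> i > t} - S))"
      using n by simp
  qed
  also have "\<dots> = measure lebesgue (S \<inter> {x. x \<bullet> i < t}) + measure lebesgue (S \<inter> {x. x \<bullet> i > t})"
  proof -
    have "S \<inter> {x. x \<bullet> i < t} \<inter> (S \<inter> {x. x \<bullet> i > t}) = {}" by auto
    then show ?thesis using measure_Un3[OF ms] by simp
  qed
  finally show ?thesis .
qed

lemma continuous_measure_boxes_halfspace:
  fixes \<D> :: "'a::euclidean_space set set"
  assumes D: "disjoint_boxes \<D>" and i: "i \<in> Basis"
  shows "continuous_on UNIV (\<lambda>s. measure lebesgue (\<Union>\<D> \<inter> {x. x \<bullet> i < s}))"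
proof -
  have one: "continuous_on UNIV (\<lambda>s. measure lebesgue (D \<inter> {x. x \<bullet> i < s}))" if "D \<in> \<D>" for D
  proof -
    obtain a b where ab: "D = box a b" "D \<noteq> {}" using disjoint_boxes_obtain[OF D \<open>D \<in> \<D>\<close>] by blast
    then have lt: "a \<bullet> j < b \<bullet> j" if "j \<in> Basis" for j using that by (auto simp: box_ne_empty)
    have "measure lebesgue (D \<inter> {x. x \<bullet> i < s}) = (\<Prod>j\<in>Basis - {i}. (b - a) \<bullet> j) * max 0 (min (b \<bullet> i) s - a \<bullet> i)" for s
    proof -
      define b' where "b' = (\<Sum>j\<in>Basis. (if j = i then min (b \<bullet> i) s else b \<bullet> j) *\<^sub>R j)"
      have b': "b' \<bullet> j = (if j = i then min (b \<bullet> i) s else b \<bullet> j)" if "j \<in> Basis" for j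
        using that by (simp add: b'_def)
      have "D \<inter> {x. x \<bullet> i < s} = box a b'"
        using i by (auto simp: ab(1) mem_box b') (metis min_less_iff_conj)+
      then have "measure lebesgue (D \<inter> {x. x \<bullet> i < s}) = measure lborel (box a b')" by simp
      also have "\<dots> = (\<Prod>j\<in>Basis - {i}. (b - a) \<bullet> j) * max 0 (min (b \<bullet> i) s - a \<bullet> i)"
      proof (cases "a \<bullet> i \<le> min (b \<bullet> i) s")
        case True
        then have "\<forall>j\<in>Basis. a \<bullet> j \<le> b' \<bullet> j" using lt by (auto simp: b' less_imp_le)
        then have "measure lborel (box a b') = (\<Prod>j\<in>Basis. (b' - a) \<bullet> j)" by (simp add: measure_lborel_box_eq)
        also have "\<dots> = (b' - a) \<bullet> i * (\<Prod>j\<in>Basis - {i}. (b' - a) \<bullet> j)"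
          using i by (intro prod.remove) auto
        also have "(\<Prod>j\<in>Basis - {i}. (b' - a) \<bullet> j) = (\<Prod>j\<in>Basis - {i}. (b - a) \<bullet> j)"
          by (intro prod.cong) (auto simp: inner_diff_left b')
        finally show ?thesis using True i by (simp add: inner_diff_left b')
      next
        case False
        then have "\<not> (\<forall>j\<in>Basis. a \<bullet> j \<le> b' \<bullet> j)" using i b'[OF i] by (intro notI) auto
        then have "measure lborel (box a b') = 0" by (simp only: measure_lborel_box_eq if_False)
        moreover have "max 0 (min (b \<bullet> i) s - a \<bullet> i) = 0" using False by linarith
        ultimately show ?thesis by simp
      qed
      finally show ?thesis .
    qed
    then show ?thesis by (simp only:) (intro continuous_intros)
  qed
  have "measure lebesgue (\<Union>\<D> \<inter> {x. x \<bullet> i < s}) = (\<Sum>D\<in>\<D>. measure lebesgue (D \<inter> {x. x \<bullet> i < s}))" for s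
  proof -
    have "\<Union>\<D> \<inter> {x. x \<bullet> i < s} = \<Union>((\<lambda>D. D \<inter> {x. x \<bullet> i < s}) ` \<D>)" by blast
    moreover have "measure lebesgue \<dots> = (\<Sum>D\<in>\<D>. measure lebesgue (D \<inter> {x. x \<bullet> i < s}))"
    proof (rule measure_negligible_finite_Union_image)
      show "finite \<D>" using D by (simp add: disjoint_boxes_def)
      show "D \<inter> {x. x \<bullet> i < s} \<in> lmeasurable" if "D \<in> \<D>" for D
      proof -
        have "D \<in> lmeasurable" using D that by (auto simp: disjoint_boxes_def)
        then show ?thesis using open_halfspace_component_lt[of i s] by (simp add: fmeasurable_Int_fmeasurable borel_open)
      qed
      show "pairwise (\<lambda>x y. negligible ((x \<inter> {x. x \<bullet> i < s}) \<inter> (y \<inter> {x. x \<bullet> i < s}))) \<D>"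
      proof (rule pairwiseI)
        fix X Y assume "X \<in> \<D>" "Y \<in> \<D>" "X \<noteq> Y"
        then have "X \<inter> Y = {}" using D by (auto simp: disjoint_boxes_def pairwise_def disjnt_def)
        then have "(X \<inter> {x. x \<bullet> i < s}) \<inter> (Y \<inter> {x. x \<bullet> i < s}) = {}" by blast
        then show "negligible ((X \<inter> {x. x \<bullet> i < s}) \<inter> (Y \<inter> {x. x \<bullet> i < s}))" by simp
      qed
    qed
    ultimately show ?thesis by simp
  qed
  then show ?thesis using one by (simp only:) (intro continuous_on_sum)
qed

lemma boxes_halfspace_divide:
  fixes \<D> :: "'a::euclidean_space set set"
  assumes D: "disjoint_boxes \<D>" and i: "i \<in> Basis" and \<theta>: "0 \<le> \<theta>" "\<theta> \<le> 1"
  obtains s where "measure lebesgue (\<Union>\<D> \<inter> {x. x \<bullet> i < s}) = \<theta> * measure lebesgue (\<Union>\<D>)"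
proof -
  let ?\<phi> = "\<lambda>s. measure lebesgue (\<Union>\<D> \<inter> {x. x \<bullet> i < s})"
  obtain R where R: "\<And>x. x \<in> \<Union>\<D> \<Longrightarrow> norm x \<le> R" using disjoint_boxes_bounded[OF D] unfolding bounded_iff by blast
  have R': "- R \<le> x \<bullet> i \<and> x \<bullet> i \<le> R" if "x \<in> \<Union>\<D>" for x
    using R[OF that] Basis_le_norm[OF i, of x] by linarith
  have "\<Union>\<D> \<inter> {x. x \<bullet> i < - R} = {}" using R' by force
  then have lo: "?\<phi> (- R) = 0" by simp
  have "\<Union>\<D> \<inter> {x. x \<bullet> i < max (- R) (R + 1)} = \<Union>\<D>" using R' by force
  then have hi: "?\<phi> (max (- R) (R + 1)) = measure lebesgue (\<Union>\<D>)" by simp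
  have "\<exists>s\<ge>- R. s \<le> max (- R) (R + 1) \<and> ?\<phi> s = \<theta> * measure lebesgue (\<Union>\<D>)"
  proof (rule IVT')
    show "?\<phi> (- R) \<le> \<theta> * measure lebesgue (\<Union>\<D>)" using lo \<theta> by simp
    show "\<theta> * measure lebesgue (\<Union>\<D>) \<le> ?\<phi> (max (- R) (R + 1))" using hi \<theta> by (simp add: mult_left_le_one_le)
    show "continuous_on {- R..max (- R) (R + 1)} ?\<phi>"
      using continuous_measure_boxes_halfspace[OF D i] by (rule continuous_on_subset) simp
  qed simp
  then show thesis using that by blast
qed

text \<open>The induction of Hadwiger and Ohmann: cut the first family by a coordinate hyperplane that
  separates two of its boxes, cut the second one by a parallel hyperplane in the same volume
  ratio, and apply the induction hypothesis on both sides.\<close>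
lemma brunn_minkowski_boxes_step:
  fixes \<A> \<B> :: "'a::euclidean_space set set"
  assumes A: "disjoint_boxes \<A>" and B: "disjoint_boxes \<B>" and neB: "\<B> \<noteq> {}" and cA: "2 \<le> card \<A>"
    and S: "S \<in> lmeasurable" and sub: "\<And>x y. x \<in> \<Union>\<A> \<Longrightarrow> y \<in> \<Union>\<B> \<Longrightarrow> x + y \<in> S"
    and IH: "\<And>(\<A>'::'a set set) \<B>' S'. disjoint_boxes \<A>' \<Longrightarrow> disjoint_boxes \<B>' \<Longrightarrow> \<A>' \<noteq> {} \<Longrightarrow> \<B>' \<noteq> {} \<Longrightarrow>
       card \<A>' + card \<B>' < card \<A> + card \<B> \<Longrightarrow> S' \<in> lmeasurable \<Longrightarrow>
       (\<And>x y. x \<in> \<Union>\<A>' \<Longrightarrow> y \<in> \<Union>\<B>' \<Longrightarrow> x + y \<in> S') \<Longrightarrow>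
       root DIM('a) (measure lebesgue (\<Union>\<A>')) + root DIM('a) (measure lebesgue (\<Union>\<B>')) \<le> root DIM('a) (measure lebesgue S')"
  shows "root DIM('a) (measure lebesgue (\<Union>\<A>)) + root DIM('a) (measure lebesgue (\<Union>\<B>)) \<le> root DIM('a) (measure lebesgue S)"
proof -
  let ?m = "measure lebesgue :: 'a set \<Rightarrow> real" and ?r = "root DIM('a)"
  obtain X Y where XY: "X \<in> \<A>" "Y \<in> \<A>" "X \<noteq> Y"
    using cA by (metis card_2_iff' obtain_subset_with_card_n subset_iff)
  have "\<exists>i\<in>Basis. \<exists>t. \<exists>X\<in>\<A>. \<exists>Y\<in>\<A>. X \<subseteq> {x. x \<bullet> i < t} \<and> Y \<subseteq> {x. x \<bullet> i > t}"
  proof -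
    obtain a b where X: "X = box a b" "box a b \<noteq> {}" using disjoint_boxes_obtain[OF A XY(1)] by blast
    obtain c d where Y: "Y = box c d" "box c d \<noteq> {}" using disjoint_boxes_obtain[OF A XY(2)] by blast
    note ne = X(2) Y(2)
    have "box a b \<inter> box c d = {}" using A XY X Y by (auto simp: disjoint_boxes_def pairwise_def disjnt_def)
    then obtain i where i: "i \<in> Basis" "b \<bullet> i \<le> c \<bullet> i \<or> d \<bullet> i \<le> a \<bullet> i"
      using ne unfolding disjoint_interval box_ne_empty by (auto simp: not_le[symmetric])
    from i(2) show ?thesis
    proof
      assume "b \<bullet> i \<le> c \<bullet> i"
      then have "X \<subseteq> {x. x \<bullet> i < b \<bullet> i}" "Y \<subseteq> {x. x \<bullet> i > b \<bullet> i}" using i(1) X Y by (auto simp: mem_box intro: le_less_trans)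
      then show ?thesis using i(1) XY by blast
    next
      assume "d \<bullet> i \<le> a \<bullet> i"
      then have "Y \<subseteq> {x. x \<bullet> i < d \<bullet> i}" "X \<subseteq> {x. x \<bullet> i > d \<bullet> i}" using i(1) X Y by (auto simp: mem_box intro: le_less_trans)
      then show ?thesis using i(1) XY by blast
    qed
  qed
  then obtain i t X Y where i: "i \<in> Basis" and X: "X \<in> \<A>" "X \<subseteq> {x. x \<bullet> i < t}" and Y: "Y \<in> \<A>" "Y \<subseteq> {x. x \<bullet> i > t}"
    by blast
  have neXY: "X \<noteq> {}" "Y \<noteq> {}" using A X Y by (auto simp: disjoint_boxes_def)
  have YX: "\<exists>D\<in>\<A>. D \<inter> {x. x \<bullet> i < t} = {}" "\<exists>D\<in>\<A>. D \<inter> {x. x \<bullet> i > t} = {}"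
    using X Y by (force intro!: bexI[of _ Y], force intro!: bexI[of _ X])
  obtain \<A>1 where A1: "disjoint_boxes \<A>1" "\<Union>\<A>1 = \<Union>\<A> \<inter> {x. x \<bullet> i < t}" "card \<A>1 < card \<A>"
    using disjoint_boxes_split[OF A i, of "{x. x \<bullet> i < t}" t, OF disjI1[OF refl]] YX(1) by metis
  obtain \<A>2 where A2: "disjoint_boxes \<A>2" "\<Union>\<A>2 = \<Union>\<A> \<inter> {x. x \<bullet> i > t}" "card \<A>2 < card \<A>"
    using disjoint_boxes_split[OF A i, of "{x. x \<bullet> i > t}" t, OF disjI2[OF refl]] YX(2) by metis
  have neA: "\<A>1 \<noteq> {}" "\<A>2 \<noteq> {}" using A1(2) A2(2) X Y neXY by blast+
  have mA: "?m (\<Union>\<A>) = ?m (\<Union>\<A>1) + ?m (\<Union>\<A>2)"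
    unfolding A1(2) A2(2) by (rule measure_split_hyperplane[OF disjoint_boxes_lmeasurable[OF A] i])
  have pos: "0 < ?m (\<Union>\<A>1)" "0 < ?m (\<Union>\<A>2)" "0 < ?m (\<Union>\<B>)"
    using measure_disjoint_boxes_pos A1 A2 neA B neB by blast+
  define \<theta> where "\<theta> = ?m (\<Union>\<A>1) / ?m (\<Union>\<A>)"
  have \<theta>: "0 < \<theta>" "\<theta> < 1" using pos mA by (auto simp: \<theta>_def)
  obtain s where s: "?m (\<Union>\<B> \<inter> {x. x \<bullet> i < s}) = \<theta> * ?m (\<Union>\<B>)"
    using boxes_halfspace_divide[OF B i, of \<theta>] \<theta> by auto
  obtain \<B>1 where B1: "disjoint_boxes \<B>1" "\<Union>\<B>1 = \<Union>\<B> \<inter> {x. x \<bullet> i < s}" "card \<B>1 \<le> card \<B>"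
    by (rule disjoint_boxes_split[OF B i, of "{x. x \<bullet> i < s}" s, OF disjI1[OF refl]]) (erule (2) that)
  obtain \<B>2 where B2: "disjoint_boxes \<B>2" "\<Union>\<B>2 = \<Union>\<B> \<inter> {x. x \<bullet> i > s}" "card \<B>2 \<le> card \<B>"
    by (rule disjoint_boxes_split[OF B i, of "{x. x \<bullet> i > s}" s, OF disjI2[OF refl]]) (erule (2) that)
  have mB: "?m (\<Union>\<B>) = ?m (\<Union>\<B>1) + ?m (\<Union>\<B>2)"
    unfolding B1(2) B2(2) by (rule measure_split_hyperplane[OF disjoint_boxes_lmeasurable[OF B] i])
  define q where "q = ?m (\<Union>\<B>) / ?m (\<Union>\<A>)"
  have Apos: "0 < ?m (\<Union>\<A>)" using pos mA by linarith
  have q: "0 < q" using pos Apos by (simp add: q_def)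
  have mB1: "?m (\<Union>\<B>1) = q * ?m (\<Union>\<A>1)" using s B1(2) by (simp add: \<theta>_def q_def)
  have "?m (\<Union>\<B>2) = q * ?m (\<Union>\<A>) - q * ?m (\<Union>\<A>1)" using mB mB1 Apos by (simp add: q_def)
  then have mB2: "?m (\<Union>\<B>2) = q * ?m (\<Union>\<A>2)" using mA by (simp add: algebra_simps)
  have neB12: "\<B>1 \<noteq> {}" "\<B>2 \<noteq> {}" using mB1 mB2 q pos by auto
  let ?S1 = "S \<inter> {x. x \<bullet> i < t + s}" and ?S2 = "S \<inter> {x. x \<bullet> i > t + s}"
  have mS: "?S1 \<in> lmeasurable" "?S2 \<in> lmeasurable"
    using open_halfspace_component_lt[of i "t + s"] open_halfspace_component_gt[of "t + s" i]
    by (simp_all add: fmeasurable_Int_fmeasurable[OF S] borel_open)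
  have half: "(1 + ?r q) ^ DIM('a) * ?m (\<Union>\<A>') \<le> ?m S'"
    if "?r (?m (\<Union>\<A>')) + ?r (q * ?m (\<Union>\<A>')) \<le> ?r (?m S')" for \<A>' S'
  proof -
    have "(1 + ?r q) * ?r (?m (\<Union>\<A>')) \<le> ?r (?m S')"
      using that by (simp add: real_root_mult algebra_simps)
    moreover have "0 \<le> (1 + ?r q) * ?r (?m (\<Union>\<A>'))" using q by (intro mult_nonneg_nonneg add_nonneg_nonneg) auto
    ultimately have "((1 + ?r q) * ?r (?m (\<Union>\<A>'))) ^ DIM('a) \<le> (?r (?m S')) ^ DIM('a)" by (rule power_mono)
    then show ?thesis by (simp add: power_mult_distrib)
  qed
  have "?r (?m (\<Union>\<A>1)) + ?r (?m (\<Union>\<B>1)) \<le> ?r (?m ?S1)"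
  proof (rule IH[OF A1(1) B1(1) neA(1) neB12(1)])
    show "?S1 \<in> lmeasurable" by (rule mS(1))
    show "card \<A>1 + card \<B>1 < card \<A> + card \<B>" using A1(3) B1(3) by linarith
    show "x + y \<in> ?S1" if "x \<in> \<Union>\<A>1" "y \<in> \<Union>\<B>1" for x y
      using that sub[of x y] unfolding A1(2) B1(2) by (auto simp: inner_add_left)
  qed
  then have 1: "(1 + ?r q) ^ DIM('a) * ?m (\<Union>\<A>1) \<le> ?m ?S1" unfolding mB1 by (rule half)
  have "?r (?m (\<Union>\<A>2)) + ?r (?m (\<Union>\<B>2)) \<le> ?r (?m ?S2)"
  proof (rule IH[OF A2(1) B2(1) neA(2) neB12(2)])
    show "?S2 \<in> lmeasurable" by (rule mS(2))
    show "card \<A>2 + card \<B>2 < card \<A> + card \<B>" using A2(3) B2(3) by linarith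
    show "x + y \<in> ?S2" if "x \<in> \<Union>\<A>2" "y \<in> \<Union>\<B>2" for x y
      using that sub[of x y] unfolding A2(2) B2(2) by (auto simp: inner_add_left)
  qed
  then have 2: "(1 + ?r q) ^ DIM('a) * ?m (\<Union>\<A>2) \<le> ?m ?S2" unfolding mB2 by (rule half)
  have "(1 + ?r q) ^ DIM('a) * ?m (\<Union>\<A>) \<le> ?m S"
    using 1 2 measure_split_hyperplane[OF S i, of "t + s"] mA by (simp add: algebra_simps)
  then have "?r ((1 + ?r q) ^ DIM('a) * ?m (\<Union>\<A>)) \<le> ?r (?m S)" by simp
  moreover have "?r ((1 + ?r q) ^ DIM('a) * ?m (\<Union>\<A>)) = (1 + ?r q) * ?r (?m (\<Union>\<A>))"
    using q by (simp add: real_root_mult real_root_power_cancel add_nonneg_nonneg)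
  moreover have "?r q * ?r (?m (\<Union>\<A>)) = ?r (?m (\<Union>\<B>))"
    using Apos by (simp add: q_def flip: real_root_mult)
  ultimately have "(1 + ?r q) * ?r (?m (\<Union>\<A>)) \<le> ?r (?m S)" "?r q * ?r (?m (\<Union>\<A>)) = ?r (?m (\<Union>\<B>))"
    by (simp_all only:)
  then show ?thesis by (simp add: distrib_right)
qed

lemma brunn_minkowski_boxes:
  fixes \<A> \<B> :: "'a::euclidean_space set set"
  assumes "disjoint_boxes \<A>" "disjoint_boxes \<B>" "\<A> \<noteq> {}" "\<B> \<noteq> {}"
    and "S \<in> lmeasurable" "\<And>x y. x \<in> \<Union>\<A> \<Longrightarrow> y \<in> \<Union>\<B> \<Longrightarrow> x + y \<in> S"
  shows "root DIM('a) (measure lebesgue (\<Union>\<A>)) + root DIM('a) (measure lebesgue (\<Union>\<B>)) \<le> root DIM('a) (measure lebesgue S)"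
  using assms
proof (induction "card \<A> + card \<B>" arbitrary: \<A> \<B> S rule: less_induct)
  case less
  have IH: "root DIM('a) (measure lebesgue (\<Union>\<A>')) + root DIM('a) (measure lebesgue (\<Union>\<B>')) \<le> root DIM('a) (measure lebesgue S')"
    if "disjoint_boxes \<A>'" "disjoint_boxes \<B>'" "\<A>' \<noteq> {}" "\<B>' \<noteq> {}" "card \<A>' + card \<B>' < card \<A> + card \<B>"
      "S' \<in> lmeasurable" "\<And>x y. x \<in> \<Union>\<A>' \<Longrightarrow> y \<in> \<Union>\<B>' \<Longrightarrow> x + y \<in> S'" for \<A>' \<B>' :: "'a set set" and S'
    by (rule less.hyps) (use that in auto)
  have pos: "0 < card \<A>" "0 < card \<B>" using less.prems by (auto simp: disjoint_boxes_def card_gt_0_iff)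
  consider "2 \<le> card \<A>" | "2 \<le> card \<B>" | "card \<A> = 1" "card \<B> = 1" using pos by linarith
  then show ?case
  proof cases
    case 1
    show ?thesis
      by (rule brunn_minkowski_boxes_step[OF less.prems(1,2,4) 1 less.prems(5,6) IH])
  next
    case 2
    have "root DIM('a) (measure lebesgue (\<Union>\<B>)) + root DIM('a) (measure lebesgue (\<Union>\<A>)) \<le> root DIM('a) (measure lebesgue S)"
    proof (rule brunn_minkowski_boxes_step[OF less.prems(2,1,3) 2 less.prems(5)])
      show "x + y \<in> S" if "x \<in> \<Union>\<B>" "y \<in> \<Union>\<A>" for x y
        using less.prems(6)[OF that(2,1)] by (simp add: add.commute)
    next
      fix \<A>' \<B>' :: "'a set set" and S' :: "'a set"
      assume "disjoint_boxes \<A>'" "disjoint_boxes \<B>'" "\<A>' \<noteq> {}" "\<B>' \<noteq> {}"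
        "card \<A>' + card \<B>' < card \<B> + card \<A>" "S' \<in> lmeasurable" "\<And>x y. x \<in> \<Union>\<A>' \<Longrightarrow> y \<in> \<Union>\<B>' \<Longrightarrow> x + y \<in> S'"
      then show "root DIM('a) (measure lebesgue (\<Union>\<A>')) + root DIM('a) (measure lebesgue (\<Union>\<B>')) \<le> root DIM('a) (measure lebesgue S')"
        by (intro IH) (simp_all add: add.commute)
    qed
    then show ?thesis by simp
  next
    case 3
    then obtain X Y where XY: "\<A> = {X}" "\<B> = {Y}" by (meson card_1_singletonE)
    obtain a b where ab: "X = box a b" "box a b \<noteq> {}" using disjoint_boxes_obtain[OF less.prems(1), of X] XY by blast
    obtain c d where cd: "Y = box c d" "box c d \<noteq> {}" using disjoint_boxes_obtain[OF less.prems(2), of Y] XY by blast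
    show ?thesis using brunn_minkowski_box[OF ab(2) cd(2) less.prems(5)] less.prems(6) XY ab(1) cd(1) by simp
  qed
qed

text \<open>The covering lemma for gauges, applied to a gauge that is \<open>A\<close> itself at the points of \<open>A\<close>, writes \<open>A\<close> as a
  countable union of non-overlapping closed boxes; finitely many of them exhaust its measure up
  to \<open>e\<close>.\<close>
lemma open_approx_disjoint_boxes:
  fixes A :: "'a::euclidean_space set"
  assumes A: "open A" "bounded A" "A \<noteq> {}" and e: "0 < e"
  obtains \<D> where "disjoint_boxes \<D>" "\<Union>\<D> \<subseteq> A" "measure lebesgue A - e < measure lebesgue (\<Union>\<D>)"
proof -
  obtain a b where ab: "A \<subseteq> cbox a b" by (rule bounded_subset_cbox_symmetric[OF A(2)])
  have "box a b \<noteq> {}"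
  proof -
    have "interior A \<subseteq> interior (cbox a b)" using ab by (rule interior_mono)
    then show ?thesis using A by (auto simp: interior_open)
  qed
  have "gauge (\<lambda>x. if x \<in> A then A else UNIV)" using A(1) by (auto simp: gauge_def)
  then obtain \<K> where K: "countable \<K>" "\<And>K. K \<in> \<K> \<Longrightarrow> interior K \<noteq> {} \<and> (\<exists>c d. K = cbox c d)"
    "pairwise (\<lambda>A B. interior A \<inter> interior B = {}) \<K>"
    "\<And>K. K \<in> \<K> \<Longrightarrow> \<exists>x \<in> A \<inter> K. K \<subseteq> (if x \<in> A then A else UNIV)" "A \<subseteq> \<Union>\<K>"
    using covering_lemma[OF ab \<open>box a b \<noteq> {}\<close>, of "\<lambda>x. if x \<in> A then A else UNIV"] by metis
  have KA: "K \<subseteq> A" if "K \<in> \<K>" for K using K(4)[OF that] by auto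
  then have AK: "A = \<Union>\<K>" using K(5) by auto
  have "\<K> \<noteq> {}" using AK A(3) by auto
  define F where "F n = \<Union>(from_nat_into \<K> ` {..<n})" for n :: nat
  have inK: "from_nat_into \<K> j \<in> \<K>" for j using \<open>\<K> \<noteq> {}\<close> by (rule from_nat_into)
  have Fmeas: "F n \<in> lmeasurable" for n
    unfolding F_def
  proof (rule fmeasurable.finite_Union)
    show "from_nat_into \<K> ` {..<n} \<subseteq> lmeasurable"
    proof (rule image_subsetI)
      fix j
      obtain c d where "from_nat_into \<K> j = cbox c d" using K(2)[OF inK] by blast
      then show "from_nat_into \<K> j \<in> lmeasurable" by simp
    qed
  qed simp
  have Am: "A \<in> lmeasurable" using A lmeasurable_open by blast
  have "(\<Union>n. F n) = A"
  proof -
    have "(\<Union>n. F n) = \<Union>(range (from_nat_into \<K>))" unfolding F_def by blast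
    then show ?thesis using AK K(1) \<open>\<K> \<noteq> {}\<close> by (simp add: range_from_nat_into)
  qed
  moreover have "(\<lambda>n. measure lebesgue (F n)) \<longlonglongrightarrow> measure lebesgue (\<Union>n. F n)"
  proof (rule Lim_measure_incseq)
    show "incseq F" unfolding F_def incseq_def by fastforce
    show "emeasure lebesgue (\<Union>n. F n) \<noteq> \<infinity>" using \<open>(\<Union>n. F n) = A\<close> Am by (auto simp: fmeasurable_def)
  qed (use Fmeas in auto)
  ultimately have "(\<lambda>n. measure lebesgue (F n)) \<longlonglongrightarrow> measure lebesgue A" by simp
  then have "\<forall>\<^sub>F n in sequentially. measure lebesgue A - e < measure lebesgue (F n)"
    by (rule order_tendstoD) (use e in simp)
  then obtain n where n: "measure lebesgue A - e < measure lebesgue (F n)"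
    using eventually_happens'[OF sequentially_bot] by blast
  let ?\<D> = "interior ` from_nat_into \<K> ` {..<n}"
  have meq: "measure lebesgue (F n) = measure lebesgue (\<Union>?\<D>)"
  proof (rule measure_negligible_symdiff[symmetric])
    show "F n \<in> lmeasurable" by fact
    have "F n - \<Union>?\<D> \<union> (\<Union>?\<D> - F n) \<subseteq> (\<Union>K\<in>from_nat_into \<K> ` {..<n}. frontier K)"
    proof
      fix x assume "x \<in> F n - \<Union>?\<D> \<union> (\<Union>?\<D> - F n)"
      moreover have "\<Union>?\<D> \<subseteq> F n" unfolding F_def using interior_subset by blast
      ultimately obtain K where "K \<in> from_nat_into \<K> ` {..<n}" "x \<in> K" "x \<notin> interior K"
        unfolding F_def by blast
      then show "x \<in> (\<Union>K\<in>from_nat_into \<K> ` {..<n}. frontier K)"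
        using closure_subset[of K] by (auto simp: frontier_def)
    qed
    moreover have "negligible (\<Union>K\<in>from_nat_into \<K> ` {..<n}. frontier K)"
    proof (rule negligible_Union)
      fix T assume "T \<in> frontier ` from_nat_into \<K> ` {..<n}"
      then obtain j where j: "T = frontier (from_nat_into \<K> j)" by auto
      obtain c d where "from_nat_into \<K> j = cbox c d" using K(2)[OF inK] by blast
      then show "negligible T" using j by (simp add: negligible_convex_frontier)
    qed simp
    ultimately show "negligible (F n - \<Union>?\<D> \<union> (\<Union>?\<D> - F n))" by (rule negligible_subset[rotated])
  qed
  show thesis
  proof
    show "disjoint_boxes ?\<D>"
      unfolding disjoint_boxes_def
    proof (intro conjI ballI)
      fix D assume "D \<in> ?\<D>"
      then obtain j where j: "D = interior (from_nat_into \<K> j)" by auto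
      then show "D \<noteq> {}" using K(2)[OF inK] by simp
      obtain c d where "from_nat_into \<K> j = cbox c d" using K(2)[OF inK] by blast
      then show "\<exists>a b. D = box a b" using j interior_cbox by metis
    next
      show "pairwise disjnt ?\<D>"
      proof (rule pairwiseI)
        fix X Y assume "X \<in> ?\<D>" "Y \<in> ?\<D>" "X \<noteq> Y"
        then obtain j l where jl: "X = interior (from_nat_into \<K> j)" "Y = interior (from_nat_into \<K> l)" by auto
        then have "from_nat_into \<K> j \<noteq> from_nat_into \<K> l" using \<open>X \<noteq> Y\<close> by auto
        then show "disjnt X Y" using K(3) inK jl by (auto simp: pairwise_def disjnt_def)
      qed
    qed simp
    show "\<Union>?\<D> \<subseteq> A" using KA inK interior_subset by blast
    show "measure lebesgue A - e < measure lebesgue (\<Union>?\<D>)" using n meq by simp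
  qed
qed

theorem brunn_minkowski:
  fixes A B S :: "'a::euclidean_space set"
  assumes A: "open A" "bounded A" "A \<noteq> {}" and B: "open B" "bounded B" "B \<noteq> {}" and S: "S \<in> lmeasurable"
    and sub: "\<And>x y. x \<in> A \<Longrightarrow> y \<in> B \<Longrightarrow> x + y \<in> S"
  shows "root DIM('a) (measure lebesgue A) + root DIM('a) (measure lebesgue B) \<le> root DIM('a) (measure lebesgue S)"
proof -
  let ?m = "measure lebesgue :: 'a set \<Rightarrow> real"
  have approx: "\<exists>\<D>. (\<forall>n. disjoint_boxes (\<D> n) \<and> \<D> n \<noteq> {} \<and> \<Union>(\<D> n) \<subseteq> A) \<and> (\<lambda>n. ?m (\<Union>(\<D> n))) \<longlonglongrightarrow> ?m A"
    if A: "open A" "bounded A" "A \<noteq> {}" for A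
  proof -
    have Am: "A \<in> lmeasurable" using A lmeasurable_open by blast
    have "\<not> negligible A" using A open_not_negligible by blast
    then have mp: "0 < ?m A" using Am by (metis measure_nonneg negligible_iff_measure less_le)
    have "\<exists>\<D>. disjoint_boxes \<D> \<and> \<D> \<noteq> {} \<and> \<Union>\<D> \<subseteq> A \<and> ?m A - ?m A / (real n + 2) < ?m (\<Union>\<D>)" for n
    proof -
      obtain \<D> where D: "disjoint_boxes \<D>" "\<Union>\<D> \<subseteq> A" "?m A - ?m A / (real n + 2) < ?m (\<Union>\<D>)"
        using open_approx_disjoint_boxes[OF A, of "?m A / (real n + 2)"] mp by auto
      have "?m A / (real n + 2) \<le> ?m A" using mp by (simp add: field_simps)
      then have "\<D> \<noteq> {}" using D(3) by auto
      then show ?thesis using D by blast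
    qed
    then obtain \<D> where D: "\<And>n. disjoint_boxes (\<D> n)" "\<And>n. \<D> n \<noteq> {}" "\<And>n. \<Union>(\<D> n) \<subseteq> A"
      "\<And>n. ?m A - ?m A / (real n + 2) < ?m (\<Union>(\<D> n))" by metis
    have "(\<lambda>n. ?m (\<Union>(\<D> n))) \<longlonglongrightarrow> ?m A"
    proof (rule tendsto_sandwich)
      show "\<forall>\<^sub>F n in sequentially. ?m A - ?m A / (real n + 2) \<le> ?m (\<Union>(\<D> n))" using D(4) by (simp add: less_imp_le)
      show "\<forall>\<^sub>F n in sequentially. ?m (\<Union>(\<D> n)) \<le> ?m A"
        using measure_mono_fmeasurable[OF D(3) fmeasurableD[OF disjoint_boxes_lmeasurable[OF D(1)]] Am] by simp
      have "(\<lambda>n. 1 / real (n + 2)) \<longlonglongrightarrow> 0"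
        using LIMSEQ_ignore_initial_segment[OF lim_1_over_n, of 2] by simp
      then have "(\<lambda>n. ?m A - ?m A * (1 / real (n + 2))) \<longlonglongrightarrow> ?m A - ?m A * 0" by (intro tendsto_intros)
      then show "(\<lambda>n. ?m A - ?m A / (real n + 2)) \<longlonglongrightarrow> ?m A" by (simp add: add.commute)
    qed simp
    then show ?thesis using D by blast
  qed
  obtain \<A> where \<A>: "\<And>n. disjoint_boxes (\<A> n)" "\<And>n. \<A> n \<noteq> {}" "\<And>n. \<Union>(\<A> n) \<subseteq> A" "(\<lambda>n. ?m (\<Union>(\<A> n))) \<longlonglongrightarrow> ?m A"
    using approx[OF A] by blast
  obtain \<B> where \<B>: "\<And>n. disjoint_boxes (\<B> n)" "\<And>n. \<B> n \<noteq> {}" "\<And>n. \<Union>(\<B> n) \<subseteq> B" "(\<lambda>n. ?m (\<Union>(\<B> n))) \<longlonglongrightarrow> ?m B"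
    using approx[OF B] by blast
  have "(\<lambda>n. root DIM('a) (?m (\<Union>(\<A> n))) + root DIM('a) (?m (\<Union>(\<B> n)))) \<longlonglongrightarrow> root DIM('a) (?m A) + root DIM('a) (?m B)"
    by (intro tendsto_add tendsto_real_root \<A>(4) \<B>(4))
  moreover have "root DIM('a) (?m (\<Union>(\<A> n))) + root DIM('a) (?m (\<Union>(\<B> n))) \<le> root DIM('a) (?m S)" for n
    by (rule brunn_minkowski_boxes[OF \<A>(1) \<B>(1) \<A>(2) \<B>(2) S]) (use sub \<A>(3) \<B>(3) in blast)
  ultimately show ?thesis by (intro LIMSEQ_le_const2) auto
qed

section \<open>Polytopes with prescribed facet normals\<close>

definition hpoly :: "'a::euclidean_space set \<Rightarrow> ('a \<Rightarrow> real) \<Rightarrow> 'a set" where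
  "hpoly U h = {x. \<forall>u\<in>U. u \<bullet> x \<le> h u}"

text \<open>The cone with apex 0 over the face of \<open>hpoly U h\<close> with normal \<open>u\<close>, without the apex and cut off at height \<open>r\<close>:
  among the ratios \<open>(v \<bullet> x) / h v\<close>, the one for \<open>u\<close> is largest. The cut height is a
  parameter of its own because dilating a wedge changes only this height.\<close>
definition wedge :: "'a::euclidean_space set \<Rightarrow> ('a \<Rightarrow> real) \<Rightarrow> 'a \<Rightarrow> real \<Rightarrow> 'a set" where
  "wedge U h u r = {x. 0 < u \<bullet> x \<and> u \<bullet> x \<le> r \<and> (\<forall>v\<in>U. h u * (v \<bullet> x) \<le> h v * (u \<bullet> x))}"

definition cone_volume :: "'a::euclidean_space set \<Rightarrow> ('a \<Rightarrow> real) \<Rightarrow> 'a \<Rightarrow> real" where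
  "cone_volume U h u = measure lebesgue (wedge U h u (h u))"

lemma measure_lebesgue_scale:
  fixes S :: "'a::euclidean_space set"
  assumes "0 \<le> c"
  shows "measure lebesgue ((*\<^sub>R) c ` S) = c ^ DIM('a) * measure lebesgue S"
  using measure_lebesgue_affine[of c 0 S] assms by simp

lemma lmeasurable_scale:
  fixes S :: "'a::euclidean_space set"
  assumes "S \<in> lmeasurable"
  shows "(*\<^sub>R) c ` S \<in> lmeasurable"
proof (cases "c = 0")
  case True
  then have "(*\<^sub>R) c ` S \<subseteq> {0}" by auto
  then have "negligible ((*\<^sub>R) c ` S)" by (rule negligible_subset[rotated]) simp
  then show ?thesis by (rule negligible_imp_measurable)
next
  case False
  have "(*\<^sub>R) c ` S = (*\<^sub>R) (1 / c) -` S"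
  proof (intro set_eqI iffI)
    fix x assume "x \<in> (*\<^sub>R) (1 / c) -` S"
    then show "x \<in> (*\<^sub>R) c ` S" using False by (intro image_eqI[of _ _ "(1 / c) *\<^sub>R x"]) auto
  qed (use False in auto)
  then have "(*\<^sub>R) c ` S \<in> sets lebesgue"
    using lebesgue_measurable_scaling[of "1/c"] assms measurable_sets[of "(*\<^sub>R) (1 / c)" lebesgue lebesgue S]
    by (auto simp: fmeasurable_def)
  moreover have "emeasure lebesgue ((*\<^sub>R) c ` S) < \<infinity>"
    using emeasure_lebesgue_affine[of c 0 S] assms by (auto simp: fmeasurable_def ennreal_mult_less_top)
  ultimately show ?thesis by (auto simp: fmeasurable_def)
qed

locale spanning_directions =
  fixes U :: "'a::euclidean_space set"
  assumes finite_U: "finite U" and unit: "\<And>u. u \<in> U \<Longrightarrow> norm u = 1"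
    and spanning: "\<And>e. e \<noteq> 0 \<Longrightarrow> \<exists>u\<in>U. 0 < u \<bullet> e"
begin

abbreviation V :: "('a \<Rightarrow> real) \<Rightarrow> real" where "V h \<equiv> measure lebesgue (hpoly U h)"

lemma U_nonempty: "U \<noteq> {}"
  using spanning[of "SOME i. i \<in> Basis"] some_in_eq[of "Basis :: 'a set"] nonzero_Basis nonempty_Basis by auto

lemma closed_hpoly: "closed (hpoly U h)"
proof -
  have "hpoly U h = (\<Inter>u\<in>U. {x. u \<bullet> x \<le> h u})" by (auto simp: hpoly_def)
  then show ?thesis by (auto intro!: closed_INT closed_halfspace_le)
qed

lemma convex_hpoly: "convex (hpoly U h)"
proof -
  have "hpoly U h = (\<Inter>u\<in>U. {x. u \<bullet> x \<le> h u})" by (auto simp: hpoly_def)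
  then show ?thesis by (auto intro!: convex_INT convex_halfspace_le)
qed

text \<open>The function \<open>x \<mapsto> \<Sum>u\<in>U. max 0 (u \<bullet> x)\<close> is positive on the unit sphere, hence bounded below there.\<close>
lemma norm_le_sum_positive_parts:
  obtains c where "0 < c" "\<And>x. c * norm x \<le> (\<Sum>u\<in>U. max 0 (u \<bullet> x))"
proof -
  let ?f = "\<lambda>x. \<Sum>u\<in>U. max 0 (u \<bullet> x)"
  have "continuous_on (sphere 0 1) ?f" by (intro continuous_intros)
  moreover have "sphere (0::'a) 1 \<noteq> {}" by simp
  ultimately obtain e where e: "e \<in> sphere 0 1" "\<And>x. x \<in> sphere 0 1 \<Longrightarrow> ?f e \<le> ?f x"
    using continuous_attains_inf[OF compact_sphere] by blast
  have "e \<noteq> 0" using e(1) by auto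
  then obtain u where u: "u \<in> U" "0 < u \<bullet> e" using spanning by blast
  have "0 < ?f e" by (rule sum_pos2[OF finite_U u(1)]) (use u in auto)
  moreover have "?f e * norm x \<le> ?f x" for x
  proof (cases "x = 0")
    case False
    have "?f e \<le> ?f ((1 / norm x) *\<^sub>R x)" using False by (intro e(2)) simp
    also have "\<dots> = (\<Sum>u\<in>U. (1 / norm x) * max 0 (u \<bullet> x))"
      using False by (intro sum.cong) (auto simp: max_def zero_le_divide_iff)
    also have "\<dots> = ?f x / norm x" by (simp add: sum_divide_distrib)
    finally show ?thesis using False by (simp add: field_simps)
  qed (simp add: sum_nonneg)
  ultimately show thesis using that by blast
qed

lemma bounded_hpoly: "bounded (hpoly U h)"
proof -
  obtain c where c: "0 < c" "\<And>x. c * norm x \<le> (\<Sum>u\<in>U. max 0 (u \<bullet> x))"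
    using norm_le_sum_positive_parts by blast
  have "norm x \<le> (\<Sum>u\<in>U. max 0 (h u)) / c" if "x \<in> hpoly U h" for x
  proof -
    have "(\<Sum>u\<in>U. max 0 (u \<bullet> x)) \<le> (\<Sum>u\<in>U. max 0 (h u))"
      using that by (intro sum_mono) (auto simp: hpoly_def)
    then have "c * norm x \<le> (\<Sum>u\<in>U. max 0 (h u))" using c(2)[of x] by linarith
    then show ?thesis using c(1) by (simp add: field_simps)
  qed
  then show ?thesis unfolding bounded_iff by blast
qed

lemma compact_hpoly: "compact (hpoly U h)"
  using bounded_hpoly closed_hpoly by (simp add: compact_eq_bounded_closed)

lemma hpoly_lmeasurable: "hpoly U h \<in> lmeasurable"
  by (rule lmeasurable_compact[OF compact_hpoly])

lemma hpoly_mono: "(\<And>u. u \<in> U \<Longrightarrow> h u \<le> k u) \<Longrightarrow> hpoly U h \<subseteq> hpoly U k"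
  unfolding hpoly_def by force

lemma V_mono: "(\<And>u. u \<in> U \<Longrightarrow> h u \<le> k u) \<Longrightarrow> V h \<le> V k"
  by (intro measure_mono_fmeasurable hpoly_mono fmeasurableD hpoly_lmeasurable)

lemma hpoly_scale:
  assumes "0 < c"
  shows "hpoly U (\<lambda>u. c * h u) = (*\<^sub>R) c ` hpoly U h"
proof (intro set_eqI iffI)
  fix x assume x: "x \<in> hpoly U (\<lambda>u. c * h u)"
  have "(1 / c) *\<^sub>R x \<in> hpoly U h" using x assms by (auto simp: hpoly_def field_simps)
  then show "x \<in> (*\<^sub>R) c ` hpoly U h" using assms by (intro image_eqI[of _ _ "(1 / c) *\<^sub>R x"]) auto
qed (use assms in \<open>auto simp: hpoly_def\<close>)

lemma V_scale: "0 < c \<Longrightarrow> V (\<lambda>u. c * h u) = c ^ DIM('a) * V h"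
  by (simp add: hpoly_scale measure_lebesgue_scale)

lemma zero_in_interior_hpoly:
  assumes "\<And>u. u \<in> U \<Longrightarrow> 0 < h u"
  shows "0 \<in> interior (hpoly U h)"
proof (rule interiorI)
  show "open (\<Inter>u\<in>U. {x. u \<bullet> x < h u})" using finite_U by (intro open_INT ballI open_halfspace_lt)
qed (use assms in \<open>auto simp: hpoly_def less_imp_le\<close>)

lemma V_pos_iff: "0 < V h \<longleftrightarrow> interior (hpoly U h) \<noteq> {}"
  using negligible_convex_interior[OF convex_hpoly, of h] hpoly_lmeasurable[of h]
  by (metis measure_nonneg negligible_iff_measure less_le)

lemma V_pos:
  assumes "\<And>u. u \<in> U \<Longrightarrow> 0 < h u"
  shows "0 < V h"
  unfolding V_pos_iff using zero_in_interior_hpoly[of h, OF assms] by blast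

lemma measure_interior_hpoly: "measure lebesgue (interior (hpoly U h)) = V h"
  by (rule measure_interior[OF bounded_hpoly negligible_convex_frontier[OF convex_hpoly]])

lemma root_V_superadditive:
  assumes "0 < V h" "0 < V k"
  shows "root DIM('a) (V h) + root DIM('a) (V k) \<le> root DIM('a) (V (\<lambda>u. h u + k u))"
proof -
  have "root DIM('a) (measure lebesgue (interior (hpoly U h))) + root DIM('a) (measure lebesgue (interior (hpoly U k)))
     \<le> root DIM('a) (V (\<lambda>u. h u + k u))"
  proof (rule brunn_minkowski)
    show "x + y \<in> hpoly U (\<lambda>u. h u + k u)" if "x \<in> interior (hpoly U h)" "y \<in> interior (hpoly U k)" for x y
      using that interior_subset[of "hpoly U h"] interior_subset[of "hpoly U k"]
      by (auto simp: hpoly_def inner_add_right intro!: add_mono)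
  qed (use assms in \<open>auto simp: V_pos_iff hpoly_lmeasurable intro: bounded_subset[OF bounded_hpoly interior_subset]\<close>)
  then show ?thesis by (simp add: measure_interior_hpoly)
qed

lemma root_V_scale: "0 < c \<Longrightarrow> root DIM('a) (V (\<lambda>u. c * h u)) = c * root DIM('a) (V h)"
  by (simp add: V_scale real_root_mult real_root_power_cancel)

lemma wedge_borel: "wedge U h u r \<in> sets borel"
proof -
  have "wedge U h u r = {x. 0 < u \<bullet> x} \<inter> ({x. u \<bullet> x \<le> r} \<inter> (\<Inter>v\<in>U. {x. h u * (v \<bullet> x) \<le> h v * (u \<bullet> x)}))"
    by (auto simp: wedge_def)
  moreover have "open {x. 0 < u \<bullet> x}" by (intro open_Collect_less continuous_intros)
  moreover have "closed ({x. u \<bullet> x \<le> r} \<inter> (\<Inter>v\<in>U. {x. h u * (v \<bullet> x) \<le> h v * (u \<bullet> x)}))"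
    by (intro closed_Int closed_INT ballI closed_Collect_le continuous_intros)
  ultimately show ?thesis by (simp only: sets.Int[OF borel_open borel_closed])
qed

lemma bounded_wedge:
  assumes "0 < h u"
  shows "bounded (wedge U h u r)"
proof (rule bounded_subset[OF bounded_hpoly])
  show "wedge U h u r \<subseteq> hpoly U (\<lambda>v. \<bar>h v\<bar> * \<bar>r\<bar> / h u)"
  proof
    fix x assume x: "x \<in> wedge U h u r"
    show "x \<in> hpoly U (\<lambda>v. \<bar>h v\<bar> * \<bar>r\<bar> / h u)"
      unfolding hpoly_def
    proof clarify
      fix v assume "v \<in> U"
      then have "h u * (v \<bullet> x) \<le> h v * (u \<bullet> x)" using x by (auto simp: wedge_def)
      also have "\<dots> \<le> \<bar>h v\<bar> * \<bar>r\<bar>" using x by (intro mult_mono) (auto simp: wedge_def)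
      finally show "v \<bullet> x \<le> \<bar>h v\<bar> * \<bar>r\<bar> / h u" using assms by (simp add: field_simps)
    qed
  qed
qed

lemma wedge_lmeasurable: "0 < h u \<Longrightarrow> wedge U h u r \<in> lmeasurable"
  using wedge_borel[of h u r] by (intro bounded_set_imp_lmeasurable bounded_wedge) auto

lemma wedge_scale:
  assumes "0 < c"
  shows "wedge U h u (c * r) = (*\<^sub>R) c ` wedge U h u r"
proof (intro set_eqI iffI)
  fix x assume x: "x \<in> wedge U h u (c * r)"
  have "h u * (v \<bullet> x / c) \<le> h v * (u \<bullet> x / c)" if "v \<in> U" for v
    using divide_right_mono[of "h u * (v \<bullet> x)" "h v * (u \<bullet> x)" c] x that assms by (simp add: wedge_def)
  moreover have "0 < u \<bullet> x / c" "u \<bullet> x / c \<le> r"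
    using x assms by (simp_all add: wedge_def pos_divide_le_eq mult.commute)
  ultimately have "(1 / c) *\<^sub>R x \<in> wedge U h u r" by (simp add: wedge_def)
  then show "x \<in> (*\<^sub>R) c ` wedge U h u r" using assms by (intro image_eqI[of _ _ "(1 / c) *\<^sub>R x"]) auto
next
  fix x assume "x \<in> (*\<^sub>R) c ` wedge U h u r"
  then obtain y where y: "y \<in> wedge U h u r" "x = c *\<^sub>R y" by auto
  have "h u * (c * (v \<bullet> y)) \<le> h v * (c * (u \<bullet> y))" if "v \<in> U" for v
    using mult_left_mono[of "h u * (v \<bullet> y)" "h v * (u \<bullet> y)" c] y that assms
    by (simp add: wedge_def mult.left_commute)
  then show "x \<in> wedge U h u (c * r)" using y assms by (simp add: wedge_def)
qed

lemma measure_wedge_scale: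
  "0 < c \<Longrightarrow> measure lebesgue (wedge U h u (c * r)) = c ^ DIM('a) * measure lebesgue (wedge U h u r)"
  by (simp add: wedge_scale measure_lebesgue_scale)

lemma cone_volume_scale:
  assumes "0 < c"
  shows "cone_volume U (\<lambda>u. c * h u) u = c ^ DIM('a) * cone_volume U h u"
proof -
  have "wedge U (\<lambda>u. c * h u) u (c * h u) = wedge U h u (c * h u)"
    using assms by (simp add: wedge_def mult.assoc)
  then show ?thesis using measure_wedge_scale[OF assms] by (simp add: cone_volume_def)
qed

lemma cone_volume_nonneg: "0 \<le> cone_volume U h u"
  by (simp add: cone_volume_def)

text \<open>The facet hit by the ray through \<open>x\<close> is the one that maximizes \<open>(v \<bullet> x) / h v\<close>.\<close>
lemma active_facet_exists:
  assumes h: "\<And>u. u \<in> U \<Longrightarrow> 0 < h u" and x: "x \<noteq> 0"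
  obtains u where "u \<in> U" "0 < u \<bullet> x" "\<And>v. v \<in> U \<Longrightarrow> h u * (v \<bullet> x) \<le> h v * (u \<bullet> x)"
proof -
  let ?m = "Max ((\<lambda>v. (v \<bullet> x) / h v) ` U)"
  have "?m \<in> (\<lambda>v. (v \<bullet> x) / h v) ` U" using finite_U U_nonempty by (intro Max_in) auto
  then obtain u where u: "u \<in> U" "?m = (u \<bullet> x) / h u" by auto
  have le: "(v \<bullet> x) / h v \<le> (u \<bullet> x) / h u" if "v \<in> U" for v
    using that finite_U u(2) Max_ge[of "(\<lambda>v. (v \<bullet> x) / h v) ` U" "(v \<bullet> x) / h v"] by auto
  obtain w where w: "w \<in> U" "0 < w \<bullet> x" using spanning[OF x] by blast
  have "0 < (w \<bullet> x) / h w" using w h by simp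
  then have "0 < (u \<bullet> x) / h u" using le[OF w(1)] by linarith
  then have "0 < u \<bullet> x" using h[OF u(1)] by (simp add: zero_less_divide_iff)
  moreover have "h u * (v \<bullet> x) \<le> h v * (u \<bullet> x)" if "v \<in> U" for v
    using le[OF that] h[OF that] h[OF u(1)] by (simp add: field_simps)
  ultimately show thesis using that u(1) by blast
qed

lemma wedge_subset_hpoly:
  assumes h: "\<And>u. u \<in> U \<Longrightarrow> 0 < h u" and u: "u \<in> U"
  shows "wedge U h u (h u) \<subseteq> hpoly U h"
proof
  fix x assume x: "x \<in> wedge U h u (h u)"
  have "v \<bullet> x \<le> h v" if v: "v \<in> U" for v
  proof -
    have "h u * (v \<bullet> x) \<le> h v * (u \<bullet> x)" using x v by (auto simp: wedge_def)
    also have "\<dots> \<le> h v * h u" using x h[OF v] by (intro mult_left_mono) (auto simp: wedge_def)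
    finally show ?thesis using h[OF u] by (simp add: mult.commute)
  qed
  then show "x \<in> hpoly U h" by (auto simp: hpoly_def)
qed

lemma normals_not_parallel:
  assumes h: "\<And>u. u \<in> U \<Longrightarrow> 0 < h u" and uv: "u \<in> U" "v \<in> U" "u \<noteq> v"
  shows "h u *\<^sub>R v - h v *\<^sub>R u \<noteq> 0"
proof
  assume "h u *\<^sub>R v - h v *\<^sub>R u = 0"
  then have eq: "h u *\<^sub>R v = h v *\<^sub>R u" by simp
  then have "norm (h u *\<^sub>R v) = norm (h v *\<^sub>R u)" by simp
  then have "h u = h v" using h uv unit by (simp add: less_imp_le)
  then show False using eq uv(3) h[OF uv(1)] by auto
qed

lemma negligible_wedge_Int:
  assumes h: "\<And>u. u \<in> U \<Longrightarrow> 0 < h u" and uv: "u \<in> U" "v \<in> U" "u \<noteq> v"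
  shows "negligible (wedge U h u r \<inter> wedge U h v s)"
proof (rule negligible_subset)
  show "negligible {x. (h u *\<^sub>R v - h v *\<^sub>R u) \<bullet> x = 0}"
    by (rule negligible_hyperplane[OF disjI1[OF normals_not_parallel[of h, OF h uv]]])
  show "wedge U h u r \<inter> wedge U h v s \<subseteq> {x. (h u *\<^sub>R v - h v *\<^sub>R u) \<bullet> x = 0}"
    using uv by (fastforce simp: wedge_def inner_diff_left)
qed

lemma V_eq_sum_cone_volume:
  assumes h: "\<And>u. u \<in> U \<Longrightarrow> 0 < h u"
  shows "V h = (\<Sum>u\<in>U. cone_volume U h u)"
proof -
  let ?W = "\<lambda>u. wedge U h u (h u)"
  have sub: "(\<Union>u\<in>U. ?W u) \<subseteq> hpoly U h" using wedge_subset_hpoly[of h, OF h] by blast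
  have cover: "hpoly U h - {0} \<subseteq> (\<Union>u\<in>U. ?W u)"
  proof
    fix x assume x: "x \<in> hpoly U h - {0}"
    then obtain u where u: "u \<in> U" "0 < u \<bullet> x" "\<And>v. v \<in> U \<Longrightarrow> h u * (v \<bullet> x) \<le> h v * (u \<bullet> x)"
      using active_facet_exists[of h x, OF h] by auto
    then have "x \<in> ?W u" using x by (auto simp: wedge_def hpoly_def)
    then show "x \<in> (\<Union>u\<in>U. ?W u)" using u(1) by blast
  qed
  have "hpoly U h - (\<Union>u\<in>U. ?W u) \<union> ((\<Union>u\<in>U. ?W u) - hpoly U h) \<subseteq> {0}" using sub cover by auto
  then have "negligible (hpoly U h - (\<Union>u\<in>U. ?W u) \<union> ((\<Union>u\<in>U. ?W u) - hpoly U h))"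
    by (rule negligible_subset[OF negligible_sing])
  then have "V h = measure lebesgue (\<Union>u\<in>U. ?W u)"
    by (rule measure_negligible_symdiff[OF hpoly_lmeasurable, symmetric])
  also have "\<dots> = (\<Sum>u\<in>U. measure lebesgue (?W u))"
    using negligible_wedge_Int[of h, OF h] wedge_lmeasurable h
    by (intro measure_negligible_finite_Union_image[OF finite_U]) (auto simp: pairwise_def)
  finally show ?thesis by (simp add: cone_volume_def)
qed

text \<open>On the cone over the facet with normal \<open>u\<close> the radial function of \<open>hpoly U k\<close> is at most
  \<open>k u / h u\<close> times that of \<open>hpoly U h\<close>.\<close>
lemma V_le_sum_cone_volume:
  assumes h: "\<And>u. u \<in> U \<Longrightarrow> 0 < h u" and k: "\<And>u. u \<in> U \<Longrightarrow> 0 \<le> k u"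
  shows "V k \<le> (\<Sum>u\<in>U. (k u / h u) ^ DIM('a) * cone_volume U h u)"
proof -
  let ?W = "\<lambda>u. (*\<^sub>R) (k u / h u) ` wedge U h u (h u)"
  have Wm: "?W u \<in> lmeasurable" if "u \<in> U" for u
    using wedge_lmeasurable[of h u "h u", OF h[OF that]] by (rule lmeasurable_scale)
  have sub: "hpoly U k \<subseteq> {0} \<union> (\<Union>u\<in>U. ?W u)"
  proof
    fix x assume x: "x \<in> hpoly U k"
    show "x \<in> {0} \<union> (\<Union>u\<in>U. ?W u)"
    proof (cases "x = 0")
      case False
      then obtain u where u: "u \<in> U" "0 < u \<bullet> x" "\<And>v. v \<in> U \<Longrightarrow> h u * (v \<bullet> x) \<le> h v * (u \<bullet> x)"
        using active_facet_exists[of h x, OF h] by auto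
      have "u \<bullet> x \<le> k u" using x u(1) by (auto simp: hpoly_def)
      then have ku: "0 < k u" using u(2) by linarith
      have hu: "0 < h u" using h u(1) by blast
      have "x \<in> wedge U h u ((k u / h u) * h u)" using u \<open>u \<bullet> x \<le> k u\<close> hu by (auto simp: wedge_def)
      then have "x \<in> ?W u" using wedge_scale[of "k u / h u" h u "h u"] ku hu by simp
      then show ?thesis using u(1) by blast
    qed simp
  qed
  have "V k \<le> measure lebesgue ({0} \<union> (\<Union>u\<in>U. ?W u))"
  proof (rule measure_mono_fmeasurable[OF sub])
    show "hpoly U k \<in> sets lebesgue" using hpoly_lmeasurable by (rule fmeasurableD)
    show "{0} \<union> (\<Union>u\<in>U. ?W u) \<in> lmeasurable"
      using Wm finite_U lmeasurable_compact[of "{0::'a}"] by (intro fmeasurable.Un fmeasurable.finite_UN) auto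
  qed
  also have "\<dots> \<le> measure lebesgue {0::'a} + measure lebesgue (\<Union>u\<in>U. ?W u)"
    using Wm finite_U by (intro measure_Un_le) (auto intro!: sets.finite_UN)
  also have "\<dots> \<le> (\<Sum>u\<in>U. measure lebesgue (?W u))"
    using Wm finite_U by (simp, intro measure_UNION_le) auto
  also have "\<dots> = (\<Sum>u\<in>U. (k u / h u) ^ DIM('a) * cone_volume U h u)"
    using h k by (intro sum.cong) (auto simp: measure_lebesgue_scale cone_volume_def less_imp_le)
  finally show ?thesis .
qed

text \<open>Minkowski's first inequality, for the mixed volume written as a mean of the ratios of the support
  numbers with respect to the cone volumes. Compare the lower bound for \<open>V (h + t k)\<close> from the
  Brunn--Minkowski inequality with the radial upper bound; both are equal at \<open>t = 0\<close>,
  so their derivatives there are ordered.\<close>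
lemma minkowski_first_inequality:
  assumes h: "\<And>u. u \<in> U \<Longrightarrow> 0 < h u" and k: "\<And>u. u \<in> U \<Longrightarrow> 0 < k u"
  shows "root DIM('a) (V k / V h) \<le> (\<Sum>u\<in>U. cone_volume U h u / V h * (k u / h u))"
proof -
  let ?n = "DIM('a)"
  define w where "w u = cone_volume U h u / V h" for u
  define q where "q u = k u / h u" for u
  define s where "s = root ?n (V k / V h)"
  have Vh: "0 < V h" and Vk: "0 < V k" using V_pos h k by blast+
  have sw: "(\<Sum>u\<in>U. w u) = 1"
    using V_eq_sum_cone_volume[of h, OF h] Vh by (simp add: w_def flip: sum_divide_distrib)
  define \<phi> where "\<phi> t = (\<Sum>u\<in>U. w u * (1 + t * q u) ^ ?n) - (1 + t * s) ^ ?n" for t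
  have nonneg: "0 \<le> \<phi> t" if t: "0 < t" for t
  proof -
    let ?k = "\<lambda>u. t * k u" and ?l = "\<lambda>u. h u + t * k u"
    have "root ?n (V h) + t * root ?n (V k) \<le> root ?n (V ?l)"
    proof -
      have "root ?n (V h) + root ?n (V ?k) \<le> root ?n (V ?l)"
        using t k by (intro root_V_superadditive Vh V_pos) simp
      then show ?thesis using root_V_scale[OF t, of k] by simp
    qed
    moreover have "root ?n (V k) = s * root ?n (V h)"
      using Vh by (simp add: s_def flip: real_root_mult)
    ultimately have "(1 + t * s) * root ?n (V h) \<le> root ?n (V ?l)" by (simp add: algebra_simps)
    moreover have "0 \<le> (1 + t * s) * root ?n (V h)"
      using t Vh Vk by (intro mult_nonneg_nonneg add_nonneg_nonneg) (auto simp: s_def)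
    ultimately have "((1 + t * s) * root ?n (V h)) ^ ?n \<le> root ?n (V ?l) ^ ?n" by (intro power_mono)
    then have "(1 + t * s) ^ ?n * V h \<le> V ?l" by (simp add: power_mult_distrib)
    also have "V ?l \<le> (\<Sum>u\<in>U. (?l u / h u) ^ ?n * cone_volume U h u)"
      using h k t by (intro V_le_sum_cone_volume) (simp_all add: add_nonneg_nonneg less_imp_le)
    also have "\<dots> = (\<Sum>u\<in>U. w u * (1 + t * q u) ^ ?n * V h)"
    proof (rule sum.cong)
      fix u assume "u \<in> U"
      then have "?l u / h u = 1 + t * q u" using h[of u] by (simp add: q_def field_simps)
      then show "(?l u / h u) ^ ?n * cone_volume U h u = w u * (1 + t * q u) ^ ?n * V h"
        using Vh by (simp add: w_def)
    qed simp
    also have "\<dots> = (\<Sum>u\<in>U. w u * (1 + t * q u) ^ ?n) * V h" by (simp add: sum_distrib_right)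
    finally show ?thesis using Vh by (simp add: \<phi>_def)
  qed
  have deriv: "(\<phi> has_real_derivative (\<Sum>u\<in>U. w u * (real ?n * q u)) - real ?n * s) (at 0)"
    unfolding \<phi>_def by (auto intro!: derivative_eq_intros sum.cong simp: sum_subtractf)
  have "\<phi> 0 = 0" by (simp add: \<phi>_def sw)
  have "0 \<le> (\<Sum>u\<in>U. w u * (real ?n * q u)) - real ?n * s"
  proof (rule ccontr)
    assume "\<not> ?thesis"
    then obtain d where d: "0 < d" "\<And>t. 0 < t \<Longrightarrow> t < d \<Longrightarrow> \<phi> (0 + t) < \<phi> 0"
      using DERIV_neg_dec_right[OF deriv] by force
    have "\<phi> (d / 2) < 0" using d(2)[of "d / 2"] d(1) \<open>\<phi> 0 = 0\<close> by simp
    then show False using nonneg[of "d / 2"] d(1) by simp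
  qed
  then have "real ?n * s \<le> real ?n * (\<Sum>u\<in>U. w u * q u)"
    by (simp add: sum_distrib_left mult.left_commute)
  then show ?thesis by (simp add: s_def w_def q_def)
qed

end

section \<open>The discrete \<open>L\<^sub>p\<close> Minkowski problem\<close>

lemma pointwise_convergent_subsequence:
  fixes f :: "nat \<Rightarrow> 'b \<Rightarrow> real"
  assumes "finite U" "\<And>u. u \<in> U \<Longrightarrow> bounded (range (\<lambda>n. f n u))"
  obtains l r where "strict_mono r" "\<And>u. u \<in> U \<Longrightarrow> (\<lambda>n. f (r n) u) \<longlonglongrightarrow> l u"
proof -
  have "\<forall>d\<subseteq>U. \<exists>l r. strict_mono r \<and> (\<forall>e>0. eventually (\<lambda>n. \<forall>i\<in>d. dist (f (r n) i) (l i) < e) sequentially)"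
    by (rule compact_lemma_general[where proj = "\<lambda>x k. x k" and unproj = "\<lambda>x. x"])
      (use assms in \<open>auto simp: image_image\<close>)
  then obtain l r where lr: "strict_mono r" "\<And>e. e > 0 \<Longrightarrow> eventually (\<lambda>n. \<forall>i\<in>U. dist (f (r n) i) (l i) < e) sequentially"
    by blast
  have "(\<lambda>n. f (r n) u) \<longlonglongrightarrow> l u" if "u \<in> U" for u
  proof (rule tendstoI)
    fix e :: real assume "0 < e"
    from lr(2)[OF this] show "eventually (\<lambda>n. dist (f (r n) u) (l u) < e) sequentially"
      by (rule eventually_mono) (use that in blast)
  qed
  then show thesis using that lr(1) by blast
qed

lemma bernoulli_powr:
  fixes x p :: real
  assumes "1 < p" "0 \<le> x"
  shows "1 + p * (x - 1) \<le> x powr p" and "x \<noteq> 1 \<Longrightarrow> 1 + p * (x - 1) < x powr p"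
proof -
  have strict: "1 + p * (x - 1) < x powr p" if x: "x \<noteq> 1"
  proof (cases "x = 0")
    case True
    then show ?thesis using assms by simp
  next
    case False
    then have x0: "0 < x" using assms by simp
    have d: "((\<lambda>t. t powr p) has_real_derivative p * t powr (p - 1)) (at t)" if "0 < t" for t
      using that by (auto intro!: derivative_eq_intros)
    consider "1 < x" | "x < 1" using x by linarith
    then show ?thesis
    proof cases
      case 1
      obtain z where z: "1 < z" "z < x" "x powr p - 1 powr p = (x - 1) * (p * z powr (p - 1))"
        using MVT2[OF 1, of "\<lambda>t. t powr p" "\<lambda>t. p * t powr (p - 1)"] d by auto
      have "1 < z powr (p - 1)" using z(1) assms by simp
      then have "(x - 1) * p * 1 < (x - 1) * p * z powr (p - 1)"
        using 1 assms by (intro mult_strict_left_mono) auto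
      then show ?thesis using z(3) by (simp add: algebra_simps)
    next
      case 2
      obtain z where z: "x < z" "z < 1" "1 powr p - x powr p = (1 - x) * (p * z powr (p - 1))"
        using MVT2[OF 2, of "\<lambda>t. t powr p" "\<lambda>t. p * t powr (p - 1)"] d x0 by auto
      have "z powr (p - 1) < 1 powr (p - 1)" using z(1,2) x0 assms by (intro powr_less_mono2) auto
      then have "(1 - x) * p * z powr (p - 1) < (1 - x) * p * 1"
        using 2 assms by (intro mult_strict_left_mono) auto
      then show ?thesis using z(3) by (simp add: algebra_simps)
    qed
  qed
  then show "x \<noteq> 1 \<Longrightarrow> 1 + p * (x - 1) < x powr p" .
  show "1 + p * (x - 1) \<le> x powr p" using strict by (cases "x = 1") auto
qed

context spanning_directions
begin

lemma V_zero_le: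
  assumes "\<And>u. u \<in> U \<Longrightarrow> h u \<le> 0"
  shows "V h = 0"
proof -
  have "hpoly U h \<subseteq> {0}"
  proof
    fix x assume x: "x \<in> hpoly U h"
    have "\<not> (\<exists>u\<in>U. 0 < u \<bullet> x)" using x assms by (force simp: hpoly_def)
    then show "x \<in> {0}" using spanning by blast
  qed
  then have "negligible (hpoly U h)" by (rule negligible_subset[OF negligible_sing])
  then show ?thesis by (rule negligible_imp_measure0)
qed

lemma V_upper_limit:
  "(\<lambda>j. V (\<lambda>u. h u + 1 / real (Suc j))) \<longlonglongrightarrow> V h"
proof -
  let ?P = "\<lambda>j. hpoly U (\<lambda>u. h u + 1 / real (Suc j))"
  have "(\<Inter>j. ?P j) = hpoly U h"
  proof (intro set_eqI iffI)
    fix x assume x: "x \<in> (\<Inter>j. ?P j)"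
    have "u \<bullet> x \<le> h u" if u: "u \<in> U" for u
    proof (rule LIMSEQ_le_const)
      have "(\<lambda>j. 1 / real (Suc j)) \<longlonglongrightarrow> 0" by (rule LIMSEQ_Suc[OF lim_1_over_n])
      then have "(\<lambda>j. h u + 1 / real (Suc j)) \<longlonglongrightarrow> h u + 0" by (intro tendsto_intros)
      then show "(\<lambda>j. h u + 1 / real (Suc j)) \<longlonglongrightarrow> h u" by simp
      show "\<exists>N. \<forall>n\<ge>N. u \<bullet> x \<le> h u + 1 / real (Suc n)"
        using x u by (intro exI[of _ 0]) (auto simp: hpoly_def)
    qed
    then show "x \<in> hpoly U h" by (simp add: hpoly_def)
  next
    fix x assume "x \<in> hpoly U h"
    then show "x \<in> (\<Inter>j. ?P j)" by (auto simp: hpoly_def intro: add_increasing2)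
  qed
  moreover have "(\<lambda>j. measure lebesgue (?P j)) \<longlonglongrightarrow> measure lebesgue (\<Inter>j. ?P j)"
  proof (rule Lim_measure_decseq)
    show "range ?P \<subseteq> sets lebesgue" using hpoly_lmeasurable by (auto simp: fmeasurable_def)
    show "decseq ?P" unfolding decseq_def by (intro allI impI hpoly_mono) (simp add: frac_le)
    show "emeasure lebesgue (?P j) \<noteq> \<infinity>" for j
      using hpoly_lmeasurable[of "\<lambda>u. h u + 1 / real (Suc j)"] by (auto simp: fmeasurable_def)
  qed
  ultimately show ?thesis by simp
qed

text \<open>Among support numbers with \<open>\<Sum>u\<in>U. \<alpha> u * h u powr p = 1\<close> the volume has a maximum, because it
  is upper semicontinuous. Homogeneity turns the maximum into an inequality for all support numbers.\<close>
lemma maximal_volume_exists: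
  assumes \<alpha>: "\<And>u. u \<in> U \<Longrightarrow> 0 < \<alpha> u" and p: "1 < p"
  obtains h where "\<And>u. u \<in> U \<Longrightarrow> 0 \<le> h u" "(\<Sum>u\<in>U. \<alpha> u * h u powr p) = 1" "0 < V h"
    "\<And>k. (\<And>u. u \<in> U \<Longrightarrow> 0 \<le> k u) \<Longrightarrow>
      root DIM('a) (V k) \<le> root DIM('a) (V h) * (\<Sum>u\<in>U. \<alpha> u * k u powr p) powr (1 / p)"
proof -
  let ?c = "\<lambda>h. \<Sum>u\<in>U. \<alpha> u * h u powr p"
  define F where "F = {h. (\<forall>u\<in>U. 0 \<le> h u) \<and> ?c h = 1}"
  define b where "b u = (1 / \<alpha> u) powr (1 / p)" for u
  have hb: "h u \<le> b u" if "h \<in> F" "u \<in> U" for h u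
  proof -
    have "\<alpha> u * h u powr p \<le> ?c h"
      using that(2) less_imp_le[OF \<alpha>] finite_U
      by (intro member_le_sum[of u U "\<lambda>u. \<alpha> u * h u powr p"]) simp_all
    then have "h u powr p \<le> 1 / \<alpha> u" using that \<alpha>[of u] by (simp add: F_def field_simps)
    then have "(h u powr p) powr (1 / p) \<le> (1 / \<alpha> u) powr (1 / p)" using p by (intro powr_mono2) auto
    then show ?thesis using that p by (simp add: b_def powr_powr F_def)
  qed
  have normalise: "\<exists>g\<in>F. root DIM('a) (V k) = root DIM('a) (V g) * ?c k powr (1 / p)"
    if k: "\<And>u. u \<in> U \<Longrightarrow> 0 \<le> k u" and ck: "0 < ?c k" for k
  proof -
    define s where "s = ?c k powr (1 / p)"
    have s: "0 < s" using ck by (simp add: s_def)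
    have sp: "s powr p = ?c k" using ck p by (simp add: s_def powr_powr)
    define g where "g u = (1 / s) * k u" for u
    have "?c g = (\<Sum>u\<in>U. \<alpha> u * k u powr p / s powr p)"
      using k s by (intro sum.cong) (auto simp: g_def powr_divide)
    also have "\<dots> = 1" using sp ck by (simp flip: sum_divide_distrib)
    finally have "g \<in> F" using k s by (auto simp: F_def g_def)
    moreover have "root DIM('a) (V k) = root DIM('a) (V (\<lambda>u. s * g u))" using s by (simp add: g_def)
    ultimately show ?thesis using root_V_scale[OF s, of g] by (auto simp: s_def mult.commute)
  qed
  have c1: "0 < ?c (\<lambda>_. 1)" using \<alpha> finite_U U_nonempty by (simp add: sum_pos)
  obtain g1 where g1: "g1 \<in> F" "root DIM('a) (V (\<lambda>_. 1)) = root DIM('a) (V g1) * ?c (\<lambda>_. 1) powr (1 / p)"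
    using normalise[of "\<lambda>_. 1"] c1 by auto
  have Vg1: "0 < V g1"
  proof -
    have "0 < root DIM('a) (V (\<lambda>_. 1))" using V_pos[of "\<lambda>_. 1"] by simp
    then have "root DIM('a) (V g1) \<noteq> 0" using g1(2) by auto
    then show ?thesis by (simp add: less_le)
  qed
  define M where "M = (SUP h\<in>F. V h)"
  have bdd: "bdd_above (V ` F)"
    by (rule bdd_aboveI2[of _ _ "V b"]) (auto intro!: V_mono hb)
  have upM: "V g \<le> M" if "g \<in> F" for g unfolding M_def using bdd that by (rule cSUP_upper2) simp
  have "\<exists>g\<in>F. M - 1 / real (Suc j) < V g" for j
  proof -
    have "M - 1 / real (Suc j) < (SUP h\<in>F. V h)" by (simp add: M_def)
    then show ?thesis using g1(1) bdd by (subst (asm) less_cSUP_iff) auto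
  qed
  then obtain g where g: "\<And>j. g j \<in> F" "\<And>j. M - 1 / real (Suc j) < V (g j)" by metis
  have "bounded (range (\<lambda>j. g j u))" if "u \<in> U" for u
    unfolding bounded_iff using hb[OF g(1) that] g(1) that by (intro exI[of _ "b u"]) (auto simp: F_def)
  then obtain h r where r: "strict_mono r" and lim: "\<And>u. u \<in> U \<Longrightarrow> (\<lambda>j. g (r j) u) \<longlonglongrightarrow> h u"
    using pointwise_convergent_subsequence[OF finite_U, of g] by blast
  have h0: "0 \<le> h u" if "u \<in> U" for u
    using lim[OF that] g(1) that by (intro LIMSEQ_le_const[OF lim[OF that]]) (auto simp: F_def)
  have "(\<lambda>j. ?c (g (r j))) \<longlonglongrightarrow> ?c h"
    by (intro tendsto_sum tendsto_mult tendsto_const tendsto_powr2 lim) (use g(1) p in \<open>auto simp: F_def\<close>)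
  moreover have "?c (g (r j)) = 1" for j using g(1) by (simp add: F_def)
  ultimately have "(\<lambda>j::nat. 1::real) \<longlonglongrightarrow> ?c h" by (simp only:)
  then have ch: "?c h = 1" by (simp only: LIMSEQ_const_iff)
  have "M \<le> V (\<lambda>u. h u + 1 / real (Suc m))" for m
  proof (rule LIMSEQ_le_const2)
    have "(\<lambda>j. M - 1 / real (Suc j)) \<longlonglongrightarrow> M - 0"
      by (intro tendsto_intros LIMSEQ_Suc[OF lim_1_over_n])
    from LIMSEQ_subseq_LIMSEQ[OF this r] show "(\<lambda>j. M - 1 / real (Suc (r j))) \<longlonglongrightarrow> M" by (simp add: o_def)
    have "\<forall>\<^sub>F j in sequentially. \<forall>u\<in>U. g (r j) u < h u + 1 / real (Suc m)"
      using finite_U lim by (intro eventually_ball_finite ballI order_tendstoD(2)) auto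
    then obtain N where N: "\<And>j. j \<ge> N \<Longrightarrow> \<forall>u\<in>U. g (r j) u < h u + 1 / real (Suc m)"
      unfolding eventually_sequentially by blast
    have "M - 1 / real (Suc (r j)) \<le> V (\<lambda>u. h u + 1 / real (Suc m))" if "N \<le> j" for j
    proof -
      have "V (g (r j)) \<le> V (\<lambda>u. h u + 1 / real (Suc m))"
        using N[OF that] by (intro V_mono) (auto intro: less_imp_le)
      then show ?thesis using g(2)[of "r j"] by linarith
    qed
    then show "\<exists>N. \<forall>j\<ge>N. M - 1 / real (Suc (r j)) \<le> V (\<lambda>u. h u + 1 / real (Suc m))" by blast
  qed
  then have MV: "M \<le> V h" by (intro LIMSEQ_le_const[OF V_upper_limit]) auto
  show thesis
  proof
    show "0 \<le> h u" if "u \<in> U" for u by (rule h0[OF that])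
    show "?c h = 1" by fact
    show "0 < V h" using Vg1 upM[OF g1(1)] MV by linarith
    fix k :: "'a \<Rightarrow> real" assume k: "\<And>u. u \<in> U \<Longrightarrow> 0 \<le> k u"
    show "root DIM('a) (V k) \<le> root DIM('a) (V h) * ?c k powr (1 / p)"
    proof (cases "?c k = 0")
      case True
      have "k u \<le> 0" if "u \<in> U" for u
      proof -
        have "\<alpha> u * k u powr p = 0"
          using True sum_nonneg_eq_0_iff[OF finite_U, of "\<lambda>u. \<alpha> u * k u powr p"] \<alpha> that by (simp add: less_imp_le)
        then show ?thesis using \<alpha>[OF that] by simp
      qed
      then show ?thesis using V_zero_le[of k] True by simp
    next
      case False
      then have "0 < ?c k" using \<alpha> by (simp add: less_le sum_nonneg)
      then obtain f where f: "f \<in> F" "root DIM('a) (V k) = root DIM('a) (V f) * ?c k powr (1 / p)"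
        using normalise[of k] k by blast
      have "root DIM('a) (V f) \<le> root DIM('a) (V h)" using upM[OF f(1)] MV by simp
      then show ?thesis unfolding f(2) by (intro mult_right_mono) auto
    qed
  qed
qed

text \<open>At a maximum no support number vanishes. Raising the vanishing ones to \<open>\<epsilon>\<close> costs
  only \<open>O(\<epsilon> powr p)\<close> in the constraint, while the root of the volume, being concave,
  gains at least a positive multiple of \<open>\<epsilon>\<close>.\<close>
lemma maximal_volume_positive:
  assumes \<alpha>: "\<And>u. u \<in> U \<Longrightarrow> 0 < \<alpha> u" and p: "1 < p"
    and h: "\<And>u. u \<in> U \<Longrightarrow> 0 \<le> h u" "(\<Sum>u\<in>U. \<alpha> u * h u powr p) = 1" "0 < V h"
    and max: "\<And>k. (\<And>u. u \<in> U \<Longrightarrow> 0 \<le> k u) \<Longrightarrow>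
      root DIM('a) (V k) \<le> root DIM('a) (V h) * (\<Sum>u\<in>U. \<alpha> u * k u powr p) powr (1 / p)"
    and u: "u \<in> U"
  shows "0 < h u"
proof (rule ccontr)
  assume "\<not> 0 < h u"
  then have hu: "h u = 0" using h(1)[OF u] by linarith
  define d where "d v = (if h v = 0 then 1 else 0 :: real)" for v
  define A where "A = (\<Sum>v\<in>U. \<alpha> v * d v)"
  let ?r = "\<lambda>k. root DIM('a) (V k)"
  have hd: "0 < h v + d v" if "v \<in> U" for v using h(1)[OF that] by (auto simp: d_def)
  have A0: "0 \<le> A" unfolding A_def using less_imp_le[OF \<alpha>] by (intro sum_nonneg) (simp add: d_def)
  have "V h < V (\<lambda>v. h v + d v)"
  proof -
    let ?O = "interior (hpoly U (\<lambda>v. h v + d v)) \<inter> {x. 0 < u \<bullet> x}"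
    have op: "open ?O" by (intro open_Int open_interior open_Collect_less continuous_intros)
    have "?O \<noteq> {}"
    proof -
      have "0 \<in> interior (hpoly U (\<lambda>v. h v + d v))" by (rule zero_in_interior_hpoly[OF hd])
      then obtain e where e: "0 < e" "ball 0 e \<subseteq> interior (hpoly U (\<lambda>v. h v + d v))"
        using open_contains_ball open_interior by blast
      have "(e / 2) *\<^sub>R u \<in> ball 0 e" using e(1) unit[OF u] by simp
      moreover have "0 < u \<bullet> ((e / 2) *\<^sub>R u)" using e(1) unit[OF u] by (simp add: norm_eq_1)
      ultimately show ?thesis using e(2) by blast
    qed
    then have "\<not> negligible ?O" using op open_not_negligible by blast
    moreover have Om: "?O \<in> lmeasurable"
      using op by (intro lmeasurable_open bounded_subset[OF bounded_hpoly[of "\<lambda>v. h v + d v"]]) (use interior_subset in auto)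
    ultimately have "0 < measure lebesgue ?O" by (metis measure_nonneg negligible_iff_measure less_le)
    moreover have "hpoly U h \<inter> ?O = {}" using u hu by (force simp: hpoly_def)
    then have "measure lebesgue (hpoly U h \<union> ?O) = V h + measure lebesgue ?O"
      using measure_Un3[OF hpoly_lmeasurable Om] by simp
    moreover have "measure lebesgue (hpoly U h \<union> ?O) \<le> V (\<lambda>v. h v + d v)"
    proof (rule measure_mono_fmeasurable)
      have "hpoly U h \<subseteq> hpoly U (\<lambda>v. h v + d v)" by (rule hpoly_mono) (simp add: d_def)
      then show "hpoly U h \<union> ?O \<subseteq> hpoly U (\<lambda>v. h v + d v)" using interior_subset by blast
    qed (use Om hpoly_lmeasurable in auto)
    ultimately show ?thesis by linarith
  qed
  then have \<delta>: "0 < ?r (\<lambda>v. h v + d v) - ?r h" by simp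
  have bound: "?r (\<lambda>v. h v + d v) - ?r h \<le> ?r h * A * e powr (p - 1)" if e: "0 < e" "e < 1" for e
  proof -
    let ?k = "\<lambda>v. h v + e * d v"
    have "(1 - e) * ?r h + e * ?r (\<lambda>v. h v + d v) \<le> ?r ?k"
    proof -
      have "?r (\<lambda>v. (1 - e) * h v) + ?r (\<lambda>v. e * (h v + d v)) \<le> ?r (\<lambda>v. (1 - e) * h v + e * (h v + d v))"
      proof (rule root_V_superadditive)
        show "0 < V (\<lambda>v. (1 - e) * h v)" using V_scale[of "1 - e" h] e h(3) by simp
        show "0 < V (\<lambda>v. e * (h v + d v))" using hd e by (intro V_pos) simp
      qed
      moreover have "?r (\<lambda>v. (1 - e) * h v) = (1 - e) * ?r h" using root_V_scale[of "1 - e" h] e by simp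
      moreover have "?r (\<lambda>v. e * (h v + d v)) = e * ?r (\<lambda>v. h v + d v)"
        using root_V_scale[of e "\<lambda>v. h v + d v"] e by simp
      moreover have "(\<lambda>v. (1 - e) * h v + e * (h v + d v)) = ?k" by (auto simp: algebra_simps)
      ultimately show ?thesis by simp
    qed
    also have "?r ?k \<le> ?r h * (\<Sum>v\<in>U. \<alpha> v * ?k v powr p) powr (1 / p)"
      using h(1) e by (intro max) (auto simp: d_def)
    also have "(\<Sum>v\<in>U. \<alpha> v * ?k v powr p) = (\<Sum>v\<in>U. \<alpha> v * h v powr p + \<alpha> v * d v * e powr p)"
      by (intro sum.cong) (auto simp: d_def)
    also have "\<dots> = 1 + A * e powr p" by (simp add: sum.distrib h(2) A_def sum_distrib_right)
    also have "?r h * (1 + A * e powr p) powr (1 / p) \<le> ?r h * (1 + A * e powr p)"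
    proof (rule mult_left_mono)
      have "(1 + A * e powr p) powr (1 / p) \<le> (1 + A * e powr p) powr 1"
        using A0 p by (intro powr_mono) auto
      then show "(1 + A * e powr p) powr (1 / p) \<le> 1 + A * e powr p" using A0 by simp
    qed simp
    finally have "e * (?r (\<lambda>v. h v + d v) - ?r h) \<le> ?r h * A * e powr p" by (simp add: algebra_simps)
    also have "e powr p = e * e powr (p - 1)" using e by (simp add: powr_diff)
    finally have "e * (?r (\<lambda>v. h v + d v) - ?r h) \<le> e * (?r h * A * e powr (p - 1))" by (simp add: algebra_simps)
    then show ?thesis using e(1) by simp
  qed
  have "(\<lambda>j. ?r h * A * (1 / real (Suc (Suc j))) powr (p - 1)) \<longlonglongrightarrow> ?r h * A * 0 powr (p - 1)"
  proof (intro tendsto_mult tendsto_const tendsto_powr2)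
    show "(\<lambda>j. 1 / real (Suc (Suc j))) \<longlonglongrightarrow> 0" by (intro LIMSEQ_Suc lim_1_over_n)
  qed (use p in auto)
  then have "(\<lambda>j. ?r h * A * (1 / real (Suc (Suc j))) powr (p - 1)) \<longlonglongrightarrow> 0" by simp
  then have "?r (\<lambda>v. h v + d v) - ?r h \<le> 0"
    by (rule LIMSEQ_le_const) (use bound in \<open>auto intro!: exI[of _ 0]\<close>)
  then show False using \<delta> by linarith
qed

text \<open>Lowering the support number of \<open>u\<close> removes points of the slab between the heights \<open>(1 - t) * h u\<close> and
  \<open>h u\<close>, and these lie in the wedge of the lowered support numbers; the part of this wedge below
  the slab is its dilate by the factor \<open>1 - t\<close>.\<close>
lemma V_shrink_lower:
  assumes h: "\<And>u. u \<in> U \<Longrightarrow> 0 < h u" and u: "u \<in> U" and t: "0 < t" "t < 1"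
  defines "k \<equiv> h(u := (1 - t) * h u)"
  shows "V h - (1 - (1 - t) ^ DIM('a)) * measure lebesgue (wedge U k u (h u)) \<le> V k"
proof -
  have k: "0 < k v" if "v \<in> U" for v using h[OF that] t by (auto simp: k_def)
  have ku: "k u = (1 - t) * h u" by (simp add: k_def)
  have sub: "hpoly U k \<subseteq> hpoly U h"
    using h[OF u] t by (intro hpoly_mono) (auto simp: k_def mult_left_le_one_le)
  have sub2: "wedge U k u (k u) \<subseteq> wedge U k u (h u)" using h[OF u] t by (auto simp: wedge_def k_def mult_left_le_one_le intro: order_trans)
  have m: "wedge U k u (k u) \<in> lmeasurable" "wedge U k u (h u) \<in> lmeasurable" using wedge_lmeasurable k u by blast+
  have diff: "hpoly U h - hpoly U k \<subseteq> wedge U k u (h u) - wedge U k u (k u)"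
  proof
    fix x assume x: "x \<in> hpoly U h - hpoly U k"
    then have hx: "v \<bullet> x \<le> h v" if "v \<in> U" for v using that by (auto simp: hpoly_def)
    obtain w where w: "w \<in> U" "k w < w \<bullet> x" using x by (auto simp: hpoly_def not_le)
    have "w = u" using w hx[OF w(1)] by (auto simp: k_def split: if_splits)
    then have ux: "k u < u \<bullet> x" using w by simp
    have "k u * (v \<bullet> x) \<le> k v * (u \<bullet> x)" if v: "v \<in> U" for v
    proof (cases "v = u")
      case False
      have "k u * (v \<bullet> x) \<le> k u * h v" using hx[OF v] k[OF u] by (intro mult_left_mono) auto
      also have "\<dots> \<le> (u \<bullet> x) * h v" using ux h[OF v] by (intro mult_right_mono) auto
      finally show ?thesis using False by (simp add: k_def mult.commute)
    qed simp
    then have "x \<in> wedge U k u (h u)" using ux k[OF u] hx[OF u] by (auto simp: wedge_def)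
    then show "x \<in> wedge U k u (h u) - wedge U k u (k u)" using ux by (auto simp: wedge_def)
  qed
  have "V h - V k = measure lebesgue (hpoly U h - hpoly U k)"
    by (rule measurable_measure_Diff[symmetric]) (use sub hpoly_lmeasurable in \<open>auto intro: fmeasurableD\<close>)
  also have "\<dots> \<le> measure lebesgue (wedge U k u (h u) - wedge U k u (k u))"
    using diff m hpoly_lmeasurable by (intro measure_mono_fmeasurable) (auto intro: fmeasurableD fmeasurable_Diff sets.Diff)
  also have "\<dots> = measure lebesgue (wedge U k u (h u)) - measure lebesgue (wedge U k u (k u))"
    by (rule measurable_measure_Diff) (use sub2 m in \<open>auto intro: fmeasurableD\<close>)
  also have "measure lebesgue (wedge U k u (k u)) = (1 - t) ^ DIM('a) * measure lebesgue (wedge U k u (h u))"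
    unfolding ku using t by (intro measure_wedge_scale) simp
  finally show ?thesis by (simp add: algebra_simps)
qed

lemma wedge_shrink_limit:
  assumes h: "\<And>u. u \<in> U \<Longrightarrow> 0 < h u" and u: "u \<in> U"
  shows "(\<lambda>j. measure lebesgue (wedge U (h(u := (1 - 1 / real (Suc (Suc j))) * h u)) u (h u))) \<longlonglongrightarrow> cone_volume U h u"
proof -
  let ?W = "\<lambda>j. wedge U (h(u := (1 - 1 / real (Suc (Suc j))) * h u)) u (h u)"
  have lt: "0 < 1 - 1 / real (Suc (Suc j))" for j by simp
  have lim1: "(\<lambda>j. 1 - 1 / real (Suc (Suc j))) \<longlonglongrightarrow> 1"
    using tendsto_diff[OF tendsto_const[of 1] LIMSEQ_Suc[OF LIMSEQ_Suc[OF lim_1_over_n]]] by simp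
  have iff: "x \<in> ?W j \<longleftrightarrow> 0 < u \<bullet> x \<and> u \<bullet> x \<le> h u \<and> (\<forall>v\<in>U - {u}. (1 - 1 / real (Suc (Suc j))) * h u * (v \<bullet> x) \<le> h v * (u \<bullet> x))" for x j
    using u by (auto simp: wedge_def)
  have "(\<Inter>j. ?W j) = wedge U h u (h u)"
  proof (intro set_eqI iffI)
    fix x assume x: "x \<in> (\<Inter>j. ?W j)"
    have "h u * (v \<bullet> x) \<le> h v * (u \<bullet> x)" if v: "v \<in> U" for v
    proof (cases "v = u")
      case False
      have "(\<lambda>j. (1 - 1 / real (Suc (Suc j))) * h u * (v \<bullet> x)) \<longlonglongrightarrow> 1 * h u * (v \<bullet> x)"
        by (intro tendsto_mult tendsto_const lim1)
      then have "1 * h u * (v \<bullet> x) \<le> h v * (u \<bullet> x)"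
        by (rule LIMSEQ_le_const2) (use x v False iff in \<open>auto intro!: exI[of _ 0]\<close>)
      then show ?thesis by simp
    qed simp
    moreover have "x \<in> ?W 0" using x by blast
    then have "0 < u \<bullet> x" "u \<bullet> x \<le> h u" by (simp_all add: wedge_def)
    ultimately show "x \<in> wedge U h u (h u)" by (simp add: wedge_def)
  next
    fix x assume x: "x \<in> wedge U h u (h u)"
    have "c * h u * (v \<bullet> x) \<le> h v * (u \<bullet> x)" if v: "v \<in> U" and c: "0 < c" "c \<le> 1" for v c
    proof (cases "0 \<le> v \<bullet> x")
      case True
      have "c * (h u * (v \<bullet> x)) \<le> h u * (v \<bullet> x)"
        using True c h[OF u] by (intro mult_left_le_one_le mult_nonneg_nonneg) simp_all
      moreover have "h u * (v \<bullet> x) \<le> h v * (u \<bullet> x)" using x v by (simp add: wedge_def)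
      ultimately show ?thesis unfolding mult.assoc by (rule order_trans)
    next
      case False
      have "c * h u * (v \<bullet> x) \<le> 0" using False c h[OF u] by (intro mult_nonneg_nonpos) auto
      also have "0 \<le> h v * (u \<bullet> x)" using x h[OF v] by (intro mult_nonneg_nonneg) (auto simp: wedge_def)
      finally show ?thesis .
    qed
    then show "x \<in> (\<Inter>j. ?W j)" using x iff lt by (auto simp: wedge_def)
  qed
  moreover have "(\<lambda>j. measure lebesgue (?W j)) \<longlonglongrightarrow> measure lebesgue (\<Inter>j. ?W j)"
  proof (rule Lim_measure_decseq)
    have m: "?W j \<in> lmeasurable" for j using h[OF u] lt[of j] by (intro wedge_lmeasurable) simp
    then show "range ?W \<subseteq> sets lebesgue" by (auto intro: fmeasurableD)
    show "emeasure lebesgue (?W j) \<noteq> \<infinity>" for j using m[of j] by (auto simp: fmeasurable_def)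
    show "decseq ?W"
    proof (rule decseq_SucI, rule subsetI)
      fix j x assume x: "x \<in> ?W (Suc j)"
      have "(1 - 1 / real (Suc (Suc j))) * h u * (v \<bullet> x) \<le> h v * (u \<bullet> x)" if v: "v \<in> U - {u}" for v
      proof (cases "0 \<le> v \<bullet> x")
        case True
        have "(1 - 1 / real (Suc (Suc j))) * h u * (v \<bullet> x) \<le> (1 - 1 / real (Suc (Suc (Suc j)))) * h u * (v \<bullet> x)"
          using True h[OF u] by (intro mult_right_mono) (auto simp: frac_le)
        also have "\<dots> \<le> h v * (u \<bullet> x)" using x v iff[of x "Suc j"] by blast
        finally show ?thesis .
      next
        case False
        have "(1 - 1 / real (Suc (Suc j))) * h u * (v \<bullet> x) \<le> 0"
          using False h[OF u] lt[of j] by (intro mult_nonneg_nonpos mult_nonneg_nonneg) auto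
        also have "0 \<le> h v * (u \<bullet> x)" using x h v iff[of x "Suc j"] by (intro mult_nonneg_nonneg) (auto intro: less_imp_le)
        finally show ?thesis .
      qed
      then show "x \<in> ?W j" using x iff by blast
    qed
  qed
  ultimately show ?thesis by (simp add: cone_volume_def)
qed

text \<open>The first variation: lowering one support number by the factor \<open>1 - t\<close> loses volume at most
  \<open>t * DIM('a) * cone_volume U h u\<close> to first order, so maximality bounds the cone volume from below.
  The bounds add up to an equality, hence each of them is an equality.\<close>
lemma maximal_volume_cone_volume:
  assumes \<alpha>: "\<And>u. u \<in> U \<Longrightarrow> 0 < \<alpha> u" and p: "1 < p"
    and h: "\<And>u. u \<in> U \<Longrightarrow> 0 < h u" "(\<Sum>u\<in>U. \<alpha> u * h u powr p) = 1"
    and max: "\<And>k. (\<And>u. u \<in> U \<Longrightarrow> 0 \<le> k u) \<Longrightarrow>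
      root DIM('a) (V k) \<le> root DIM('a) (V h) * (\<Sum>u\<in>U. \<alpha> u * k u powr p) powr (1 / p)"
    and u: "u \<in> U"
  shows "cone_volume U h u = V h * (\<alpha> u * h u powr p)"
proof -
  let ?n = "DIM('a)"
  have Vh: "0 < V h" using V_pos h(1) by blast
  have lower: "V h * (\<alpha> u * h u powr p) \<le> cone_volume U h u" if u: "u \<in> U" for u
  proof -
    define a where "a = \<alpha> u * h u powr p"
    have a: "0 < a" using \<alpha>[OF u] h(1)[OF u] by (simp add: a_def)
    define k where "k t = h(u := (1 - t) * h u)" for t
    define W where "W t = measure lebesgue (wedge U (k t) u (h u))" for t
    define \<phi> where "\<phi> t = V h * (1 - (1 - a * (1 - (1 - t) powr p)) powr (real ?n / p))" for t
    define \<psi> where "\<psi> t = 1 - (1 - t) ^ ?n" for t :: real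
    have ineq: "\<phi> t \<le> \<psi> t * W t" if t: "0 < t" "t < 1" for t
    proof -
      have k0: "0 \<le> k t v" if "v \<in> U" for v using h(1)[OF that] h(1)[OF u] t by (auto simp: k_def less_imp_le)
      have "(\<Sum>v\<in>U. \<alpha> v * k t v powr p) = \<alpha> u * k t u powr p + (\<Sum>v\<in>U - {u}. \<alpha> v * k t v powr p)"
        using finite_U u by (rule sum.remove)
      also have "(\<Sum>v\<in>U - {u}. \<alpha> v * k t v powr p) = (\<Sum>v\<in>U - {u}. \<alpha> v * h v powr p)"
        by (intro sum.cong) (auto simp: k_def)
      also have "\<dots> = 1 - a"
        using sum.remove[OF finite_U u, of "\<lambda>v. \<alpha> v * h v powr p"] h(2) by (simp add: a_def)
      also have "\<alpha> u * k t u powr p = (1 - t) powr p * a"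
        using t h(1)[OF u] by (simp add: k_def a_def powr_mult less_imp_le)
      finally have c: "(\<Sum>v\<in>U. \<alpha> v * k t v powr p) = 1 - a * (1 - (1 - t) powr p)"
        by (simp add: algebra_simps)
      have c0: "0 \<le> 1 - a * (1 - (1 - t) powr p)"
        unfolding c[symmetric] using less_imp_le[OF \<alpha>] by (intro sum_nonneg) simp
      have "root ?n (V (k t)) \<le> root ?n (V h) * (1 - a * (1 - (1 - t) powr p)) powr (1 / p)"
        using max[of "k t"] k0 c by simp
      then have "root ?n (V (k t)) ^ ?n \<le> (root ?n (V h) * (1 - a * (1 - (1 - t) powr p)) powr (1 / p)) ^ ?n"
        by (intro power_mono) auto
      then have "V (k t) \<le> V h * ((1 - a * (1 - (1 - t) powr p)) powr (1 / p)) ^ ?n"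
        by (simp add: power_mult_distrib)
      also have "((1 - a * (1 - (1 - t) powr p)) powr (1 / p)) ^ ?n = (1 - a * (1 - (1 - t) powr p)) powr (real ?n / p)"
      proof (cases "1 - a * (1 - (1 - t) powr p) = 0")
        case False
        then show ?thesis using c0 by (simp add: powr_powr flip: powr_realpow)
      qed simp
      finally have "\<phi> t \<le> V h - V (k t)" by (simp add: \<phi>_def algebra_simps)
      also have "\<dots> \<le> \<psi> t * W t"
        using V_shrink_lower[of h u t, OF h(1) u t] by (simp add: \<psi>_def W_def k_def)
      finally show ?thesis .
    qed
    define t where "t j = 1 / real (Suc (Suc j))" for j
    have t01: "0 < t j" "t j < 1" for j by (simp_all add: t_def)
    have t0: "filterlim t (at 0) sequentially"
      unfolding filterlim_at t_def[abs_def] using LIMSEQ_Suc[OF LIMSEQ_Suc[OF lim_1_over_n]] by simp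
    have "(\<phi> has_real_derivative V h * (real ?n * a)) (at 0)"
      unfolding \<phi>_def by (rule derivative_eq_intros refl | simp)+ (use p in simp)
    then have "((\<lambda>x. (\<phi> (0 + x) - \<phi> 0) / x) \<longlongrightarrow> V h * (real ?n * a)) (at 0)" by (simp add: DERIV_def)
    from filterlim_compose[OF this t0]
    have 1: "(\<lambda>j. \<phi> (t j) / t j) \<longlonglongrightarrow> V h * (real ?n * a)" by (simp add: \<phi>_def)
    have "(\<psi> has_real_derivative real ?n) (at 0)"
      unfolding \<psi>_def by (auto intro!: derivative_eq_intros)
    then have "((\<lambda>x. (\<psi> (0 + x) - \<psi> 0) / x) \<longlongrightarrow> real ?n) (at 0)" by (simp add: DERIV_def)
    from filterlim_compose[OF this t0] have "(\<lambda>j. \<psi> (t j) / t j) \<longlonglongrightarrow> real ?n" by (simp add: \<psi>_def)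
    moreover have "(\<lambda>j. W (t j)) \<longlonglongrightarrow> cone_volume U h u"
      using wedge_shrink_limit[of h u, OF h(1) u] by (simp add: W_def k_def t_def)
    ultimately have 2: "(\<lambda>j. \<psi> (t j) / t j * W (t j)) \<longlonglongrightarrow> real ?n * cone_volume U h u" by (rule tendsto_mult)
    have "V h * (real ?n * a) \<le> real ?n * cone_volume U h u"
    proof (rule LIMSEQ_le[OF 1 2])
      have "\<phi> (t j) / t j \<le> \<psi> (t j) / t j * W (t j)" for j
        using divide_right_mono[OF ineq[OF t01[of j]], of "t j"] t01(1)[of j] by simp
      then show "\<exists>N. \<forall>j\<ge>N. \<phi> (t j) / t j \<le> \<psi> (t j) / t j * W (t j)" by blast
    qed
    then show ?thesis by (simp add: a_def)
  qed
  have "(\<Sum>u\<in>U. cone_volume U h u - V h * (\<alpha> u * h u powr p)) = 0"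
    using V_eq_sum_cone_volume[of h, OF h(1)] h(2) by (simp add: sum_subtractf flip: sum_distrib_left)
  moreover have "0 \<le> cone_volume U h u - V h * (\<alpha> u * h u powr p)" if "u \<in> U" for u
    using lower[OF that] by simp
  ultimately have "\<forall>u\<in>U. cone_volume U h u - V h * (\<alpha> u * h u powr p) = 0"
    using sum_nonneg_eq_0_iff[OF finite_U, of "\<lambda>u. cone_volume U h u - V h * (\<alpha> u * h u powr p)"] by simp
  then show ?thesis using u by simp
qed

text \<open>A maximizer solves the problem up to a constant factor; because \<open>p\<close> differs from the dimension,
  a dilation removes the factor.\<close>
theorem Lp_minkowski_existence:
  assumes \<alpha>: "\<And>u. u \<in> U \<Longrightarrow> 0 < \<alpha> u" and p: "1 < p" "p \<noteq> real DIM('a)"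
  obtains h where "\<And>u. u \<in> U \<Longrightarrow> 0 < h u" "\<And>u. u \<in> U \<Longrightarrow> cone_volume U h u = \<alpha> u * h u powr p"
proof -
  obtain h where h: "\<And>u. u \<in> U \<Longrightarrow> 0 \<le> h u" "(\<Sum>u\<in>U. \<alpha> u * h u powr p) = 1" "0 < V h"
    "\<And>k. (\<And>u. u \<in> U \<Longrightarrow> 0 \<le> k u) \<Longrightarrow>
      root DIM('a) (V k) \<le> root DIM('a) (V h) * (\<Sum>u\<in>U. \<alpha> u * k u powr p) powr (1 / p)"
    using maximal_volume_exists[of \<alpha> p, OF \<alpha> p(1)] by blast
  have hpos: "0 < h u" if "u \<in> U" for u
    by (rule maximal_volume_positive[of \<alpha> p h u, OF \<alpha> p(1) h that])
  have cv: "cone_volume U h u = V h * (\<alpha> u * h u powr p)" if "u \<in> U" for u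
    by (rule maximal_volume_cone_volume[of \<alpha> p h u, OF \<alpha> p(1) hpos h(2,4) that])
  \<comment> \<open>a dilation by \<open>c\<close> multiplies the cone volumes by \<open>c ^ DIM('a)\<close> and \<open>h u powr p\<close> by \<open>c powr p\<close>\<close>
  define c where "c = V h powr (1 / (p - real DIM('a)))"
  have c: "0 < c" using h(3) by (simp add: c_def)
  have "c powr (p - real DIM('a)) = V h"
    using h(3) p(2) by (simp add: c_def powr_powr)
  then have cp: "c powr p = c ^ DIM('a) * V h"
    using c by (simp add: powr_diff powr_realpow field_simps)
  show thesis
  proof
    show "0 < c * h u" if "u \<in> U" for u using c hpos[OF that] by simp
    show "cone_volume U (\<lambda>u. c * h u) u = \<alpha> u * (c * h u) powr p" if "u \<in> U" for u
      using cone_volume_scale[OF c, of h u] cv[OF that] c hpos[OF that] cp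
      by (simp add: powr_mult less_imp_le)
  qed
qed

text \<open>The hypothesis \<open>hk\<close> is what equality of the \<open>L\<^sub>p\<close> surface area measures of \<open>hpoly U h\<close> and \<open>hpoly U k\<close> says
  about the support function of \<open>hpoly U k\<close>. By Jensen's inequality for \<open>x powr p\<close> and Minkowski's
  first inequality, the mean of \<open>(k u / h u) powr p\<close> is at least the power of the volume
  ratio. Jensen's inequality is used in the form of the tangent at the root \<open>s\<close> of this ratio.\<close>
lemma Lp_minkowski_mean_ratio:
  assumes p: "1 < p"
    and h: "\<And>u. u \<in> U \<Longrightarrow> 0 < h u" and k: "\<And>u. u \<in> U \<Longrightarrow> 0 < k u"
    and hk: "(\<Sum>u\<in>U. (k u / h u) powr p * cone_volume U h u) = V k"
  shows "root DIM('a) (V k / V h) powr p \<le> V k / V h"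
proof -
  define w where "w u = cone_volume U h u / V h" for u
  define q where "q u = k u / h u" for u
  define s where "s = root DIM('a) (V k / V h)"
  have Vh: "0 < V h" and Vk: "0 < V k" using V_pos h k by blast+
  have s: "0 < s" using Vh Vk by (simp add: s_def)
  have sw: "(\<Sum>u\<in>U. w u) = 1"
    using V_eq_sum_cone_volume[of h, OF h] Vh by (simp add: w_def flip: sum_divide_distrib)
  have mink: "s \<le> (\<Sum>u\<in>U. w u * q u)"
    using minkowski_first_inequality[of h k, OF h k] by (simp add: s_def w_def q_def)
  have "(\<Sum>u\<in>U. w u * q u powr p) = V k / V h"
    using hk by (simp add: w_def q_def mult.commute flip: sum_divide_distrib)
  have "s powr p * (1 + p * (q u / s - 1)) \<le> q u powr p" if "u \<in> U" for u
  proof -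
    have "0 < q u" using h k that by (simp add: q_def)
    then have "s powr p * (1 + p * (q u / s - 1)) \<le> s powr p * (q u / s) powr p"
      using s p by (intro mult_left_mono bernoulli_powr) auto
    also have "\<dots> = q u powr p" using s \<open>0 < q u\<close> by (simp add: powr_divide)
    finally show ?thesis .
  qed
  then have "(\<Sum>u\<in>U. w u * (s powr p * (1 + p * (q u / s - 1)))) \<le> (\<Sum>u\<in>U. w u * q u powr p)"
    using Vh cone_volume_nonneg by (intro sum_mono mult_left_mono) (auto simp: w_def)
  also have "(\<Sum>u\<in>U. w u * (s powr p * (1 + p * (q u / s - 1)))) =
     s powr p * ((1 - p) * (\<Sum>u\<in>U. w u) + p / s * (\<Sum>u\<in>U. w u * q u))"
    by (simp add: sum_distrib_left sum.distrib[symmetric] algebra_simps)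
  finally have "s powr p * ((1 - p) + p / s * (\<Sum>u\<in>U. w u * q u)) \<le> V k / V h"
    using sw \<open>(\<Sum>u\<in>U. w u * q u powr p) = V k / V h\<close> by simp
  moreover have "p / s * s \<le> p / s * (\<Sum>u\<in>U. w u * q u)" using mink s p by (intro mult_left_mono) auto
  then have "1 \<le> (1 - p) + p / s * (\<Sum>u\<in>U. w u * q u)" using s by simp
  then have "s powr p * 1 \<le> s powr p * ((1 - p) + p / s * (\<Sum>u\<in>U. w u * q u))" by (intro mult_left_mono) auto
  ultimately show ?thesis by (simp add: s_def)
qed

text \<open>With equal volumes all inequalities become equalities. The tangent at 1 touches the strictly convex
  function \<open>x powr p\<close> only at 1, so the support numbers agree for all normals with
  positive cone volume, and the cones over these facets fill the space up to a null set.\<close>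
lemma Lp_minkowski_subset:
  assumes p: "1 < p"
    and h: "\<And>u. u \<in> U \<Longrightarrow> 0 < h u" and k: "\<And>u. u \<in> U \<Longrightarrow> 0 < k u"
    and hk: "(\<Sum>u\<in>U. (k u / h u) powr p * cone_volume U h u) = V k"
    and eq: "V h = V k"
  shows "hpoly U k \<subseteq> hpoly U h"
proof -
  define w where "w u = cone_volume U h u / V h" for u
  define q where "q u = k u / h u" for u
  have Vh: "0 < V h" using V_pos h by blast
  have w0: "0 \<le> w u" for u using Vh cone_volume_nonneg by (simp add: w_def)
  have sw: "(\<Sum>u\<in>U. w u) = 1"
    using V_eq_sum_cone_volume[of h, OF h] Vh by (simp add: w_def flip: sum_divide_distrib)
  have mink: "1 \<le> (\<Sum>u\<in>U. w u * q u)"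
    using minkowski_first_inequality[of h k, OF h k] Vh eq by (simp add: w_def q_def)
  have swq: "(\<Sum>u\<in>U. w u * q u powr p) = 1"
    using hk Vh eq by (simp add: w_def q_def mult.commute flip: sum_divide_distrib)
  have q0: "0 < q u" if "u \<in> U" for u using h k that by (simp add: q_def)
  have term0: "0 \<le> w u * (q u powr p - (1 + p * (q u - 1)))" if "u \<in> U" for u
    using w0 bernoulli_powr(1)[OF p less_imp_le[OF q0[OF that]]] by simp
  have "(\<Sum>u\<in>U. w u * (q u powr p - (1 + p * (q u - 1)))) =
     (\<Sum>u\<in>U. w u * q u powr p) - ((1 - p) * (\<Sum>u\<in>U. w u) + p * (\<Sum>u\<in>U. w u * q u))"
    by (simp add: sum_distrib_left sum.distrib[symmetric] sum_subtractf[symmetric] algebra_simps)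
  also have "\<dots> = p * (1 - (\<Sum>u\<in>U. w u * q u))" unfolding sw swq by (simp add: algebra_simps)
  also have "\<dots> \<le> 0" using mink p by (intro mult_nonneg_nonpos) auto
  finally have "(\<Sum>u\<in>U. w u * (q u powr p - (1 + p * (q u - 1)))) = 0"
    using sum_nonneg[of U "\<lambda>u. w u * (q u powr p - (1 + p * (q u - 1)))", OF term0] by (intro antisym) simp_all
  then have zero: "w u * (q u powr p - (1 + p * (q u - 1))) = 0" if "u \<in> U" for u
    using sum_nonneg_eq_0_iff[OF finite_U, of "\<lambda>u. w u * (q u powr p - (1 + p * (q u - 1)))"] term0 that by simp
  have ratio: "k u = h u" if u: "u \<in> U" and cv: "cone_volume U h u \<noteq> 0" for u
  proof -
    have "w u \<noteq> 0" using cv Vh by (simp add: w_def)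
    then have "q u powr p = 1 + p * (q u - 1)" using zero[OF u] by simp
    then have "q u = 1" using bernoulli_powr(2)[OF p less_imp_le[OF q0[OF u]]] by fastforce
    then show ?thesis using h[OF u] by (simp add: q_def)
  qed
  \<comment> \<open>every point of the open set \<open>?O\<close> lies in the cone over a face with cone volume zero\<close>
  let ?O = "interior (hpoly U k) - hpoly U h"
  have op: "open ?O" by (intro open_Diff open_interior closed_hpoly)
  have "?O \<subseteq> (\<Union>u\<in>{u\<in>U. cone_volume U h u = 0}. (*\<^sub>R) (k u / h u) ` wedge U h u (h u))"
  proof
    fix x assume x: "x \<in> ?O"
    then have xk: "u \<bullet> x \<le> k u" if "u \<in> U" for u using that interior_subset by (force simp: hpoly_def)
    have "x \<noteq> 0" using x h by (force simp: hpoly_def less_imp_le)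
    then obtain u where u: "u \<in> U" "0 < u \<bullet> x" "\<And>v. v \<in> U \<Longrightarrow> h u * (v \<bullet> x) \<le> h v * (u \<bullet> x)"
      using active_facet_exists[of h x, OF h] by blast
    have "cone_volume U h u = 0"
    proof (rule ccontr)
      assume "cone_volume U h u \<noteq> 0"
      then have "u \<bullet> x \<le> h u" using ratio[OF u(1)] xk[OF u(1)] by simp
      then have "x \<in> wedge U h u (h u)" using u by (auto simp: wedge_def)
      then show False using wedge_subset_hpoly[of h u, OF h u(1)] x by blast
    qed
    moreover have "x \<in> (*\<^sub>R) (k u / h u) ` wedge U h u (h u)"
    proof -
      have "x \<in> wedge U h u (k u / h u * h u)" using u xk[OF u(1)] h[OF u(1)] by (auto simp: wedge_def)
      then show ?thesis using wedge_scale[of "k u / h u" h u "h u"] h k u(1) by simp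
    qed
    ultimately show "x \<in> (\<Union>u\<in>{u\<in>U. cone_volume U h u = 0}. (*\<^sub>R) (k u / h u) ` wedge U h u (h u))"
      using u(1) by blast
  qed
  moreover have "negligible (\<Union>u\<in>{u\<in>U. cone_volume U h u = 0}. (*\<^sub>R) (k u / h u) ` wedge U h u (h u))"
  proof (rule negligible_Union)
    fix T assume "T \<in> (\<lambda>u. (*\<^sub>R) (k u / h u) ` wedge U h u (h u)) ` {u\<in>U. cone_volume U h u = 0}"
    then obtain u where u: "u \<in> U" "cone_volume U h u = 0" "T = (*\<^sub>R) (k u / h u) ` wedge U h u (h u)" by blast
    have "T \<in> lmeasurable" unfolding u(3) using wedge_lmeasurable h u(1) by (intro lmeasurable_scale) blast
    moreover have "measure lebesgue T = 0"
      unfolding u(3) using u(2) h[OF u(1)] k[OF u(1)] by (subst measure_lebesgue_scale) (auto simp: cone_volume_def)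
    ultimately show "negligible T" by (simp add: negligible_iff_measure)
  qed (use finite_U in simp)
  ultimately have "negligible ?O" by (rule negligible_subset[rotated])
  then have "?O = {}" using op open_not_negligible by blast
  then have "interior (hpoly U k) \<subseteq> hpoly U h" by blast
  then have "closure (interior (hpoly U k)) \<subseteq> hpoly U h" by (rule closure_minimal) (rule closed_hpoly)
  moreover have "closure (interior (hpoly U k)) = hpoly U k"
    using zero_in_interior_hpoly[of k, OF k] convex_closure_interior[OF convex_hpoly, of k] closed_hpoly by auto
  ultimately show ?thesis by simp
qed

text \<open>The volume ratio \<open>V k / V h\<close> and its inverse both bound their own power with exponent \<open>p / DIM('a) \<noteq> 1\<close>
  from above, so the ratio is 1.\<close>
theorem Lp_minkowski_uniqueness:
  assumes p: "1 < p" "p \<noteq> real DIM('a)"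
    and h: "\<And>u. u \<in> U \<Longrightarrow> 0 < h u" and k: "\<And>u. u \<in> U \<Longrightarrow> 0 < k u"
    and hk: "(\<Sum>u\<in>U. (k u / h u) powr p * cone_volume U h u) = V k"
    and kh: "(\<Sum>u\<in>U. (h u / k u) powr p * cone_volume U k u) = V h"
  shows "hpoly U h = hpoly U k"
proof -
  let ?n = "DIM('a)"
  have Vh: "0 < V h" and Vk: "0 < V k" using V_pos h k by blast+
  define s where "s = root ?n (V k / V h)"
  have s: "0 < s" using Vh Vk by (simp add: s_def)
  have sn: "s powr real ?n = V k / V h" using Vh Vk s by (simp add: powr_realpow) (simp add: s_def)
  have "s powr p \<le> s powr real ?n"
    using Lp_minkowski_mean_ratio[of p h k, OF p(1) h k hk] sn by (simp add: s_def)
  moreover have "s powr real ?n \<le> s powr p"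
  proof -
    have "root ?n (V h / V k) powr p \<le> V h / V k"
      by (rule Lp_minkowski_mean_ratio[of p k h, OF p(1) k h kh])
    moreover have "root ?n (V h / V k) = 1 / s" by (simp add: s_def real_root_divide)
    ultimately have "(1 / s) powr p \<le> (1 / s) powr real ?n"
      using sn s by (simp add: powr_divide)
    then show ?thesis using s by (simp add: powr_divide field_simps)
  qed
  ultimately have "s powr p = s powr real ?n" by linarith
  then have "p * ln s = real ?n * ln s" using s by (metis ln_powr less_irrefl)
  then have "s = 1" using s p(2) by simp
  then have "V k / V h = 1" using Vh Vk by (metis sn powr_one_eq_one)
  then have eq: "V h = V k" using Vh by simp
  show ?thesis
    using Lp_minkowski_subset[of p h k, OF p(1) h k hk eq] Lp_minkowski_subset[of p k h, OF p(1) k h kh eq[symmetric]]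
    by (rule subset_antisym[rotated])
qed

end

section \<open>Gradients of piecewise affine functions\<close>

lemma gradient_affine_on_open:
  assumes "open S" "x \<in> S" "\<And>y. y \<in> S \<Longrightarrow> f y = a \<bullet> y + b"
  shows "gradient f x = a"
proof -
  have "((\<lambda>y. a \<bullet> y + b) has_derivative (\<lambda>d. d \<bullet> a)) (at x)"
    by (auto intro!: derivative_eq_intros simp: inner_commute)
  then have d: "(f has_derivative (\<lambda>d. d \<bullet> a)) (at x)"
    by (rule has_derivative_transform_within_open[OF _ assms(1,2)]) (use assms(3) in simp)
  show ?thesis
    unfolding gradient_def
  proof (rule the_equality)
    show "GDERIV f x :> a" using d by (simp add: gderiv_def)
    fix D assume "GDERIV f x :> D"
    then have "(\<lambda>d. d \<bullet> D) = (\<lambda>d. d \<bullet> a)" using has_derivative_unique[OF _ d] by (simp add: gderiv_def)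
    then have "(D - a) \<bullet> D = (D - a) \<bullet> a" by (rule fun_cong)
    then have "(D - a) \<bullet> (D - a) = 0" by (simp add: inner_diff_right)
    then show "D = a" by simp
  qed
qed

lemma full_simplex_interior_nonempty:
  fixes T :: "'a::euclidean_space set"
  assumes "int DIM('a) simplex T"
  shows "interior T \<noteq> {}"
proof -
  have "aff_dim T = int DIM('a)" using assms by (rule aff_dim_simplex)
  then have "affine hull T = UNIV" by (simp add: aff_dim_eq_full)
  then have "rel_interior T = interior T" by (rule rel_interior_interior)
  moreover have "rel_interior T \<noteq> {}"
    using rel_interior_eq_empty[OF convex_simplex[OF assms]] \<open>aff_dim T = int DIM('a)\<close> by auto
  ultimately show ?thesis by simp
qed

lemma mono_of_nonneg_derivative_off_finite:
  fixes \<phi> :: "real \<Rightarrow> real"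
  assumes "finite k" "continuous_on UNIV \<phi>" "s \<le> t"
    and der: "\<And>x. x \<notin> k \<Longrightarrow> \<exists>m\<ge>0. (\<phi> has_real_derivative m) (at x)"
  shows "\<phi> s \<le> \<phi> t"
proof -
  obtain m where m: "\<And>x. x \<notin> k \<Longrightarrow> 0 \<le> m x \<and> (\<phi> has_real_derivative m x) (at x)" using der by metis
  define m' where "m' x = (if x \<in> k then 0 else m x)" for x
  have "(m' has_integral (\<phi> t - \<phi> s)) {s..t}"
  proof (rule fundamental_theorem_of_calculus_interior_strong[OF assms(1,3)])
    show "(\<phi> has_vector_derivative m' x) (at x)" if "x \<in> {s<..<t} - k" for x
      using m[of x] that by (simp add: m'_def has_real_derivative_iff_has_vector_derivative)
    show "continuous_on {s..t} \<phi>" using assms(2) by (rule continuous_on_subset) simp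
  qed
  then have "0 \<le> \<phi> t - \<phi> s" by (rule has_integral_nonneg) (use m in \<open>auto simp: m'_def\<close>)
  then show ?thesis by simp
qed

text \<open>If no gradient had a negative component along \<open>e\<close>, then \<open>f\<close> would be nondecreasing along every line in
  direction \<open>e\<close>; it vanishes near both ends of the line, so it would vanish everywhere.\<close>
lemma piecewise_affine_descending_piece:
  fixes f :: "'a::euclidean_space \<Rightarrow> real"
  assumes cont: "continuous_on UNIV f" and fin: "finite \<T>"
    and T: "\<And>T. T \<in> \<T> \<Longrightarrow> convex T \<and> compact T"
    and aff: "\<And>T x. T \<in> \<T> \<Longrightarrow> x \<in> T \<Longrightarrow> f x = a T \<bullet> x + b T"
    and out: "\<And>x. x \<notin> \<Union>\<T> \<Longrightarrow> f x = 0"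
    and nz: "f x0 \<noteq> 0" and e: "e \<noteq> 0"
  obtains T where "T \<in> \<T>" "a T \<bullet> e < 0"
proof (rule ccontr)
  assume "\<not> thesis"
  then have nonneg: "0 \<le> a T \<bullet> e" if "T \<in> \<T>" for T
    using \<open>\<not> thesis\<close> \<open>\<And>T. \<lbrakk>T \<in> \<T>; a T \<bullet> e < 0\<rbrakk> \<Longrightarrow> thesis\<close>[OF that] by linarith
  define \<phi> where "\<phi> t = f (x0 + t *\<^sub>R e)" for t
  define I where "I T = {t. x0 + t *\<^sub>R e \<in> T}" for T
  have c\<phi>: "continuous_on UNIV \<phi>"
    unfolding \<phi>_def by (intro continuous_on_compose2[OF cont] continuous_intros) auto
  have "bounded (\<Union>\<T>)" using fin T compact_imp_bounded by (intro bounded_Union) auto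
  then obtain B where B: "\<And>x. x \<in> \<Union>\<T> \<Longrightarrow> norm x \<le> B" unfolding bounded_iff by blast
  define L where "L = (\<bar>B\<bar> + norm x0 + 1) / norm e"
  have L0: "0 \<le> L" by (simp add: L_def)
  have far: "x0 + t *\<^sub>R e \<notin> \<Union>\<T>" if "L \<le> \<bar>t\<bar>" for t
  proof
    assume "x0 + t *\<^sub>R e \<in> \<Union>\<T>"
    then have "norm (x0 + t *\<^sub>R e) \<le> B" by (rule B)
    moreover have "norm (t *\<^sub>R e) \<le> norm (x0 + t *\<^sub>R e) + norm x0"
      using norm_triangle_ineq4[of "x0 + t *\<^sub>R e" x0] by simp
    moreover have "L * norm e \<le> \<bar>t\<bar> * norm e" using that by (intro mult_right_mono) auto
    moreover have "L * norm e = \<bar>B\<bar> + norm x0 + 1" using e by (simp add: L_def)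
    ultimately show False by simp
  qed
  have clI: "closed (I T)" if "T \<in> \<T>" for T
  proof -
    have "I T = (\<lambda>t. x0 + t *\<^sub>R e) -` T" by (auto simp: I_def)
    moreover have "closed ((\<lambda>t. x0 + t *\<^sub>R e) -` T)"
      using T[OF that] by (intro closed_vimage compact_imp_closed continuous_intros) simp
    ultimately show ?thesis by simp
  qed
  have "\<exists>c d. I T = {c..d}" if "T \<in> \<T>" for T
  proof -
    have "I T \<subseteq> {-L..L}"
    proof
      fix t assume "t \<in> I T"
      then have "x0 + t *\<^sub>R e \<in> \<Union>\<T>" using that by (auto simp: I_def)
      then have "\<not> L \<le> \<bar>t\<bar>" using far[of t] by blast
      then show "t \<in> {-L..L}" by auto
    qed
    then have "bounded (I T)" by (rule bounded_subset[OF bounded_closed_interval])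
    then have "compact (I T)" using clI[OF that] by (simp add: compact_eq_bounded_closed)
    moreover have "convex (I T)"
    proof (rule convexI)
      fix s t u v :: real assume *: "s \<in> I T" "t \<in> I T" "0 \<le> u" "0 \<le> v" "u + v = 1"
      have "u *\<^sub>R (x0 + s *\<^sub>R e) + v *\<^sub>R (x0 + t *\<^sub>R e) \<in> T"
        using T[OF that] * by (intro convexD) (auto simp: I_def)
      also have "u *\<^sub>R (x0 + s *\<^sub>R e) + v *\<^sub>R (x0 + t *\<^sub>R e) = (u + v) *\<^sub>R x0 + (u * s + v * t) *\<^sub>R e"
        by (simp add: algebra_simps)
      finally show "u *\<^sub>R s + v *\<^sub>R t \<in> I T" using *(5) by (simp add: I_def)
    qed
    ultimately show ?thesis by (metis connected_compact_interval_1 convex_connected)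
  qed
  then obtain c d where cd: "\<And>T. T \<in> \<T> \<Longrightarrow> I T = {c T..d T}" by metis
  have der: "\<exists>m\<ge>0. (\<phi> has_real_derivative m) (at t)" if t: "t \<notin> c ` \<T> \<union> d ` \<T>" for t
  proof (cases "\<exists>T\<in>\<T>. t \<in> I T")
    case True
    then obtain T where T': "T \<in> \<T>" "t \<in> I T" by blast
    then have "t \<in> {c T<..<d T}" using t cd[OF T'(1)] by (auto simp: less_le)
    moreover have "\<phi> s = a T \<bullet> (x0 + s *\<^sub>R e) + b T" if "s \<in> {c T<..<d T}" for s
    proof -
      have "s \<in> I T" using that cd[OF T'(1)] by auto
      then show ?thesis using aff[OF T'(1)] by (simp add: \<phi>_def I_def)
    qed
    moreover have "((\<lambda>s. a T \<bullet> (x0 + s *\<^sub>R e) + b T) has_real_derivative a T \<bullet> e) (at t)"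
    proof -
      have "(\<lambda>s. a T \<bullet> (x0 + s *\<^sub>R e) + b T) = (\<lambda>s. a T \<bullet> x0 + s * (a T \<bullet> e) + b T)"
        by (simp add: inner_add_right)
      then show ?thesis by (auto intro!: derivative_eq_intros)
    qed
    ultimately have "(\<phi> has_real_derivative a T \<bullet> e) (at t)"
      using has_field_derivative_transform_within_open[of "\<lambda>s. a T \<bullet> (x0 + s *\<^sub>R e) + b T" "a T \<bullet> e" t "{c T<..<d T}" \<phi>]
      by auto
    then show ?thesis using nonneg[OF T'(1)] by blast
  next
    case False
    have op: "open (- (\<Union>T\<in>\<T>. I T))" using fin clI by (intro open_Compl closed_UN) auto
    have "\<phi> s = 0" if "s \<in> - (\<Union>T\<in>\<T>. I T)" for s
      using that by (auto simp: \<phi>_def I_def intro!: out)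
    then have "(\<phi> has_real_derivative 0) (at t)"
      using has_field_derivative_transform_within_open[OF DERIV_const op, of t 0 \<phi>] False by auto
    then show ?thesis by blast
  qed
  have mono: "\<phi> s \<le> \<phi> t" if "s \<le> t" for s t
    by (rule mono_of_nonneg_derivative_off_finite[of "c ` \<T> \<union> d ` \<T>", OF _ c\<phi> that der]) (use fin in simp_all)
  have "\<phi> (- L) = 0" "\<phi> L = 0" using far[of "- L"] far[of L] L0 by (auto simp: \<phi>_def intro!: out)
  then have "\<phi> 0 = 0" using mono[of "- L" 0] mono[of 0 L] L0 by simp
  then show False using nz by (simp add: \<phi>_def)
qed

text \<open>Grouping the simplices by the direction of \<open>- \<nabla>f\<close> turns the integral into a sum over finitely many
  unit vectors.\<close>
lemma piecewise_affine_gradient_integral: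
  fixes f :: "'a::euclidean_space \<Rightarrow> real"
  assumes f: "f \<in> piecewise_affine" and nz: "f x0 \<noteq> 0" and p: "0 < p"
  obtains U \<alpha> where "spanning_directions U" "\<And>u. u \<in> U \<Longrightarrow> 0 < \<alpha> u"
    "\<And>\<Psi>. (\<And>x. 0 \<le> \<Psi> x) \<Longrightarrow> positively_homogeneous \<Psi> \<Longrightarrow>
      (\<integral>\<^sup>+ x. ennreal (\<Psi> (- gradient f x) powr p) \<partial>lebesgue) = ennreal (\<Sum>u\<in>U. \<alpha> u * \<Psi> u powr p)"
proof -
  have cont: "continuous_on UNIV f"
    using f unfolding piecewise_affine_def mem_Collect_eq by (rule conjunct1)
  have "\<exists>\<T>. finite \<T> \<and> (\<forall>T\<in>\<T>. int DIM('a) simplex T) \<and>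
        pairwise (\<lambda>S T. disjnt (interior S) (interior T)) \<T> \<and>
        (\<forall>T\<in>\<T>. \<exists>a b. \<forall>x\<in>T. f x = a \<bullet> x + b) \<and> (\<forall>x. x \<notin> \<Union>\<T> \<longrightarrow> f x = 0)"
    using f unfolding piecewise_affine_def mem_Collect_eq by (rule conjunct2)
  then obtain \<T> where \<T>: "finite \<T> \<and> (\<forall>T\<in>\<T>. int DIM('a) simplex T) \<and>
        pairwise (\<lambda>S T. disjnt (interior S) (interior T)) \<T> \<and>
        (\<forall>T\<in>\<T>. \<exists>a b. \<forall>x\<in>T. f x = a \<bullet> x + b) \<and> (\<forall>x. x \<notin> \<Union>\<T> \<longrightarrow> f x = 0)"
    by (rule exE)
  have fin: "finite \<T>" and simp\<T>: "\<And>T. T \<in> \<T> \<Longrightarrow> int DIM('a) simplex T"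
    and disj: "pairwise (\<lambda>S T. disjnt (interior S) (interior T)) \<T>"
    and ex: "\<And>T. T \<in> \<T> \<Longrightarrow> \<exists>a b. \<forall>x\<in>T. f x = a \<bullet> x + b"
    and out: "\<And>x. x \<notin> \<Union>\<T> \<Longrightarrow> f x = 0"
    using \<T> by (simp_all only: simp_thms)
  obtain a b where aff: "\<And>T x. T \<in> \<T> \<Longrightarrow> x \<in> T \<Longrightarrow> f x = a T \<bullet> x + b T" using ex by metis
  have T: "convex T \<and> compact T" if "T \<in> \<T>" for T
    using convex_simplex[OF simp\<T>[OF that]] compact_simplex[OF simp\<T>[OF that]] by simp
  define m where "m T = measure lebesgue (interior T)" for T :: "'a set"
  have iT: "interior T \<in> lmeasurable" if "T \<in> \<T>" for T
    using T[OF that] by (intro lmeasurable_open bounded_subset[OF compact_imp_bounded interior_subset]) auto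
  have mpos: "0 < m T" if "T \<in> \<T>" for T
  proof -
    have "\<not> negligible (interior T)"
      using full_simplex_interior_nonempty[OF simp\<T>[OF that]] open_not_negligible by blast
    then show ?thesis using iT[OF that] unfolding m_def by (metis measure_nonneg negligible_iff_measure less_le)
  qed
  have gin: "gradient f x = a T" if "T \<in> \<T>" "x \<in> interior T" for T x
    using that interior_subset by (intro gradient_affine_on_open[where S = "interior T" and b = "b T"] aff) auto
  have gout: "gradient f x = 0" if "x \<notin> \<Union>\<T>" for x
  proof (rule gradient_affine_on_open[where S = "- \<Union>\<T>" and b = 0])
    show "open (- \<Union>\<T>)" using fin T compact_imp_closed by (intro open_Compl closed_Union) auto
  qed (use that out in auto)
  define \<T>' where "\<T>' = {T \<in> \<T>. a T \<noteq> 0}"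
  define d where "d T = (1 / norm (a T)) *\<^sub>R (- a T)" for T
  define U where "U = d ` \<T>'"
  define \<alpha> where "\<alpha> u = (\<Sum>T\<in>{T \<in> \<T>'. d T = u}. m T * norm (a T) powr p)" for u
  have fin': "finite \<T>'" using fin by (simp add: \<T>'_def)
  show thesis
  proof
    show "spanning_directions U"
    proof
      show "finite U" using fin' by (simp add: U_def)
      show "norm u = 1" if "u \<in> U" for u using that by (auto simp: U_def d_def \<T>'_def)
      fix e :: 'a assume "e \<noteq> 0"
      then obtain T where T': "T \<in> \<T>" "a T \<bullet> e < 0"
        using piecewise_affine_descending_piece[of f \<T> a b x0 e] cont fin T aff out nz by metis
      then have "a T \<noteq> 0" by auto
      then have "d T \<in> U" "0 < d T \<bullet> e" using T' by (auto simp: U_def \<T>'_def d_def divide_neg_pos)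
      then show "\<exists>u\<in>U. 0 < u \<bullet> e" by blast
    qed
    show "0 < \<alpha> u" if u: "u \<in> U" for u
    proof -
      obtain T where T': "T \<in> \<T>'" "d T = u" using u unfolding U_def by blast
      have pos: "0 < m S * norm (a S) powr p" if "S \<in> \<T>'" for S
        using that mpos[of S] by (auto simp: \<T>'_def)
      show ?thesis unfolding \<alpha>_def
        by (rule sum_pos2[of _ T]) (use T' fin' pos in \<open>auto intro: less_imp_le\<close>)
    qed
    fix \<Psi> :: "'a \<Rightarrow> real" assume \<Psi>: "\<And>x. 0 \<le> \<Psi> x" and hom: "positively_homogeneous \<Psi>"
    have \<Psi>0: "\<Psi> 0 = 0" using hom[unfolded positively_homogeneous_def, rule_format, of 0 0] by simp
    have "negligible (\<Union>T\<in>\<T>. frontier T)"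
      using fin T by (intro negligible_Union) (auto intro: negligible_convex_frontier)
    then have "(\<Union>T\<in>\<T>. frontier T) \<in> null_sets lebesgue" by (simp add: negligible_iff_null_sets)
    then have "AE x in lebesgue. x \<notin> (\<Union>T\<in>\<T>. frontier T)" by (rule AE_not_in)
    then have "AE x in lebesgue. ennreal (\<Psi> (- gradient f x) powr p) =
        (\<Sum>T\<in>\<T>. ennreal (\<Psi> (- a T) powr p) * indicator (interior T) x)"
    proof (rule AE_mp[OF _ AE_I2], intro impI)
      fix x assume x: "x \<notin> (\<Union>T\<in>\<T>. frontier T)"
      show "ennreal (\<Psi> (- gradient f x) powr p) = (\<Sum>T\<in>\<T>. ennreal (\<Psi> (- a T) powr p) * indicator (interior T) x)"
      proof (cases "x \<in> \<Union>\<T>")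
        case True
        then obtain T where T': "T \<in> \<T>" "x \<in> T" by blast
        then have xi: "x \<in> interior T" using x closure_subset[of T] by (auto simp: frontier_def)
        have "x \<notin> interior S" if "S \<in> \<T> - {T}" for S
          using disj that T'(1) xi by (auto simp: pairwise_def disjnt_def)
        then have "(\<Sum>S\<in>\<T> - {T}. ennreal (\<Psi> (- a S) powr p) * indicator (interior S) x) = 0"
          by (intro sum.neutral) simp
        then show ?thesis
          using sum.remove[OF fin T'(1), of "\<lambda>T. ennreal (\<Psi> (- a T) powr p) * indicator (interior T) x"] xi gin[OF T'(1) xi]
          by simp
      next
        case False
        then have "(\<Sum>T\<in>\<T>. ennreal (\<Psi> (- a T) powr p) * indicator (interior T) x) = 0"
          using interior_subset by (intro sum.neutral) (auto simp: indicator_def)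
        then show ?thesis using gout[OF False] \<Psi>0 by simp
      qed
    qed
    then have "(\<integral>\<^sup>+ x. ennreal (\<Psi> (- gradient f x) powr p) \<partial>lebesgue) =
        (\<integral>\<^sup>+ x. (\<Sum>T\<in>\<T>. ennreal (\<Psi> (- a T) powr p) * indicator (interior T) x) \<partial>lebesgue)"
      by (rule nn_integral_cong_AE)
    also have "\<dots> = (\<Sum>T\<in>\<T>. (\<integral>\<^sup>+ x. ennreal (\<Psi> (- a T) powr p) * indicator (interior T) x \<partial>lebesgue))"
      by (intro nn_integral_sum borel_measurable_times_ennreal borel_measurable_const borel_measurable_indicator fmeasurableD[OF iT])
    also have "\<dots> = (\<Sum>T\<in>\<T>. ennreal (\<Psi> (- a T) powr p * m T))"
    proof (rule sum.cong)
      fix T assume T': "T \<in> \<T>"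
      have "(\<integral>\<^sup>+ x. ennreal (\<Psi> (- a T) powr p) * indicator (interior T) x \<partial>lebesgue) = ennreal (\<Psi> (- a T) powr p) * emeasure lebesgue (interior T)"
        using fmeasurableD[OF iT[OF T']] by (rule nn_integral_cmult_indicator)
      also have "emeasure lebesgue (interior T) = ennreal (m T)"
        unfolding m_def by (rule emeasure_eq_measure2[OF iT[OF T']])
      finally show "(\<integral>\<^sup>+ x. ennreal (\<Psi> (- a T) powr p) * indicator (interior T) x \<partial>lebesgue) = ennreal (\<Psi> (- a T) powr p * m T)"
        by (simp add: ennreal_mult m_def)
    qed simp
    also have "\<dots> = ennreal (\<Sum>T\<in>\<T>. \<Psi> (- a T) powr p * m T)"
      by (rule sum_ennreal) (simp add: m_def)
    also have "(\<Sum>T\<in>\<T>. \<Psi> (- a T) powr p * m T) = (\<Sum>T\<in>\<T>'. \<Psi> (- a T) powr p * m T)"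
      by (rule sum.mono_neutral_right[OF fin]) (auto simp: \<T>'_def \<Psi>0)
    also have "\<dots> = (\<Sum>T\<in>\<T>'. m T * norm (a T) powr p * \<Psi> (d T) powr p)"
    proof (rule sum.cong)
      fix T assume "T \<in> \<T>'"
      then have "- a T = norm (a T) *\<^sub>R d T" by (simp add: d_def \<T>'_def)
      then have "\<Psi> (- a T) = norm (a T) * \<Psi> (d T)" using hom by (metis norm_ge_zero positively_homogeneous_def)
      then show "\<Psi> (- a T) powr p * m T = m T * norm (a T) powr p * \<Psi> (d T) powr p"
        using \<Psi> by (simp add: powr_mult)
    qed simp
    also have "\<dots> = (\<Sum>u\<in>U. \<Sum>T\<in>{T \<in> \<T>'. d T = u}. m T * norm (a T) powr p * \<Psi> (d T) powr p)"
      unfolding U_def by (rule sum.image_gen[OF fin'])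
    also have "\<dots> = (\<Sum>u\<in>U. \<alpha> u * \<Psi> u powr p)"
      unfolding \<alpha>_def sum_distrib_right by (intro sum.cong) auto
    finally show "(\<integral>\<^sup>+ x. ennreal (\<Psi> (- gradient f x) powr p) \<partial>lebesgue) = ennreal (\<Sum>u\<in>U. \<alpha> u * \<Psi> u powr p)" .
  qed
qed

section \<open>Surface area measures of polytopes\<close>

lemma support_fun_upper:
  assumes "bounded K" "y \<in> K"
  shows "x \<bullet> y \<le> support_fun K x"
proof -
  obtain B where B: "\<And>y. y \<in> K \<Longrightarrow> norm y \<le> B" using assms(1) bounded_iff by blast
  have "bdd_above ((\<lambda>y. x \<bullet> y) ` K)"
  proof (rule bdd_aboveI2)
    fix y assume "y \<in> K"
    have "x \<bullet> y \<le> norm x * norm y" by (rule norm_cauchy_schwarz)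
    also have "\<dots> \<le> norm x * B" using B[OF \<open>y \<in> K\<close>] by (intro mult_left_mono) auto
    finally show "x \<bullet> y \<le> norm x * B" .
  qed
  then show ?thesis unfolding support_fun_def using assms(2) by (rule cSUP_upper2) simp
qed

lemma support_fun_attained:
  assumes "compact K" "K \<noteq> {}"
  obtains y where "y \<in> K" "x \<bullet> y = support_fun K x"
proof -
  obtain y where y: "y \<in> K" "\<And>z. z \<in> K \<Longrightarrow> x \<bullet> z \<le> x \<bullet> y"
  proof -
    have "continuous_on K (\<lambda>y. x \<bullet> y)" by (intro continuous_intros)
    from continuous_attains_sup[OF assms this] show thesis using that by blast
  qed
  have "support_fun K x \<le> x \<bullet> y" unfolding support_fun_def using assms(2) y(2) by (rule cSUP_least)
  moreover have "x \<bullet> y \<le> support_fun K x"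
    using y(1) assms(1) by (intro support_fun_upper compact_imp_bounded)
  ultimately show thesis using that y(1) by force
qed

lemma support_fun_continuous:
  assumes "compact K" "K \<noteq> {}"
  shows "continuous_on UNIV (support_fun K)"
proof -
  obtain B where B: "0 < B" "\<And>y. y \<in> K \<Longrightarrow> norm y \<le> B"
    using compact_imp_bounded[OF assms(1)] bounded_pos by blast
  have le: "support_fun K x \<le> support_fun K z + B * norm (x - z)" for x z
  proof -
    obtain y where y: "y \<in> K" "x \<bullet> y = support_fun K x" using support_fun_attained[OF assms] by blast
    have "x \<bullet> y = z \<bullet> y + (x - z) \<bullet> y" by (simp add: inner_diff_left)
    moreover have "z \<bullet> y \<le> support_fun K z"
      using y(1) assms(1) by (intro support_fun_upper compact_imp_bounded)
    moreover have "(x - z) \<bullet> y \<le> norm (x - z) * norm y" by (rule norm_cauchy_schwarz)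
    moreover have "norm (x - z) * norm y \<le> norm (x - z) * B" using B(2)[OF y(1)] by (intro mult_left_mono) auto
    ultimately show ?thesis using y(2) by (simp add: mult.commute)
  qed
  have "B-lipschitz_on UNIV (support_fun K)"
  proof (rule lipschitz_onI)
    fix x z show "dist (support_fun K x) (support_fun K z) \<le> B * dist x z"
      using le[of x z] le[of z x] by (simp add: dist_norm abs_le_iff norm_minus_commute)
  qed (use B in simp)
  then show ?thesis by (rule lipschitz_on_continuous_on)
qed

lemma support_fun_nonneg: "bounded K \<Longrightarrow> 0 \<in> K \<Longrightarrow> 0 \<le> support_fun K x"
  using support_fun_upper[of K 0 x] by simp

lemma support_fun_homogeneous:
  assumes "compact K" "K \<noteq> {}"
  shows "positively_homogeneous (support_fun K)"
  unfolding positively_homogeneous_def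
proof (intro allI impI)
  fix t :: real and x assume t: "0 \<le> t"
  obtain y where y: "y \<in> K" "x \<bullet> y = support_fun K x" using support_fun_attained[OF assms] by blast
  obtain z where z: "z \<in> K" "(t *\<^sub>R x) \<bullet> z = support_fun K (t *\<^sub>R x)" using support_fun_attained[OF assms] by blast
  have "(t *\<^sub>R x) \<bullet> y \<le> support_fun K (t *\<^sub>R x)"
    using y(1) assms(1) by (intro support_fun_upper compact_imp_bounded)
  moreover have "x \<bullet> z \<le> support_fun K x"
    using z(1) assms(1) by (intro support_fun_upper compact_imp_bounded)
  then have "t * (x \<bullet> z) \<le> t * support_fun K x" using t by (rule mult_left_mono)
  ultimately show "support_fun K (t *\<^sub>R x) = t * support_fun K x" using y(2) z(2) by simp
qed

lemma support_fun_pos: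
  assumes "bounded K" "0 \<in> interior K" "norm u = 1"
  shows "0 < support_fun K u"
proof -
  obtain e where e: "0 < e" "ball 0 e \<subseteq> interior K" using assms(2) open_contains_ball open_interior by blast
  have "(e / 2) *\<^sub>R u \<in> ball 0 e" using e(1) assms(3) by simp
  then have "(e / 2) *\<^sub>R u \<in> K" using e(2) interior_subset by blast
  then have "u \<bullet> ((e / 2) *\<^sub>R u) \<le> support_fun K u" by (rule support_fun_upper[OF assms(1)])
  then show ?thesis using e(1) assms(3) by (simp add: norm_eq_1)
qed

text \<open>A polytope is cut out by the supporting half-spaces in finitely many directions, and
  remains so when further directions are added.\<close>
lemma polytopes0_eq_hpoly:
  assumes "P \<in> polytopes0"
  obtains U where "finite U" "\<And>u. u \<in> U \<Longrightarrow> norm u = 1"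
    "\<And>U'. U \<subseteq> U' \<Longrightarrow> P = hpoly U' (support_fun P)"
proof -
  have "polyhedron P" and bd: "bounded P"
    using assms polytope_eq_bounded_polyhedron by (auto simp: polytopes0_def)
  have ne: "P \<noteq> {}" using assms interior_subset[of P] by (auto simp: polytopes0_def)
  obtain F where F: "finite F" "P = \<Inter>F" "\<And>h. h \<in> F \<Longrightarrow> \<exists>a b. a \<noteq> 0 \<and> h = {x. a \<bullet> x \<le> b}"
    using \<open>polyhedron P\<close> unfolding polyhedron_def by blast
  then obtain a b where ab: "\<And>h. h \<in> F \<Longrightarrow> a h \<noteq> 0" "\<And>h. h \<in> F \<Longrightarrow> h = {x. a h \<bullet> x \<le> b h}" by metis
  define U where "U = (\<lambda>h. (1 / norm (a h)) *\<^sub>R a h) ` F"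
  show thesis
  proof
    show "finite U" using F(1) by (simp add: U_def)
    show "norm u = 1" if "u \<in> U" for u using that ab(1) by (auto simp: U_def)
    fix U' assume U': "U \<subseteq> U'"
    show "P = hpoly U' (support_fun P)"
    proof
      show "P \<subseteq> hpoly U' (support_fun P)" using support_fun_upper[OF bd] by (auto simp: hpoly_def)
      show "hpoly U' (support_fun P) \<subseteq> P"
      proof
        fix x assume x: "x \<in> hpoly U' (support_fun P)"
        have "x \<in> h" if h: "h \<in> F" for h
        proof -
          let ?u = "(1 / norm (a h)) *\<^sub>R a h"
          have "?u \<in> U'" using U' h unfolding U_def by blast
          then have "?u \<bullet> x \<le> support_fun P ?u" using x unfolding hpoly_def by blast
          also have "\<dots> \<le> b h / norm (a h)"
            unfolding support_fun_def
          proof (rule cSUP_least[OF ne])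
            fix y assume "y \<in> P"
            then have "a h \<bullet> y \<le> b h" using F(2) h ab(2)[OF h] by blast
            then show "?u \<bullet> y \<le> b h / norm (a h)" by (simp add: divide_right_mono)
          qed
          finally have "a h \<bullet> x \<le> b h" using ab(1)[OF h] by (simp add: divide_le_cancel)
          then show ?thesis using ab(2)[OF h] by blast
        qed
        then show "x \<in> P" using F(2) by blast
      qed
    qed
  qed
qed

lemma bounded_hpoly_imp_spanning:
  assumes "finite U" "\<And>u. u \<in> U \<Longrightarrow> norm u = 1" "\<And>u. u \<in> U \<Longrightarrow> 0 < h u" "bounded (hpoly U h)"
  shows "spanning_directions U"
proof
  fix e :: 'a assume e: "e \<noteq> 0"
  show "\<exists>u\<in>U. 0 < u \<bullet> e"
  proof (rule ccontr)
    assume neg: "\<not> ?thesis"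
    obtain B where B: "\<And>x. x \<in> hpoly U h \<Longrightarrow> norm x \<le> B" using assms(4) bounded_iff by blast
    let ?t = "(\<bar>B\<bar> + 1) / norm e"
    have "?t *\<^sub>R e \<in> hpoly U h"
      unfolding hpoly_def
    proof clarify
      fix u assume u: "u \<in> U"
      then have "?t * (u \<bullet> e) \<le> 0" using neg by (intro mult_nonneg_nonpos) auto
      then show "u \<bullet> (?t *\<^sub>R e) \<le> h u" using assms(3)[OF u] by simp
    qed
    then have "norm (?t *\<^sub>R e) \<le> B" by (rule B)
    then show False using e by simp
  qed
qed (use assms in auto)

definition facet :: "'a::euclidean_space set \<Rightarrow> ('a \<Rightarrow> real) \<Rightarrow> 'a \<Rightarrow> 'a set" where
  "facet U h u = {x \<in> hpoly U h. u \<bullet> x = h u}"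

text \<open>The factor \<open>C\<close> between Hausdorff measure and cone volume is a parameter of the locale, so that two polytopes
  can be compared with the same \<open>C\<close>.\<close>
locale spanning_directions_hausdorff = spanning_directions U for U :: "(real^'n::finite) set" +
  fixes C :: real and h :: "real^'n \<Rightarrow> real"
  assumes C: "0 < C"
    "\<And>(u::real^'n) r A. norm u = 1 \<Longrightarrow> 0 < r \<Longrightarrow> A \<in> sets borel \<Longrightarrow> A \<subseteq> {x. u \<bullet> x = r} \<Longrightarrow>
      ennreal r * hausdorff_measure (CARD('n) - 1) A =
      ennreal C * emeasure lborel {x. 0 < u \<bullet> x \<and> u \<bullet> x \<le> r \<and> (r / (u \<bullet> x)) *\<^sub>R x \<in> A}"
    and h: "\<And>u. u \<in> U \<Longrightarrow> 0 < h u"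
begin

abbreviation H :: "(real^'n) set \<Rightarrow> ennreal" where "H \<equiv> hausdorff_measure (CARD('n) - 1)"

lemma closed_facet: "closed (facet U h u)"
proof -
  have "facet U h u = hpoly U h \<inter> {x. u \<bullet> x = h u}" by (auto simp: facet_def)
  then show ?thesis using closed_hpoly[of h] closed_hyperplane[of u "h u"] by auto
qed

lemma cone_over_facet:
  assumes u: "u \<in> U"
  shows "{x. 0 < u \<bullet> x \<and> u \<bullet> x \<le> h u \<and> (h u / (u \<bullet> x)) *\<^sub>R x \<in> facet U h u} = wedge U h u (h u)"
proof -
  have "(h u / (u \<bullet> x)) *\<^sub>R x \<in> facet U h u \<longleftrightarrow> (\<forall>v\<in>U. h u * (v \<bullet> x) \<le> h v * (u \<bullet> x))" if "0 < u \<bullet> x" for x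
    using that by (simp add: facet_def hpoly_def pos_divide_le_eq)
  then show ?thesis by (auto simp: wedge_def)
qed

lemma hausdorff_facet:
  assumes u: "u \<in> U"
  shows "H (facet U h u) = ennreal (C * cone_volume U h u / h u)"
proof -
  have "ennreal (h u) * H (facet U h u) = ennreal C * emeasure lborel (wedge U h u (h u))"
    using C(2)[OF unit[OF u] h[OF u], of "facet U h u"] closed_facet[of u] cone_over_facet[OF u]
    by (auto simp: facet_def)
  also have "emeasure lborel (wedge U h u (h u)) = ennreal (cone_volume U h u)"
  proof -
    have "emeasure lebesgue (wedge U h u (h u)) = ennreal (measure lebesgue (wedge U h u (h u)))"
      by (rule emeasure_eq_measure2[OF wedge_lmeasurable[of h u, OF h[OF u]]])
    then show ?thesis using wedge_borel[of h u "h u"] by (simp add: cone_volume_def emeasure_completion)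
  qed
  finally have "ennreal (h u) * H (facet U h u) = ennreal (C * cone_volume U h u)"
    using C(1) cone_volume_nonneg by (simp add: ennreal_mult)
  moreover have "H (facet U h u) = (ennreal (1 / h u) * ennreal (h u)) * H (facet U h u)"
    using h[OF u] by (simp flip: ennreal_mult)
  ultimately have "H (facet U h u) = ennreal (1 / h u) * ennreal (C * cone_volume U h u)"
    by (simp add: mult.assoc)
  also have "\<dots> = ennreal (C * cone_volume U h u / h u)"
    using h[OF u] C(1) cone_volume_nonneg[of h u] by (simp flip: ennreal_mult)
  finally show ?thesis .
qed

text \<open>The cone over the intersection of two facets lies in a hyperplane through the origin.\<close>
lemma hausdorff_facet_Int:
  assumes uv: "u \<in> U" "v \<in> U" "u \<noteq> v"
  shows "H (facet U h u \<inter> facet U h v) = 0"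
proof -
  let ?K = "{x. 0 < u \<bullet> x \<and> u \<bullet> x \<le> h u \<and> (h u / (u \<bullet> x)) *\<^sub>R x \<in> facet U h u \<inter> facet U h v}"
  have "?K \<subseteq> {x. (h u *\<^sub>R v - h v *\<^sub>R u) \<bullet> x = 0}"
  proof
    fix x assume x: "x \<in> ?K"
    then have "v \<bullet> ((h u / (u \<bullet> x)) *\<^sub>R x) = h v" by (auto simp: facet_def)
    then show "x \<in> {x. (h u *\<^sub>R v - h v *\<^sub>R u) \<bullet> x = 0}" using x by (simp add: inner_diff_left field_simps)
  qed
  moreover have "negligible {x. (h u *\<^sub>R v - h v *\<^sub>R u) \<bullet> x = 0}"
    by (rule negligible_hyperplane[OF disjI1[OF normals_not_parallel[of h, OF h uv]]])
  ultimately have "negligible ?K" by (rule negligible_subset[rotated])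
  moreover have "emeasure lborel ?K \<le> emeasure lborel {x. (h u *\<^sub>R v - h v *\<^sub>R u) \<bullet> x = 0}"
    using \<open>?K \<subseteq> _\<close> closed_hyperplane[of "h u *\<^sub>R v - h v *\<^sub>R u" 0] by (intro emeasure_mono) auto
  moreover have "emeasure lborel {x. (h u *\<^sub>R v - h v *\<^sub>R u) \<bullet> x = 0} = 0"
    using \<open>negligible {x. (h u *\<^sub>R v - h v *\<^sub>R u) \<bullet> x = 0}\<close> closed_hyperplane[of "h u *\<^sub>R v - h v *\<^sub>R u" 0]
    by (simp add: negligible_iff_emeasure0 emeasure_completion)
  ultimately have K0: "emeasure lborel ?K = 0" by simp
  have "ennreal (h u) * H (facet U h u \<inter> facet U h v) = ennreal C * emeasure lborel ?K"
  proof (rule C(2)[OF unit[OF uv(1)] h[OF uv(1)]])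
    show "facet U h u \<inter> facet U h v \<in> sets borel" using closed_facet[of u] closed_facet[of v] by auto
    show "facet U h u \<inter> facet U h v \<subseteq> {x. u \<bullet> x = h u}" by (auto simp: facet_def)
  qed
  then have "ennreal (h u) * H (facet U h u \<inter> facet U h v) = 0" by (simp only: K0 mult_zero_right)
  then show ?thesis using h[OF uv(1)] by (simp add: ennreal_eq_0_iff)
qed

definition ridges :: "(real^'n) set" where
  "ridges = (\<Union>u\<in>U. \<Union>v\<in>U - {u}. facet U h u \<inter> facet U h v)"

lemma ridges_borel: "ridges \<in> sets borel"
  unfolding ridges_def using finite_U closed_facet by (intro sets.finite_UN sets.Int) auto

lemma hausdorff_ridges: "H ridges = 0"
proof -
  have "ridges \<in> null_sets (hausdorff_borel (CARD('n) - 1))"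
    unfolding ridges_def
  proof (intro null_sets.finite_UN finite_U finite_Diff)
    fix u v assume "u \<in> U" "v \<in> U - {u}"
    then show "facet U h u \<inter> facet U h v \<in> null_sets (hausdorff_borel (CARD('n) - 1))"
      using hausdorff_facet_Int[of u v] closed_facet[of u] closed_facet[of v]
      by (intro null_setsI) (auto simp: emeasure_hausdorff_borel)
  qed
  then show ?thesis using ridges_borel emeasure_hausdorff_borel by (metis null_setsD1)
qed

lemma hausdorff_Union_facets:
  assumes J: "J \<subseteq> U"
  shows "H (\<Union>u\<in>J. facet U h u) = (\<Sum>u\<in>J. H (facet U h u))"
proof -
  let ?M = "hausdorff_borel (CARD('n) - 1) :: (real^'n) measure"
  have finJ: "finite J" using J finite_U finite_subset by blast
  have bF: "facet U h u \<in> sets borel" for u using closed_facet by auto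
  have null: "ridges \<in> null_sets ?M"
    using ridges_borel hausdorff_ridges by (intro null_setsI) (auto simp: emeasure_hausdorff_borel)
  have em: "emeasure ?M (A - ridges) = H A" if "A \<in> sets borel" for A
    using emeasure_Diff_null_set[OF null, of A] that by (simp add: emeasure_hausdorff_borel)
  have "(\<Sum>u\<in>J. emeasure ?M (facet U h u - ridges)) = emeasure ?M (\<Union>u\<in>J. facet U h u - ridges)"
  proof (rule sum_emeasure)
    show "(\<lambda>u. facet U h u - ridges) ` J \<subseteq> sets ?M" using bF ridges_borel by auto
    show "disjoint_family_on (\<lambda>u. facet U h u - ridges) J"
      unfolding disjoint_family_on_def
    proof (intro ballI impI)
      fix u v assume "u \<in> J" "v \<in> J" "u \<noteq> v"
      then have "facet U h u \<inter> facet U h v \<subseteq> ridges" using J unfolding ridges_def by blast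
      then show "(facet U h u - ridges) \<inter> (facet U h v - ridges) = {}" by blast
    qed
  qed (rule finJ)
  also have "(\<Union>u\<in>J. facet U h u - ridges) = (\<Union>u\<in>J. facet U h u) - ridges" by blast
  also have "emeasure ?M \<dots> = H (\<Union>u\<in>J. facet U h u)"
    using finJ bF by (intro em sets.finite_UN) auto
  finally show ?thesis using em[OF bF] by simp
qed

text \<open>Away from the ridges a boundary point has exactly one outer unit normal. Otherwise a
  small step from the facet normal towards another normal would stay in the polytope.\<close>
lemma normal_points_subset:
  "{x \<in> frontier (hpoly U h). \<exists>w\<in>\<omega>. outer_normal (hpoly U h) x w} \<subseteq> (\<Union>u\<in>U \<inter> \<omega>. facet U h u) \<union> ridges"
proof
  fix x assume "x \<in> {x \<in> frontier (hpoly U h). \<exists>w\<in>\<omega>. outer_normal (hpoly U h) x w}"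
  then obtain w where xP: "x \<in> frontier (hpoly U h)" and w: "w \<in> \<omega>" "norm w = 1" "\<And>y. y \<in> hpoly U h \<Longrightarrow> w \<bullet> (y - x) \<le> 0"
    by (auto simp: outer_normal_def)
  have x: "x \<in> hpoly U h" using xP closed_hpoly[of h] by (auto simp: frontier_def)
  have ww: "w \<bullet> w = 1" using w(2) by (simp add: norm_eq_1)
  have step: False if d: "0 < w \<bullet> d" "\<And>u. u \<in> U \<Longrightarrow> u \<bullet> x = h u \<Longrightarrow> u \<bullet> d \<le> 0" for d
  proof -
    have "\<exists>e>0. \<forall>s. 0 < s \<and> s < e \<longrightarrow> u \<bullet> (x + s *\<^sub>R d) \<le> h u" if u: "u \<in> U" for u
    proof (cases "u \<bullet> x = h u")
      case True
      then have "u \<bullet> (x + s *\<^sub>R d) \<le> h u" if "0 < s" for s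
        using d(2)[OF u True] that by (simp add: inner_add_right mult_nonneg_nonpos)
      then show ?thesis by (intro exI[of _ 1]) auto
    next
      case False
      then have g: "0 < h u - u \<bullet> x" using x u by (auto simp: hpoly_def less_le)
      let ?e = "(h u - u \<bullet> x) / (\<bar>u \<bullet> d\<bar> + 1)"
      have "u \<bullet> (x + s *\<^sub>R d) \<le> h u" if s: "0 < s" "s < ?e" for s
      proof -
        have "s * (u \<bullet> d) \<le> s * (\<bar>u \<bullet> d\<bar> + 1)" using s(1) by (intro mult_left_mono) auto
        also have "\<dots> \<le> h u - u \<bullet> x" using s(2) by (simp add: pos_less_divide_eq less_imp_le)
        finally show ?thesis by (simp add: inner_add_right)
      qed
      then show ?thesis using g by (intro exI[of _ ?e]) auto
    qed
    then obtain e where e: "\<And>u. u \<in> U \<Longrightarrow> 0 < e u" "\<And>u s. u \<in> U \<Longrightarrow> 0 < s \<Longrightarrow> s < e u \<Longrightarrow> u \<bullet> (x + s *\<^sub>R d) \<le> h u"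
      by metis
    define s where "s = Min (e ` U) / 2"
    have m: "0 < Min (e ` U)" using e(1) finite_U U_nonempty by simp
    have "s < e u" if "u \<in> U" for u
    proof -
      have "Min (e ` U) \<le> e u" using finite_U that by (intro Min_le) auto
      then show ?thesis using m unfolding s_def by linarith
    qed
    moreover have s0: "0 < s" using m by (simp add: s_def)
    ultimately have "x + s *\<^sub>R d \<in> hpoly U h" using e(2) by (auto simp: hpoly_def)
    from w(3)[OF this] show False using s0 d(1) by (simp add: mult_le_0_iff)
  qed
  show "x \<in> (\<Union>u\<in>U \<inter> \<omega>. facet U h u) \<union> ridges"
  proof (rule ccontr)
    assume no: "x \<notin> (\<Union>u\<in>U \<inter> \<omega>. facet U h u) \<union> ridges"
    show False
    proof (cases "\<exists>u\<in>U. u \<bullet> x = h u")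
      case True
      then obtain u where u: "u \<in> U" "u \<bullet> x = h u" by blast
      then have "x \<in> facet U h u" using x by (simp add: facet_def)
      then have "u \<noteq> w" using no u(1) w(1) by blast
      have other: "v = u" if "v \<in> U" "v \<bullet> x = h v" for v
      proof (rule ccontr)
        assume "v \<noteq> u"
        moreover have "x \<in> facet U h v" using x that by (simp add: facet_def)
        ultimately have "x \<in> ridges" unfolding ridges_def using u(1) that(1) \<open>x \<in> facet U h u\<close> by blast
        then show False using no by blast
      qed
      have uu: "u \<bullet> u = 1" using unit[OF u(1)] by (simp add: norm_eq_1)
      have "0 < (w - u) \<bullet> (w - u)" using \<open>u \<noteq> w\<close> by simp
      then have "u \<bullet> w < 1" using ww uu by (simp add: inner_diff_left inner_diff_right inner_commute)
      show False
        by (rule step[of "w - u"])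
          (use \<open>u \<bullet> w < 1\<close> ww uu other in \<open>auto simp: inner_diff_right inner_commute\<close>)
    next
      case False
      show False by (rule step[of w]) (use False ww in auto)
    qed
  qed
qed

lemma facets_subset_normal_points:
  assumes "\<omega> \<subseteq> sphere 0 1"
  shows "(\<Union>u\<in>U \<inter> \<omega>. facet U h u) \<subseteq> {x \<in> frontier (hpoly U h). \<exists>w\<in>\<omega>. outer_normal (hpoly U h) x w}"
proof
  fix x assume "x \<in> (\<Union>u\<in>U \<inter> \<omega>. facet U h u)"
  then obtain u where u: "u \<in> U" "u \<in> \<omega>" "x \<in> hpoly U h" "u \<bullet> x = h u" by (auto simp: facet_def)
  have "outer_normal (hpoly U h) x u"
    using u unit by (auto simp: outer_normal_def inner_diff_right hpoly_def)
  moreover have "x \<notin> interior (hpoly U h)"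
  proof
    assume "x \<in> interior (hpoly U h)"
    then obtain e where e: "0 < e" "ball x e \<subseteq> interior (hpoly U h)" using open_contains_ball open_interior by blast
    have "x + (e / 2) *\<^sub>R u \<in> ball x e" using e(1) unit[OF u(1)] by (simp add: dist_norm)
    then have "x + (e / 2) *\<^sub>R u \<in> hpoly U h" using e(2) interior_subset by blast
    then have "u \<bullet> (x + (e / 2) *\<^sub>R u) \<le> h u" using u(1) by (auto simp: hpoly_def)
    then show False using u(4) e(1) unit[OF u(1)] by (simp add: inner_add_right norm_eq_1)
  qed
  ultimately show "x \<in> {x \<in> frontier (hpoly U h). \<exists>w\<in>\<omega>. outer_normal (hpoly U h) x w}"
    using u closure_subset[of "hpoly U h"] by (auto simp: frontier_def)
qed

lemma hausdorff_normal_points: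
  assumes "\<omega> \<subseteq> sphere 0 1"
  shows "H {x \<in> frontier (hpoly U h). \<exists>w\<in>\<omega>. outer_normal (hpoly U h) x w} =
    (\<Sum>u\<in>U \<inter> \<omega>. ennreal (C * cone_volume U h u / h u))"
proof -
  let ?F = "\<Union>u\<in>U \<inter> \<omega>. facet U h u"
  have "H {x \<in> frontier (hpoly U h). \<exists>w\<in>\<omega>. outer_normal (hpoly U h) x w} \<le> H (?F \<union> ridges)"
    by (rule hausdorff_measure_mono[OF normal_points_subset])
  also have "\<dots> \<le> H ?F + H ridges" by (rule hausdorff_measure_subadd)
  finally have "H {x \<in> frontier (hpoly U h). \<exists>w\<in>\<omega>. outer_normal (hpoly U h) x w} \<le> H ?F"
    by (simp only: hausdorff_ridges add_0_right)
  moreover have "H ?F \<le> H {x \<in> frontier (hpoly U h). \<exists>w\<in>\<omega>. outer_normal (hpoly U h) x w}"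
    by (rule hausdorff_measure_mono[OF facets_subset_normal_points[OF assms]])
  ultimately have "H {x \<in> frontier (hpoly U h). \<exists>w\<in>\<omega>. outer_normal (hpoly U h) x w} = H ?F" by (rule antisym)
  also have "\<dots> = (\<Sum>u\<in>U \<inter> \<omega>. H (facet U h u))" by (rule hausdorff_Union_facets) blast
  also have "\<dots> = (\<Sum>u\<in>U \<inter> \<omega>. ennreal (C * cone_volume U h u / h u))"
    by (intro sum.cong hausdorff_facet) auto
  finally show ?thesis .
qed

text \<open>Since the set function that defines the surface area measure agrees on the Borel sets with a
  discrete measure, it is countably additive there and generates that measure.\<close>
lemma surface_area_measure_hpoly:
  "surface_area_measure (hpoly U h) =
    distr (point_measure U (\<lambda>u. ennreal (C * cone_volume U h u / h u))) (restrict_space borel (sphere 0 1)) (\<lambda>u. u)"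
    (is "_ = ?D")
proof -
  let ?R = "restrict_space borel (sphere (0::real^'n) 1)"
  have sp: "space ?R = sphere 0 1" by (simp add: space_restrict_space)
  have m: "(\<lambda>u. u) \<in> point_measure U (\<lambda>u. ennreal (C * cone_volume U h u / h u)) \<rightarrow>\<^sub>M ?R"
    using unit by (auto simp: measurable_point_measure_eq1 sp)
  have "surface_area_measure (hpoly U h) = measure_of (space ?D) (sets ?D) (emeasure ?D)"
    unfolding surface_area_measure_def
  proof (simp only: space_distr sets_distr sp, rule measure_of_eq)
    show "sets ?R \<subseteq> Pow (sphere 0 1)" using sets.space_closed[of ?R] sp by simp
    fix \<omega> assume "\<omega> \<in> sigma_sets (sphere 0 1) (sets ?R)"
    then have \<omega>: "\<omega> \<in> sets ?R" using sets.sigma_sets_eq[of ?R] sp by simp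
    then have sub: "\<omega> \<subseteq> sphere 0 1" using sets.sets_into_space[of \<omega> ?R] sp by simp
    have "emeasure ?D \<omega> = emeasure (point_measure U (\<lambda>u. ennreal (C * cone_volume U h u / h u))) ((\<lambda>u. u) -` \<omega> \<inter> U)"
      using \<omega> m by (simp add: emeasure_distr space_point_measure)
    also have "\<dots> = (\<Sum>u\<in>U \<inter> \<omega>. ennreal (C * cone_volume U h u / h u))"
      using finite_U by (subst emeasure_point_measure_finite) (auto simp: Int_commute intro!: sum.cong)
    finally show "hausdorff_measure (DIM(real^'n) - 1) {x \<in> frontier (hpoly U h). \<exists>w\<in>\<omega>. outer_normal (hpoly U h) x w} = emeasure ?D \<omega>"
      using hausdorff_normal_points[OF sub] by simp
  qed
  also have "\<dots> = ?D" by (rule measure_of_of_measure)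
  finally show ?thesis .
qed

lemma Lp_surface_integral_hpoly:
  assumes tight: "\<And>u. u \<in> U \<Longrightarrow> support_fun (hpoly U h) u = h u"
    and \<Psi>: "continuous_on UNIV \<Psi>" "\<And>x. 0 \<le> \<Psi> x" and p: "0 < p"
  shows "(\<integral>\<^sup>+ u. ennreal (\<Psi> u powr p) \<partial>Lp_surface_area_measure p (hpoly U h)) =
    ennreal (C * (\<Sum>u\<in>U. (\<Psi> u / h u) powr p * cone_volume U h u))"
proof -
  let ?R = "restrict_space borel (sphere (0::real^'n) 1)"
  let ?c = "\<lambda>u. ennreal (C * cone_volume U h u / h u)"
  let ?D = "distr (point_measure U ?c) ?R (\<lambda>u. u)"
  let ?s = "\<lambda>u. ennreal (support_fun (hpoly U h) u powr (1 - p))"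
  let ?g = "\<lambda>u. ennreal (\<Psi> u powr p)"
  have sp: "space ?R = sphere 0 1" by (simp add: space_restrict_space)
  have m: "(\<lambda>u. u) \<in> point_measure U ?c \<rightarrow>\<^sub>M ?R"
    using unit by (auto simp: measurable_point_measure_eq1 sp)
  have ne: "hpoly U h \<noteq> {}" using zero_in_interior_hpoly[of h, OF h] interior_subset by blast
  have "support_fun (hpoly U h) \<in> borel_measurable borel"
    by (rule borel_measurable_continuous_onI[OF support_fun_continuous[OF compact_hpoly ne]])
  then have "?s \<in> borel_measurable borel" by measurable
  then have ms: "?s \<in> borel_measurable ?R" by (rule measurable_restrict_space1)
  have "\<Psi> \<in> borel_measurable borel" by (rule borel_measurable_continuous_onI[OF \<Psi>(1)])
  then have "?g \<in> borel_measurable borel" by measurable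
  then have mg: "?g \<in> borel_measurable ?R" by (rule measurable_restrict_space1)
  have "(\<integral>\<^sup>+ u. ?g u \<partial>Lp_surface_area_measure p (hpoly U h)) = (\<integral>\<^sup>+ u. ?s u * ?g u \<partial>?D)"
    unfolding Lp_surface_area_measure_def surface_area_measure_hpoly
    using ms mg by (intro nn_integral_density) simp_all
  also have "\<dots> = (\<integral>\<^sup>+ u. ?s u * ?g u \<partial>point_measure U ?c)"
    using ms mg m by (intro nn_integral_distr) simp_all
  also have "\<dots> = (\<Sum>u\<in>U. ?c u * (?s u * ?g u))"
    using finite_U by (intro nn_integral_point_measure_finite)
  also have "\<dots> = (\<Sum>u\<in>U. ennreal (C * ((\<Psi> u / h u) powr p * cone_volume U h u)))"
  proof (rule sum.cong)
    fix u assume u: "u \<in> U"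
    have "?c u * (?s u * ?g u) = ennreal ((C * cone_volume U h u / h u) * (h u powr (1 - p) * \<Psi> u powr p))"
    proof -
      have "0 \<le> C * cone_volume U h u / h u" using h[OF u] C(1) cone_volume_nonneg[of h u] by simp
      then show ?thesis by (simp only: tight[OF u] ennreal_mult'[symmetric] ennreal_mult[symmetric] powr_ge_zero mult_nonneg_nonneg)
    qed
    also have "(C * cone_volume U h u / h u) * (h u powr (1 - p) * \<Psi> u powr p) = C * ((\<Psi> u / h u) powr p * cone_volume U h u)"
      using h[OF u] \<Psi>(2)[of u] by (simp add: powr_diff powr_divide)
    finally show "?c u * (?s u * ?g u) = ennreal (C * ((\<Psi> u / h u) powr p * cone_volume U h u))" .
  qed simp
  also have "\<dots> = ennreal (\<Sum>u\<in>U. C * ((\<Psi> u / h u) powr p * cone_volume U h u))"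
    using C(1) cone_volume_nonneg by (intro sum_ennreal) simp
  finally show ?thesis by (simp add: sum_distrib_left)
qed

end

section \<open>Polytopes and their \<open>L\<^sub>p\<close> surface area measures\<close>

text \<open>A face over which the cone has positive volume is not empty, so its support number is attained.\<close>
lemma hpoly_support_fun_eq:
  assumes "spanning_directions U" "\<And>u. u \<in> U \<Longrightarrow> 0 < h u" "u \<in> U" "0 < cone_volume U h u"
  shows "support_fun (hpoly U h) u = h u"
proof -
  interpret spanning_directions U by fact
  have h: "0 < h v" if "v \<in> U" for v using assms(2) that .
  have "wedge U h u (h u) \<noteq> {}" using assms(4) by (auto simp: cone_volume_def)
  then obtain x where x: "x \<in> wedge U h u (h u)" by blast
  then have ux: "0 < u \<bullet> x" by (simp add: wedge_def)
  let ?y = "(h u / (u \<bullet> x)) *\<^sub>R x"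
  have "?y \<in> hpoly U h"
    using x ux by (simp add: hpoly_def wedge_def pos_divide_le_eq)
  then have "u \<bullet> ?y \<le> support_fun (hpoly U h) u" by (rule support_fun_upper[OF bounded_hpoly])
  then have "h u \<le> support_fun (hpoly U h) u" using ux by simp
  moreover have "hpoly U h \<noteq> {}" using \<open>?y \<in> hpoly U h\<close> by blast
  then have "support_fun (hpoly U h) u \<le> h u"
    unfolding support_fun_def using assms(3) by (intro cSUP_least) (auto simp: hpoly_def)
  ultimately show ?thesis by simp
qed

lemma hpoly_in_polytopes0:
  assumes "spanning_directions U" "\<And>u. u \<in> U \<Longrightarrow> 0 < h u"
  shows "hpoly U h \<in> polytopes0"
proof -
  interpret spanning_directions U by fact
  have "hpoly U h = (\<Inter>u\<in>U. {x. u \<bullet> x \<le> h u})" by (auto simp: hpoly_def)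
  then have "polyhedron (hpoly U h)"
    using finite_U by (auto intro!: polyhedron_Inter polyhedron_halfspace_le)
  then have "polytope (hpoly U h)" using bounded_hpoly polytope_eq_bounded_polyhedron by blast
  then show ?thesis using zero_in_interior_hpoly[of h, OF assms(2)] by (simp add: polytopes0_def)
qed

text \<open>Describe both polytopes by the union \<open>U\<close> of their sets of normals and take their own support functions as
  test functions \<open>\<Psi>\<close>.\<close>
lemma Lp_surface_measure_determines_polytope:
  fixes P Q :: "(real^'n::finite) set" and p :: real
  assumes p: "1 < p" "p \<noteq> real CARD('n)" and PQ: "P \<in> polytopes0" "Q \<in> polytopes0"
    and eq: "\<And>\<Psi>. continuous_on UNIV \<Psi> \<Longrightarrow> (\<And>x. 0 \<le> \<Psi> x) \<Longrightarrow> positively_homogeneous \<Psi> \<Longrightarrow>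
      (\<integral>\<^sup>+ u. ennreal (\<Psi> u powr p) \<partial>Lp_surface_area_measure p P) =
      (\<integral>\<^sup>+ u. ennreal (\<Psi> u powr p) \<partial>Lp_surface_area_measure p Q)"
  shows "P = Q"
proof -
  obtain C :: real where C: "0 < C"
    "\<And>(u::real^'n) r A. norm u = 1 \<Longrightarrow> 0 < r \<Longrightarrow> A \<in> sets borel \<Longrightarrow> A \<subseteq> {x. u \<bullet> x = r} \<Longrightarrow>
      ennreal r * hausdorff_measure (CARD('n) - 1) A =
      ennreal C * emeasure lborel {x. 0 < u \<bullet> x \<and> u \<bullet> x \<le> r \<and> (r / (u \<bullet> x)) *\<^sub>R x \<in> A}"
    by (rule hausdorff_measure_cone_volume[where 'n = 'n]) (rule that)
  have bd: "compact K" "bounded K" "0 \<in> interior K" "0 \<in> K" "K \<noteq> {}" if "K \<in> polytopes0" for K :: "(real^'n) set"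
    using that interior_subset[of K] polytope_imp_compact[of K] polytope_imp_bounded[of K] by (auto simp: polytopes0_def)
  obtain U1 where U1: "finite U1" "\<And>u. u \<in> U1 \<Longrightarrow> norm u = 1" "\<And>U'. U1 \<subseteq> U' \<Longrightarrow> P = hpoly U' (support_fun P)"
    by (rule polytopes0_eq_hpoly[OF PQ(1)]) (rule that)
  obtain U2 where U2: "finite U2" "\<And>u. u \<in> U2 \<Longrightarrow> norm u = 1" "\<And>U'. U2 \<subseteq> U' \<Longrightarrow> Q = hpoly U' (support_fun Q)"
    by (rule polytopes0_eq_hpoly[OF PQ(2)]) (rule that)
  define U where "U = U1 \<union> U2"
  let ?h = "support_fun P" and ?k = "support_fun Q"
  have nU: "norm u = 1" if "u \<in> U" for u using that U1(1,2) U2(1,2) by (auto simp: U_def)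
  have P: "P = hpoly U ?h" and Q: "Q = hpoly U ?k" using U1(3)[of U] U2(3)[of U] by (simp_all add: U_def)
  have h: "0 < ?h u" and k: "0 < ?k u" if "u \<in> U" for u
    using support_fun_pos[OF bd(2,3)[OF PQ(1)] nU[OF that]] support_fun_pos[OF bd(2,3)[OF PQ(2)] nU[OF that]] by blast+
  have "spanning_directions U"
  proof (rule bounded_hpoly_imp_spanning[of U ?h])
    show "finite U" using U1(1) U2(1) by (simp add: U_def)
    show "bounded (hpoly U ?h)" using bd(2)[OF PQ(1)] P by simp
  qed (use nU h in auto)
  then interpret spanning_directions U .
  interpret P: spanning_directions_hausdorff U C ?h by unfold_locales (use C h in auto)
  interpret Q: spanning_directions_hausdorff U C ?k by unfold_locales (use C k in auto)
  have int: "C * (\<Sum>u\<in>U. (\<Psi> u / ?h u) powr p * cone_volume U ?h u) = C * (\<Sum>u\<in>U. (\<Psi> u / ?k u) powr p * cone_volume U ?k u)"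
    if \<Psi>: "continuous_on UNIV \<Psi>" "\<And>x. 0 \<le> \<Psi> x" "positively_homogeneous \<Psi>" for \<Psi>
  proof -
    have "(\<integral>\<^sup>+ u. ennreal (\<Psi> u powr p) \<partial>Lp_surface_area_measure p P) = ennreal (C * (\<Sum>u\<in>U. (\<Psi> u / ?h u) powr p * cone_volume U ?h u))"
      using P.Lp_surface_integral_hpoly[of \<Psi> p, OF _ \<Psi>(1,2)] p(1) by (simp flip: P)
    moreover have "(\<integral>\<^sup>+ u. ennreal (\<Psi> u powr p) \<partial>Lp_surface_area_measure p Q) = ennreal (C * (\<Sum>u\<in>U. (\<Psi> u / ?k u) powr p * cone_volume U ?k u))"
      using Q.Lp_surface_integral_hpoly[of \<Psi> p, OF _ \<Psi>(1,2)] p(1) by (simp flip: Q)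
    ultimately have "ennreal (C * (\<Sum>u\<in>U. (\<Psi> u / ?h u) powr p * cone_volume U ?h u)) = ennreal (C * (\<Sum>u\<in>U. (\<Psi> u / ?k u) powr p * cone_volume U ?k u))"
      using eq[OF \<Psi>] by simp
    then show ?thesis
      using C(1) cone_volume_nonneg by (subst (asm) ennreal_inj) (auto intro!: mult_nonneg_nonneg sum_nonneg)
  qed
  have self: "(\<Sum>u\<in>U. (g u / g u) powr p * cone_volume U g u) = V g" if g: "\<And>u. u \<in> U \<Longrightarrow> 0 < g u" for g
  proof -
    have "(\<Sum>u\<in>U. (g u / g u) powr p * cone_volume U g u) = (\<Sum>u\<in>U. cone_volume U g u)"
      by (intro sum.cong refl) (use g in force)
    then show ?thesis using V_eq_sum_cone_volume[of g, OF g] by simp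
  qed
  have "(\<Sum>u\<in>U. (?k u / ?h u) powr p * cone_volume U ?h u) = V ?k"
    using int[of ?k] self[of ?k, OF k] support_fun_continuous[OF bd(1,5)[OF PQ(2)]] support_fun_nonneg[OF bd(2,4)[OF PQ(2)]]
      support_fun_homogeneous[OF bd(1,5)[OF PQ(2)]] C(1) by simp
  moreover have "(\<Sum>u\<in>U. (?h u / ?k u) powr p * cone_volume U ?k u) = V ?h"
    using int[of ?h] self[of ?h, OF h] support_fun_continuous[OF bd(1,5)[OF PQ(1)]] support_fun_nonneg[OF bd(2,4)[OF PQ(1)]]
      support_fun_homogeneous[OF bd(1,5)[OF PQ(1)]] C(1) by simp
  ultimately have "hpoly U ?h = hpoly U ?k"
    using p by (intro Lp_minkowski_uniqueness[of p]) (simp_all add: h k)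
  then show ?thesis using P Q by simp
qed

text \<open>The weights are divided by \<open>C\<close> before the discrete problem is solved, because each cone volume enters the
  surface area measure with the factor \<open>C\<close>.\<close>
lemma Lp_surface_measure_prescribed:
  fixes U :: "(real^'n::finite) set" and p :: real
  assumes U: "spanning_directions U" and \<alpha>: "\<And>u. u \<in> U \<Longrightarrow> 0 < \<alpha> u" and p: "1 < p" "p \<noteq> real CARD('n)"
  obtains P where "P \<in> polytopes0"
    "\<And>\<Psi>. continuous_on UNIV \<Psi> \<Longrightarrow> (\<And>x. 0 \<le> \<Psi> x) \<Longrightarrow>
      (\<integral>\<^sup>+ u. ennreal (\<Psi> u powr p) \<partial>Lp_surface_area_measure p P) = ennreal (\<Sum>u\<in>U. \<alpha> u * \<Psi> u powr p)"
proof -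
  interpret spanning_directions U by fact
  obtain C :: real where C: "0 < C"
    "\<And>(u::real^'n) r A. norm u = 1 \<Longrightarrow> 0 < r \<Longrightarrow> A \<in> sets borel \<Longrightarrow> A \<subseteq> {x. u \<bullet> x = r} \<Longrightarrow>
      ennreal r * hausdorff_measure (CARD('n) - 1) A =
      ennreal C * emeasure lborel {x. 0 < u \<bullet> x \<and> u \<bullet> x \<le> r \<and> (r / (u \<bullet> x)) *\<^sub>R x \<in> A}"
    by (rule hausdorff_measure_cone_volume[where 'n = 'n]) (rule that)
  have "0 < \<alpha> u / C" if "u \<in> U" for u using \<alpha>[OF that] C(1) by simp
  then obtain h where h: "\<And>u. u \<in> U \<Longrightarrow> 0 < h u" "\<And>u. u \<in> U \<Longrightarrow> cone_volume U h u = \<alpha> u / C * h u powr p"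
    using Lp_minkowski_existence[of "\<lambda>u. \<alpha> u / C" p] p by auto
  interpret H: spanning_directions_hausdorff U C h by unfold_locales (use C h in auto)
  show thesis
  proof
    show "hpoly U h \<in> polytopes0" using U h(1) by (rule hpoly_in_polytopes0)
    fix \<Psi> :: "real^'n \<Rightarrow> real" assume \<Psi>: "continuous_on UNIV \<Psi>" "\<And>x. 0 \<le> \<Psi> x"
    have tight: "support_fun (hpoly U h) u = h u" if u: "u \<in> U" for u
    proof (rule hpoly_support_fun_eq[OF U h(1) u])
      show "0 < cone_volume U h u" using h[OF u] \<alpha>[OF u] C(1) by simp
    qed
    have "(\<integral>\<^sup>+ u. ennreal (\<Psi> u powr p) \<partial>Lp_surface_area_measure p (hpoly U h)) =
        ennreal (C * (\<Sum>u\<in>U. (\<Psi> u / h u) powr p * cone_volume U h u))"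
      using tight \<Psi> p(1) by (intro H.Lp_surface_integral_hpoly) auto
    also have "C * (\<Sum>u\<in>U. (\<Psi> u / h u) powr p * cone_volume U h u) = (\<Sum>u\<in>U. \<alpha> u * \<Psi> u powr p)"
      unfolding sum_distrib_left
    proof (rule sum.cong)
      fix u assume u: "u \<in> U"
      show "C * ((\<Psi> u / h u) powr p * cone_volume U h u) = \<alpha> u * \<Psi> u powr p"
        using h[OF u] \<Psi>(2)[of u] C(1) by (simp add: powr_divide)
    qed simp
    finally show "(\<integral>\<^sup>+ u. ennreal (\<Psi> u powr p) \<partial>Lp_surface_area_measure p (hpoly U h)) = ennreal (\<Sum>u\<in>U. \<alpha> u * \<Psi> u powr p)" .
  qed
qed

theorem theorem1:
  fixes f :: "real ^ 'n \<Rightarrow> real" and p :: real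
  assumes "1 < p" and "p \<noteq> real CARD('n)"
    and "f \<in> piecewise_affine" and "\<exists>x. f x \<noteq> 0"
  shows "\<exists>!P. P \<in> polytopes0 \<and>
    (\<forall>\<Psi> :: real ^ 'n \<Rightarrow> real.
       continuous_on UNIV \<Psi> \<and> (\<forall>x. 0 \<le> \<Psi> x) \<and> positively_homogeneous \<Psi> \<longrightarrow>
       of_nat CARD('n) * (\<integral>\<^sup>+ x. ennreal (\<Psi> (- gradient f x) powr p) \<partial>lebesgue) =
       (\<integral>\<^sup>+ u. ennreal (\<Psi> u powr p) \<partial>Lp_surface_area_measure p P))"
proof (rule ex_ex1I)
  let ?n = "real CARD('n)"
  obtain x0 where x0: "f x0 \<noteq> 0" using assms(4) by blast
  have p0: "0 < p" using assms(1) by simp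
  obtain U \<alpha> where U: "spanning_directions U" and \<alpha>: "\<And>u. u \<in> U \<Longrightarrow> 0 < \<alpha> u"
    and integral: "\<And>\<Psi>. (\<And>x. 0 \<le> \<Psi> x) \<Longrightarrow> positively_homogeneous \<Psi> \<Longrightarrow>
      (\<integral>\<^sup>+ x. ennreal (\<Psi> (- gradient f x) powr p) \<partial>lebesgue) = ennreal (\<Sum>u\<in>U. \<alpha> u * \<Psi> u powr p)"
    by (rule piecewise_affine_gradient_integral[OF assms(3) x0 p0]) (rule that, assumption, blast, simp)
  have n\<alpha>: "0 < ?n * \<alpha> u" if "u \<in> U" for u using \<alpha>[OF that] by simp
  obtain P where P: "P \<in> polytopes0"
    "\<And>\<Psi>. continuous_on UNIV \<Psi> \<Longrightarrow> (\<And>x. 0 \<le> \<Psi> x) \<Longrightarrow>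
      (\<integral>\<^sup>+ u. ennreal (\<Psi> u powr p) \<partial>Lp_surface_area_measure p P) = ennreal (\<Sum>u\<in>U. ?n * \<alpha> u * \<Psi> u powr p)"
    by (rule Lp_surface_measure_prescribed[of U "\<lambda>u. ?n * \<alpha> u" p, OF U n\<alpha> assms(1,2)]) (assumption, rule that, assumption, blast)
  have "of_nat CARD('n) * (\<integral>\<^sup>+ x. ennreal (\<Psi> (- gradient f x) powr p) \<partial>lebesgue) =
       (\<integral>\<^sup>+ u. ennreal (\<Psi> u powr p) \<partial>Lp_surface_area_measure p P)"
    if \<Psi>: "continuous_on UNIV \<Psi> \<and> (\<forall>x. 0 \<le> \<Psi> x) \<and> positively_homogeneous \<Psi>" for \<Psi>
  proof -
    have nn: "\<And>x. 0 \<le> \<Psi> x" using \<Psi> by blast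
    have "0 \<le> (\<Sum>u\<in>U. \<alpha> u * \<Psi> u powr p)" using less_imp_le[OF \<alpha>] by (intro sum_nonneg) simp
    then have "of_nat CARD('n) * ennreal (\<Sum>u\<in>U. \<alpha> u * \<Psi> u powr p) = ennreal (?n * (\<Sum>u\<in>U. \<alpha> u * \<Psi> u powr p))"
      by (simp add: ennreal_mult ennreal_of_nat_eq_real_of_nat)
    also have "?n * (\<Sum>u\<in>U. \<alpha> u * \<Psi> u powr p) = (\<Sum>u\<in>U. ?n * \<alpha> u * \<Psi> u powr p)"
      by (simp add: sum_distrib_left mult.assoc)
    finally show ?thesis using integral[of \<Psi>, OF nn] P(2)[of \<Psi>, OF _ nn] \<Psi> by simp
  qed
  then show "\<exists>P. P \<in> polytopes0 \<and>
    (\<forall>\<Psi> :: real ^ 'n \<Rightarrow> real.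
       continuous_on UNIV \<Psi> \<and> (\<forall>x. 0 \<le> \<Psi> x) \<and> positively_homogeneous \<Psi> \<longrightarrow>
       of_nat CARD('n) * (\<integral>\<^sup>+ x. ennreal (\<Psi> (- gradient f x) powr p) \<partial>lebesgue) =
       (\<integral>\<^sup>+ u. ennreal (\<Psi> u powr p) \<partial>Lp_surface_area_measure p P))"
    using P(1) by blast
next
  fix P Q :: "(real^'n) set"
  assume P: "P \<in> polytopes0 \<and>
    (\<forall>\<Psi> :: real ^ 'n \<Rightarrow> real.
       continuous_on UNIV \<Psi> \<and> (\<forall>x. 0 \<le> \<Psi> x) \<and> positively_homogeneous \<Psi> \<longrightarrow>
       of_nat CARD('n) * (\<integral>\<^sup>+ x. ennreal (\<Psi> (- gradient f x) powr p) \<partial>lebesgue) =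
       (\<integral>\<^sup>+ u. ennreal (\<Psi> u powr p) \<partial>Lp_surface_area_measure p P))"
    and Q: "Q \<in> polytopes0 \<and>
    (\<forall>\<Psi> :: real ^ 'n \<Rightarrow> real.
       continuous_on UNIV \<Psi> \<and> (\<forall>x. 0 \<le> \<Psi> x) \<and> positively_homogeneous \<Psi> \<longrightarrow>
       of_nat CARD('n) * (\<integral>\<^sup>+ x. ennreal (\<Psi> (- gradient f x) powr p) \<partial>lebesgue) =
       (\<integral>\<^sup>+ u. ennreal (\<Psi> u powr p) \<partial>Lp_surface_area_measure p Q))"
  show "P = Q"
  proof (rule Lp_surface_measure_determines_polytope[OF assms(1,2) conjunct1[OF P] conjunct1[OF Q]])
    fix \<Psi> :: "real^'n \<Rightarrow> real"
    assume "continuous_on UNIV \<Psi>" "\<And>x. 0 \<le> \<Psi> x" "positively_homogeneous \<Psi>"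
    then have \<Psi>: "continuous_on UNIV \<Psi> \<and> (\<forall>x. 0 \<le> \<Psi> x) \<and> positively_homogeneous \<Psi>" by blast
    show "(\<integral>\<^sup>+ u. ennreal (\<Psi> u powr p) \<partial>Lp_surface_area_measure p P) =
      (\<integral>\<^sup>+ u. ennreal (\<Psi> u powr p) \<partial>Lp_surface_area_measure p Q)"
      using conjunct2[OF P, rule_format, OF \<Psi>] conjunct2[OF Q, rule_format, OF \<Psi>] by (rule trans[OF sym])
  qed
qed

end
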